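(* Let $A=(q,q^4;q^5)_\infty$, $B=(q^2,q^3;q^5)_\infty$, $E_1=(q;q)_\infty$, $E_5=(q^5;q^5)_\infty$ and $S=\sum_{n=-\infty}^{\infty}(-1)^n n\, q^{n(5n+1)/2}$. For $r\in\{2,4\}$ write $G_r(q)=\sum_{n\ge0}\big[NB_5(1,5,5n+r)-NB_5(4,5,5n+r)+3NB_5(2,5,5n+r)-3NB_5(3,5,5n+r)\big]q^n$. Then \begin{align*} G_2(q)=\;&-70q^5\frac{A^{11}E_5^{17}}{B^{13}E_1^{18}}+2165q^4\frac{A^6E_5^{17}}{B^8E_1^{18}}-\frac{3265}{2}q^3\frac{A\,E_5^{17}}{B^3E_1^{18}}+\frac{5745}{2}q^2\frac{B^2E_5^{17}}{A^4E_1^{18}}+\frac{1965}{2}q\frac{B^7E_5^{17}}{A^9E_1^{18}}+\frac{35}{2}\frac{B^{12}E_5^{17}}{A^{14}E_1^{18}}\\ &+10q^4\frac{A^9E_5^{15}}{B^{10}E_1^{18}}-45q^3\frac{A^4E_5^{15}}{B^5E_1^{18}}-\frac{165}{2}q^2\frac{E_5^{15}}{A\,E_1^{18}}-200q\frac{B^5E_5^{15}}{A^6E_1^{18}}-\frac{15}{2}\frac{B^{10}E_5^{15}}{A^{11}E_1^{18}},\\[4pt] G_4(q)=\;&5S\Big(2q^4\frac{A^{11}E_5^{14}}{B^{13}E_1^{18}}-q^3\frac{A^6E_5^{14}}{B^8E_1^{18}}+2108q^2\frac{A\,E_5^{14}}{B^3E_1^{18}}-4q\frac{B^2E_5^{14}}{A^4E_1^{18}}-3\frac{B^7E_5^{14}}{A^9E_1^{18}}-5q^3\frac{A^9E_5^{12}}{B^{10}E_1^{18}}+30q^2\frac{A^4E_5^{12}}{B^5E_1^{18}}\Big)\\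 &-\frac52q^5\frac{A^{13}E_5^{17}}{B^{15}E_1^{18}}+825q^4\frac{A^8E_5^{17}}{B^{10}E_1^{18}}+\frac{1865}{2}q^2\frac{E_5^{17}}{A^2E_1^{18}}+\frac{4125}{2}q\frac{B^5E_5^{17}}{A^7E_1^{18}}+\frac{275}{2}\frac{B^{10}E_5^{17}}{A^{12}E_1^{18}}\\ &-5q^4\frac{A^{11}E_5^{15}}{B^{12}E_1^{18}}+\frac{1895}{2}q^2\frac{A\,E_5^{15}}{B^2E_1^{18}}-245q\frac{B^3E_5^{15}}{A^4E_1^{18}}-\frac{95}{2}\frac{B^8E_5^{15}}{A^9E_1^{18}}-\frac52q^3\frac{A^9E_5^{13}}{B^9E_1^{18}}+15q^2\frac{A^4E_5^{13}}{B^4E_1^{18}}. \end{align*}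
   Context: Notation: $(a;q)_\infty=\prod_{n\ge0}(1-aq^n)$ and $(a_1,\dots,a_t;q)_\infty=(a_1;q)_\infty\cdots(a_t;q)_\infty$; identities are of formal power series in $q$ (equivalently analytic for $|q|<1$). For $k\ge2$, a $k$-colored partition of $n\ge0$ is a $k$-tuple $\pi=(\pi^{(1)},\dots,\pi^{(k)})$ of ordinary partitions with $|\pi^{(1)}|+\cdots+|\pi^{(k)}|=n$ (written $\pi\vdash n$); $\#(\pi^{(i)})$ is the number of parts of $\pi^{(i)}$, and $\mathrm{crank}_k(\pi)=\#(\pi^{(1)})-\#(\pi^{(2)})$. For $k\ge2$, $j\ge2$, $0\le m\le j-1$, $n\ge0$, $$NB_k(m,j,n)=\sum_{\pi\vdash n,\ \mathrm{crank}_k(\pi)\equiv m \pmod j}\#(\pi^{(1)}).$$ *)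

theory Defs
  imports
    "HOL-Analysis.Analysis"
    "HOL-Computational_Algebra.Formal_Power_Series"
    "HOL-Number_Theory.Cong"
begin

text \<open>
  Identities are between formal power series over \<open>\<complex>\<close>. Infinite products and sums are the
  library's \<^const>\<open>prodinf\<close> and \<^const>\<open>infsum\<close>, taken in the library's metric on \<open>complex fps\<close>
  (two series are close iff they agree on a long initial segment of coefficients).
\<close>

definition qpoch :: "'a::{t2_space, comm_ring_1} \<Rightarrow> 'a \<Rightarrow> 'a" where
  "qpoch a q = (\<Prod>n. 1 - a * q ^ n)"

definition qpochs :: "'a::{t2_space, comm_ring_1} list \<Rightarrow> 'a \<Rightarrow> 'a" where
  "qpochs as q = (\<Prod>a\<leftarrow>as. qpoch a q)"

text \<open>
  An ordinary partition is the multiset of its (positive) parts, so that the number partitioned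
  is \<^const>\<open>sum_mset\<close> and the number of parts is \<^const>\<open>size\<close>. The component \<open>\<pi>\<^sup>(\<^sup>i\<^sup>)\<close> of a
  \<open>k\<close>-colored partition is \<open>\<pi> ! (i - 1)\<close>.
\<close>

definition is_partition :: "nat multiset \<Rightarrow> bool" where
  "is_partition p \<longleftrightarrow> 0 \<notin># p"

definition colored_partitions :: "nat \<Rightarrow> nat \<Rightarrow> nat multiset list set" where
  "colored_partitions k n =
     {\<pi>. length \<pi> = k \<and> (\<forall>p\<in>set \<pi>. is_partition p) \<and> (\<Sum>p\<leftarrow>\<pi>. sum_mset p) = n}"

text \<open>Meaningful for \<open>k \<ge> 2\<close> colors only.\<close>

definition crank :: "nat multiset list \<Rightarrow> int" where
  "crank \<pi> = int (size (\<pi> ! 0)) - int (size (\<pi> ! 1))"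

definition NB :: "nat \<Rightarrow> nat \<Rightarrow> nat \<Rightarrow> nat \<Rightarrow> nat" where
  "NB k m j n =
     (\<Sum>\<pi> | \<pi> \<in> colored_partitions k n \<and> [crank \<pi> = int m] (mod int j). size (\<pi> ! 0))"

text \<open>
  The following facts show that the sum, the products and the series used below do not degenerate
  to the default values of \<^const>\<open>sum\<close>, \<^const>\<open>prodinf\<close> and \<^const>\<open>infsum\<close>.
\<close>

lemma finite_partitions_le: "finite {p. is_partition p \<and> sum_mset p \<le> n}"
proof (rule finite_subset)
  show "{p. is_partition p \<and> sum_mset p \<le> n} \<subseteq> mset ` {xs. set xs \<subseteq> {..n} \<and> length xs \<le> n}"
  proof
    fix p assume p: "p \<in> {p. is_partition p \<and> sum_mset p \<le> n}"
    have size: "is_partition r \<Longrightarrow> size r \<le> sum_mset r" for r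
      by (induction r) (auto simp: is_partition_def)
    obtain xs where xs: "p = mset xs" by (metis ex_mset)
    have "set xs \<subseteq> {..n}"
    proof
      fix x assume "x \<in> set xs"
      then have "x \<in># p" using xs by simp
      then have "x \<le> sum_mset p" by (metis le_add1 multi_member_split sum_mset.add_mset)
      then show "x \<in> {..n}" using p by simp
    qed
    moreover have "length xs \<le> n"
      using size[of p] p xs by auto
    ultimately show "p \<in> mset ` {xs. set xs \<subseteq> {..n} \<and> length xs \<le> n}"
      using xs by blast
  qed
  show "finite (mset ` {xs. set xs \<subseteq> {..n} \<and> length xs \<le> n})"
    by (intro finite_imageI finite_lists_length_le) simp
qed

lemma finite_colored_partitions: "finite (colored_partitions k n)"
proof (rule finite_subset)
  show "colored_partitions k n \<subseteq> {\<pi>. set \<pi> \<subseteq> {p. is_partition p \<and> sum_mset p \<le> n} \<and> length \<pi> = k}"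
    by (auto simp: colored_partitions_def intro!: member_le_sum_list)
  show "finite {\<pi>. set \<pi> \<subseteq> {p. is_partition p \<and> sum_mset p \<le> n} \<and> length \<pi> = k}"
    by (intro finite_lists_length_eq finite_partitions_le)
qed

lemma has_prod_qpoch:
  fixes a q :: "complex fps"
  assumes a: "fps_nth a 0 = 0" and q: "fps_nth q 0 = 0"
  shows "(\<lambda>n. 1 - a * q ^ n) has_prod qpoch a q"
proof -
  define P where "P = (\<lambda>N. \<Prod>i\<le>N. 1 - a * q ^ i)"
  define L where "L = Abs_fps (\<lambda>m. fps_nth (P m) m)"
  have P_Suc: "fps_nth (P (Suc N)) m = fps_nth (P N) m" if "m \<le> N" for N m
  proof -
    have z: "fps_nth (q ^ Suc N) i = 0" if "i \<le> m" for i
      using that \<open>m \<le> N\<close> q by (intro startsby_zero_power_prefix[rule_format]) auto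
    have "fps_nth (P N * a * q ^ Suc N) m = 0"
      by (subst fps_mult_nth) (intro sum.neutral ballI, use z in auto)
    moreover have "P (Suc N) = P N - P N * a * q ^ Suc N"
      by (simp add: P_def algebra_simps)
    ultimately show ?thesis by simp
  qed
  have "fps_nth (P N) m = fps_nth L m" if "m \<le> N" for N m
    using that by (induction N rule: dec_induct) (auto simp: L_def P_Suc)
  then have lim: "P \<longlonglongrightarrow> L"
    by (intro tendsto_fpsI) (auto simp: eventually_at_top_linorder)
  have "fps_nth L 0 = 1"
    by (simp add: L_def P_def a)
  then have "L \<noteq> 0" by auto
  with lim have "(\<lambda>n. 1 - a * q ^ n) has_prod L"
    by (simp add: has_prod_def raw_has_prod_def P_def)
  then show ?thesis
    unfolding qpoch_def by (metis has_prod_unique)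
qed

lemma summable_theta:
  "(\<lambda>n::int. fps_const ((-1) powi n * of_int n) * fps_X ^ nat (n * (5 * n + 1) div 2) :: complex fps)
     summable_on UNIV"
proof -
  define f :: "int \<Rightarrow> complex fps" where
    "f = (\<lambda>n. fps_const ((-1) powi n * of_int n) * fps_X ^ nat (n * (5 * n + 1) div 2))"
  define L where "L = Abs_fps (\<lambda>m. fps_nth (\<Sum>n\<in>{- int m..int m}. f n) m)"
  have big: "m < nat (n * (5 * n + 1) div 2)" if "n \<notin> {- int m..int m}" for m n
  proof -
    have m: "\<bar>n\<bar> \<ge> int m + 1" using that by auto
    have "2 * \<bar>n\<bar> \<le> \<bar>n\<bar> * (5 * \<bar>n\<bar> - 1)"
      using m mult_left_mono[of 2 "5 * \<bar>n\<bar> - 1" "\<bar>n\<bar>"] by (simp add: mult.commute)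
    also have "\<dots> \<le> n * (5 * n + 1)"
      by (cases "n \<ge> 0") (auto simp: algebra_simps)
    finally show ?thesis using m by linarith
  qed
  have z: "fps_nth (f n) m = 0" if "n \<notin> {- int m..int m}" for m n
    using big[OF that] by (simp add: f_def fps_X_power_nth)
  have "(sum f \<longlongrightarrow> L) (finite_subsets_at_top UNIV)"
  proof (rule tendsto_fpsI)
    fix m
    show "\<forall>\<^sub>F F in finite_subsets_at_top UNIV. fps_nth (sum f F) m = fps_nth L m"
      unfolding eventually_finite_subsets_at_top
    proof (intro exI[of _ "{- int m..int m}"] conjI allI impI)
      fix F :: "int set" assume F: "finite F \<and> {- int m..int m} \<subseteq> F \<and> F \<subseteq> UNIV"
      then show "fps_nth (sum f F) m = fps_nth L m"
        unfolding L_def fps_sum_nth fps_nth_Abs_fps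
        by (intro sum.mono_neutral_right) (use z in auto)
    qed auto
  qed
  then show ?thesis
    unfolding f_def[symmetric] summable_on_def has_sum_def by blast
qed

end

theory Submission
  imports Defs "HOL-Computational_Algebra.Formal_Laurent_Series"
begin

text \<open>
  Let \<open>z\<close> be a primitive fifth root of unity, \<open>U z = \<Sum> z\<^bsup>#\<pi>\<^esup> q\<^bsup>|\<pi>|\<^esup>\<close> over partitions and \<open>J z = \<Sum> (-1)\<^sup>n z\<^sup>n q\<^bsup>n(n-1)/2\<^esup>\<close>.
  The crank generating function weighted by \<open>#\<pi>\<^sup>(\<^sup>1\<^sup>)\<close> is \<open>(z U') U(1/z) U(1)\<^sup>3\<close>, so its part odd under \<open>z \<mapsto> 1/z\<close> is
  \<open>E1\<^bsup>-3\<^esup> z d/dz (U(z) U(1/z))\<close>. The Jacobi triple product gives \<open>U(z) U(1/z) J(z) = (1 - z) E1\<close>, hence this odd part is an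
  expression in \<open>J\<close>, \<open>dJ/dz\<close> and \<open>E1\<close>, and \<open>J(z) J(z\<^sup>2) = (1 - z)(1 - z\<^sup>2) E1 E5\<close> clears the denominators.

  Write \<open>b = B(q\<^sup>5)\<close>, \<open>y = q A(q\<^sup>5)\<close>, \<open>e = E5(q\<^sup>5)\<close> and let \<open>\<alpha>, \<beta>\<close> be the roots of \<open>x\<^sup>2 = x + 1\<close>. Splitting sums by residues modulo 5
  gives \<open>J(z) = (1 - z) e (b - \<alpha> y)\<close>, therefore \<open>E1 A(q\<^sup>5) B(q\<^sup>5) = e (b\<^sup>2 - b y - y\<^sup>2)\<close>; taking the norm over \<open>q \<mapsto> z\<^sup>j q\<close>
  gives \<open>b\<^bsup>10\<^esup> - 11 b\<^sup>5 y\<^sup>5 - y\<^bsup>10\<^esup> = (A(q\<^sup>5) B(q\<^sup>5))\<^bsup>11\<^esup>\<close>, which inverts \<open>E1\<close>. Comparing Jacobi's series for \<open>E1\<^sup>3\<close> with the cube of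
  this dissection expresses the series \<open>S\<close>, and its companion with \<open>n(5n+3)/2\<close>, in terms of \<open>A\<close>, \<open>B\<close>, \<open>E5\<close>. Thus the whole
  generating function becomes a form in \<open>b\<close> and \<open>y\<close>, and the terms \<open>y\<^sup>i\<close> with \<open>i \<equiv> r (mod 5)\<close> make up \<open>G\<^sub>r\<close>.
\<close>

subsection \<open>Infinite products of formal power series\<close>

lemma tendsto_mult_fps:
  fixes f g :: "'b \<Rightarrow> 'a::comm_ring_1 fps"
  assumes "(f \<longlongrightarrow> a) F" "(g \<longlongrightarrow> b) F"
  shows "((\<lambda>x. f x * g x) \<longlongrightarrow> a * b) F"
proof (rule tendsto_fpsI)
  fix n
  have "\<forall>\<^sub>F x in F. \<forall>i\<in>{..n}. fps_nth (f x) i = fps_nth a i"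
    using assms(1) by (subst eventually_ball_finite_distrib) (auto simp: tendsto_fps_iff)
  moreover have "\<forall>\<^sub>F x in F. \<forall>i\<in>{..n}. fps_nth (g x) i = fps_nth b i"
    using assms(2) by (subst eventually_ball_finite_distrib) (auto simp: tendsto_fps_iff)
  ultimately show "\<forall>\<^sub>F x in F. fps_nth (f x * g x) n = fps_nth (a * b) n"
    by eventually_elim (simp add: fps_mult_nth)
qed

lemma tendsto_power_fps:
  fixes f :: "'b \<Rightarrow> 'a::comm_ring_1 fps"
  assumes "(f \<longlongrightarrow> a) F"
  shows "((\<lambda>x. f x ^ n) \<longlongrightarrow> a ^ n) F"
  by (induction n) (auto intro: tendsto_mult_fps assms)

lemma tendsto_compose_fps:
  fixes f :: "'b \<Rightarrow> 'a::comm_ring_1 fps"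
  assumes "(f \<longlongrightarrow> a) F"
  shows "((\<lambda>x. (f x oo h)) \<longlongrightarrow> (a oo h)) F"
proof (rule tendsto_fpsI)
  fix n
  have "\<forall>\<^sub>F x in F. \<forall>i\<in>{..n}. fps_nth (f x) i = fps_nth a i"
    using assms(1) by (subst eventually_ball_finite_distrib) (auto simp: tendsto_fps_iff)
  then show "\<forall>\<^sub>F x in F. fps_nth (f x oo h) n = fps_nth (a oo h) n"
    by eventually_elim (simp add: fps_compose_nth)
qed

lemma tendsto_qpoch:
  fixes a q :: "complex fps"
  assumes a: "fps_nth a 0 = 0" and q: "fps_nth q 0 = 0"
  shows "(\<lambda>N. \<Prod>i<N. 1 - a * q ^ i) \<longlonglongrightarrow> qpoch a q"
proof -
  \<comment> \<open>\<open>has_prod\<close> allows finitely many zero factors to be split off. Every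
    factor here has constant term 1, so the product is the plain limit of its partial
    products.\<close>
  have nz: "1 - a * q ^ i \<noteq> 0" for i
  proof
    assume "1 - a * q ^ i = 0"
    then have "fps_nth (1 - a * q ^ i) 0 = 0" by simp
    then show False using a by simp
  qed
  have "(\<lambda>N. \<Prod>i\<le>N. 1 - a * q ^ i) \<longlonglongrightarrow> qpoch a q"
    using has_prod_qpoch[OF a q] nz by (auto simp: has_prod_def raw_has_prod_def)
  then show ?thesis
    unfolding lessThan_Suc_atMost[symmetric] by (rule LIMSEQ_imp_Suc)
qed

lemma tendsto_qpoch_subseq:
  fixes a q :: "complex fps"
  assumes "fps_nth a 0 = 0" "fps_nth q 0 = 0" "k > 0"
  shows "(\<lambda>N. \<Prod>i<N * k. 1 - a * q ^ i) \<longlonglongrightarrow> qpoch a q"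
  using LIMSEQ_subseq_LIMSEQ[OF tendsto_qpoch[OF assms(1,2)], of "\<lambda>N. N * k"] \<open>k > 0\<close>
  by (simp add: strict_mono_def o_def)

lemma fps_nth_qpoch_0 [simp]:
  fixes a q :: "complex fps"
  assumes a: "fps_nth a 0 = 0" and q: "fps_nth q 0 = 0"
  shows "fps_nth (qpoch a q) 0 = 1"
proof -
  have "\<forall>\<^sub>F N in sequentially. fps_nth (\<Prod>i<N. 1 - a * q ^ i) 0 = fps_nth (qpoch a q) 0"
    using tendsto_qpoch[OF a q] by (simp add: tendsto_fps_iff)
  moreover have "fps_nth (\<Prod>i<N. 1 - a * q ^ i) 0 = 1" for N
    by (induction N) (simp_all add: a)
  ultimately show ?thesis by simp
qed

lemma qpoch_compose:
  fixes a q h :: "complex fps"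
  assumes a: "fps_nth a 0 = 0" and q: "fps_nth q 0 = 0" and h: "fps_nth h 0 = 0"
  shows "qpoch a q oo h = qpoch (a oo h) (q oo h)"
proof (rule LIMSEQ_unique)
  show "(\<lambda>N. ((\<Prod>i<N. 1 - a * q ^ i) oo h)) \<longlonglongrightarrow> (qpoch a q oo h)"
    by (intro tendsto_compose_fps tendsto_qpoch a q)
  have "(\<Prod>i<N. 1 - a * q ^ i) oo h = (\<Prod>i<N. 1 - (a oo h) * (q oo h) ^ i)" for N
    by (simp add: fps_compose_prod_distrib[OF h] fps_compose_sub_distrib
        fps_compose_mult_distrib[OF h] fps_compose_power[OF h])
  then show "(\<lambda>N. ((\<Prod>i<N. 1 - a * q ^ i) oo h)) \<longlonglongrightarrow> qpoch (a oo h) (q oo h)"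
    using tendsto_qpoch[of "a oo h" "q oo h"] by (simp add: a q)
qed

lemma prod_lessThan_mult_5:
  fixes f :: "nat \<Rightarrow> 'a::comm_monoid_mult"
  shows "prod f {..<N * 5} = (\<Prod>m<N. f (m*5) * f (m*5+1) * f (m*5+2) * f (m*5+3) * f (m*5+4))"
proof -
  have "{m*5..<m*5+5} = {m*5, m*5+1, m*5+2, m*5+3, m*5+4}" for m :: nat by auto
  then have "prod f {m*5..<m*5+5} = f (m*5) * f (m*5+1) * f (m*5+2) * f (m*5+3) * f (m*5+4)" for m
    by (simp add: mult.assoc)
  then show ?thesis by (simp flip: prod.nat_group)
qed

text \<open>The factors 1 - q^n are sorted by n modulo 5; the classes 1 and 4 form A, the classes 2
  and 3 form B, and the class 0 forms E5.\<close>

lemma qpoch_split5: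
  fixes q :: "complex fps"
  assumes q: "fps_nth q 0 = 0"
  shows "qpoch q q = qpochs [q, q^4] (q^5) * qpochs [q^2, q^3] (q^5) * qpoch (q^5) (q^5)"
proof (rule LIMSEQ_unique)
  show "(\<lambda>N. \<Prod>i<N * 5. 1 - q * q ^ i) \<longlonglongrightarrow> qpoch q q"
    by (intro tendsto_qpoch_subseq) (use q in auto)
  have e: "q * q ^ (m*5) = q * (q^5)^m" "q * q ^ (m*5+1) = q^2 * (q^5)^m" "q * q ^ (m*5+2) = q^3 * (q^5)^m"
     "q * q ^ (m*5+3) = q^4 * (q^5)^m" "q * q ^ (m*5+4) = q^5 * (q^5)^m" for m
  proof -
    have "q * q ^ (m*5+r) = q ^ (r + 1) * (q^5)^m" for r
      unfolding power_mult[symmetric] power_add[symmetric] power_Suc[symmetric]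
      by (simp add: algebra_simps del: power_Suc)
    from this[of 0] this[of 1] this[of 2] this[of 3] this[of 4]
    show "q * q ^ (m*5) = q * (q^5)^m" "q * q ^ (m*5+1) = q^2 * (q^5)^m" "q * q ^ (m*5+2) = q^3 * (q^5)^m"
     "q * q ^ (m*5+3) = q^4 * (q^5)^m" "q * q ^ (m*5+4) = q^5 * (q^5)^m"
      by (simp_all only: add_0 add_0_right one_add_one numeral_plus_one add_num_simps power_one_right)
  qed
  have "(\<Prod>i<N * 5. 1 - q * q ^ i) =
    ((\<Prod>i<N. 1 - q * (q^5) ^ i) * (\<Prod>i<N. 1 - q^4 * (q^5) ^ i)) *
    ((\<Prod>i<N. 1 - q^2 * (q^5) ^ i) * (\<Prod>i<N. 1 - q^3 * (q^5) ^ i)) *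
    (\<Prod>i<N. 1 - q^5 * (q^5) ^ i)" for N
    unfolding prod_lessThan_mult_5 e by (simp add: prod.distrib mult_ac)
  then show "(\<lambda>N. \<Prod>i<N * 5. 1 - q * q ^ i) \<longlonglongrightarrow>
      qpochs [q, q^4] (q^5) * qpochs [q^2, q^3] (q^5) * qpoch (q^5) (q^5)"
    using q by (simp add: qpochs_def) (intro tendsto_mult_fps tendsto_qpoch, auto)
qed

section \<open>Primitive fifth roots of unity and norms of infinite products\<close>

definition prim5 :: "complex \<Rightarrow> bool" where
  "prim5 z \<longleftrightarrow> 1 + z + z^2 + z^3 + z^4 = 0"

lemma prim5_power: "prim5 z \<Longrightarrow> z ^ 5 = 1"
proof -
  assume "prim5 z"
  then have "(z - 1) * (1 + z + z^2 + z^3 + z^4) = 0" by (simp add: prim5_def)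
  then show ?thesis by (simp add: algebra_simps eval_nat_numeral)
qed

lemma prim5_nz [simp]: "prim5 z \<Longrightarrow> z \<noteq> 0" "prim5 z \<Longrightarrow> z \<noteq> 1"
  by (auto simp: prim5_def)

lemma prim5_square: "prim5 z \<Longrightarrow> prim5 (z^2)"
  using prim5_power[of z] unfolding prim5_def by algebra

lemma prim5_prod_diff:
  fixes a x :: "complex fps"
  assumes "prim5 z"
  shows "(\<Prod>j<5. a - fps_const (z^j) * x) = a ^ 5 - x ^ 5"
proof -
  define w where "w = fps_const z"
  have "1 + w + w^2 + w^3 + w^4 = fps_const 1 + fps_const z + fps_const (z^2) + fps_const (z^3) + fps_const (z^4)"
    by (simp only: w_def fps_const_1_eq_1 fps_const_power)
  also have "\<dots> = fps_const (1 + z + z^2 + z^3 + z^4)"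
    by (simp only: fps_const_add)
  finally have w: "1 + w + w^2 + w^3 + w^4 = 0"
    using assms by (simp only: prim5_def fps_const_0_eq_0)
  have w5: "w^5 = 1"
    by (simp only: w_def fps_const_power prim5_power[OF assms] fps_const_1_eq_1)
  have wl: "w * w^4 = 1" "w^2 * w^3 = 1"
    using w5 by (simp_all flip: power_add power_Suc)
  \<comment> \<open>Conjugate roots are paired, so that the product depends only on
    \<open>s + t\<close> and \<open>s * t\<close>, which both equal -1.\<close>
  define s t where "s = w + w^4" and "t = w^2 + w^3"
  have "s + t + 1 = 0" using w by (simp add: s_def t_def ac_simps)
  then have st: "s + t = -1" by (simp only: eq_neg_iff_add_eq_0)
  have "s * t = w^3 + w^4 + w^5 * w + w^5 * w^2"
    unfolding s_def t_def by algebra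
  also have "\<dots> = s + t" unfolding w5 by (simp add: s_def t_def)
  finally have st': "s * t = -1" using st by simp
  have "{..<5::nat} = {0,1,2,3,4}" by auto
  then have "(\<Prod>j<5. a - fps_const (z^j) * x) = (a - x) * ((a - w*x) * (a - w^4*x)) * ((a - w^2*x) * (a - w^3*x))"
    by (simp add: w_def mult_ac)
  also have "(a - w*x) * (a - w^4*x) = a^2 - s * a * x + (w * w^4) * x^2"
    by (simp add: s_def algebra_simps power2_eq_square)
  also have "(a - w^2*x) * (a - w^3*x) = a^2 - t * a * x + (w^2 * w^3) * x^2"
    by (simp add: t_def algebra_simps power2_eq_square)
  also have "(a - x) * (a^2 - s * a * x + (w * w^4) * x^2) * (a^2 - t * a * x + (w^2 * w^3) * x^2)
      = (a - x) * (a^4 - (s+t) * a^3 * x + (2 + s*t) * a^2 * x^2 - (s+t) * a * x^3 + x^4)"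
    unfolding wl by algebra
  also have "\<dots> = a ^ 5 - x ^ 5"
    unfolding st st' by algebra
  finally show ?thesis .
qed

lemma prim5_prod:
  "prim5 z \<Longrightarrow> (\<Prod>j<5. 1 - fps_const (z^j) * x) = 1 - x ^ 5"
  using prim5_prod_diff[of z 1 x] by simp

text \<open>Once the two products are interchanged, the five factors with a given exponent n
  multiply to 1 - q^(5n).\<close>

lemma qpoch_prim5:
  assumes "prim5 z"
  shows "(\<Prod>j<5. qpoch (fps_const (z^j) * fps_X) fps_X) = qpoch (fps_X^5) (fps_X^5)"
proof (rule LIMSEQ_unique)
  have "(\<Prod>j<n. \<Prod>i<N. 1 - fps_const (z^j) * fps_X * fps_X ^ i)
      = (\<Prod>i<N. \<Prod>j<n. 1 - fps_const (z^j) * fps_X ^ Suc i)" for N n :: nat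
    by (subst prod.swap) (simp add: mult.assoc)
  from this[of _ 5] show "(\<lambda>N. \<Prod>j<5. \<Prod>i<N. 1 - fps_const (z^j) * fps_X * fps_X ^ i)
      \<longlonglongrightarrow> qpoch (fps_X^5) (fps_X^5)"
    using tendsto_qpoch[of "fps_X^5" "fps_X^5"]
    by (simp add: prim5_prod[OF assms] power_mult_distrib flip: power_mult) (simp add: mult.commute[of 5] power_mult)
  have "(\<lambda>N. \<Prod>j<n. \<Prod>i<N. 1 - fps_const (z^j) * fps_X * fps_X ^ i) \<longlonglongrightarrow>
      (\<Prod>j<n. qpoch (fps_const (z^j) * fps_X) fps_X)" for n :: nat
    by (induction n) (auto intro!: tendsto_mult_fps tendsto_qpoch)
  then show "(\<lambda>N. \<Prod>j<5. \<Prod>i<N. 1 - fps_const (z^j) * fps_X * fps_X ^ i) \<longlonglongrightarrow>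
      (\<Prod>j<5. qpoch (fps_const (z^j) * fps_X) fps_X)" .
qed

lemma prim5_power_not_dvd:
  assumes "prim5 z" "\<not> 5 dvd m"
  shows "prim5 (z ^ m)"
proof -
  have z5: "z ^ 5 = 1" by (rule prim5_power[OF assms(1)])
  have "z ^ m = (z ^ 5) ^ (m div 5) * z ^ (m mod 5)"
    by (simp flip: power_mult power_add)
  then have "z ^ m = z ^ (m mod 5)" using z5 by simp
  moreover have "m mod 5 = 1 \<or> m mod 5 = 2 \<or> m mod 5 = 3 \<or> m mod 5 = 4" using assms(2) by presburger
  moreover have "prim5 (z ^ 3)" using assms(1) z5 unfolding prim5_def by algebra
  moreover have "prim5 (z ^ 4)" using assms(1) z5 unfolding prim5_def by algebra
  ultimately show ?thesis using assms(1) prim5_square[OF assms(1)] by auto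
qed

text \<open>This is the norm of E1 over the substitutions of z^j q for q. The factors 1 - (z^j q)^m
  multiply to (1 - q^m)^5 if 5 divides m and to 1 - q^(5m) otherwise, which gives E5(q)^6 /
  E5(q^5).\<close>

lemma qpoch_scaled_prod:
  assumes z: "prim5 z"
  shows "(\<Prod>j<5. qpoch (fps_const (z^j) * fps_X) (fps_const (z^j) * fps_X)) * qpoch (fps_X^25) (fps_X^25)
       = qpoch (fps_X^5) (fps_X^5) ^ 6"
proof (rule LIMSEQ_unique)
  let ?c = "\<lambda>j. fps_const (z^j) * fps_X"
  define F where "F = (\<lambda>N. (\<Prod>j<5. \<Prod>i<N*5. 1 - ?c j * ?c j ^ i) * (\<Prod>i<N. 1 - fps_X^25 * (fps_X^25)^i))"
  define h :: "nat \<Rightarrow> complex fps" where "h = (\<lambda>i. 1 - fps_X^5 * (fps_X^5) ^ i)"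
  define g :: "nat \<Rightarrow> complex fps" where "g = (\<lambda>m. if 5 dvd m then (1 - fps_X ^ m)^5 else 1 - fps_X ^ (5*m))"
  have "(\<lambda>N. \<Prod>j<n. \<Prod>i<N*5. 1 - ?c j * ?c j ^ i) \<longlonglongrightarrow> (\<Prod>j<n. qpoch (?c j) (?c j))" for n :: nat
    by (induction n) (auto intro!: tendsto_mult_fps tendsto_qpoch_subseq)
  then show "F \<longlonglongrightarrow> (\<Prod>j<5. qpoch (?c j) (?c j)) * qpoch (fps_X^25) (fps_X^25)"
    unfolding F_def by (intro tendsto_mult_fps tendsto_qpoch) auto
  have g: "(\<Prod>j<5. 1 - ?c j ^ m) = g m" for m
  proof (cases "5 dvd m")
    case True
    then obtain k where "m = 5 * k" by auto
    then have "(z ^ j) ^ m = 1" for j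
      using prim5_power[OF z] by (metis power_mult power_one mult.commute)
    then show ?thesis using True by (simp add: g_def power_mult_distrib)
  next
    case False
    have "?c j ^ m = fps_const ((z^m)^j) * fps_X ^ m" for j
      by (simp only: power_mult_distrib fps_const_power power_mult[symmetric]) (simp only: mult.commute)
    then have "(\<Prod>j<5. 1 - ?c j ^ m) = (\<Prod>j<5. 1 - fps_const ((z^m)^j) * fps_X ^ m)" by (simp only:)
    also have "\<dots> = 1 - (fps_X ^ m)^5" by (rule prim5_prod[OF prim5_power_not_dvd[OF z False]])
    finally show ?thesis using False by (simp add: g_def mult.commute[of 5] power_mult)
  qed
  have 1: "(\<Prod>j<5. \<Prod>i<N*5. 1 - ?c j * ?c j ^ i) = (\<Prod>i<N*5. g (Suc i))" for N
    unfolding g[symmetric] power_Suc[symmetric] by (rule prod.swap)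
  \<comment> \<open>In a block of five consecutive exponents the first four contribute one factor
    \<open>h\<close> each and the multiple of 5 contributes \<open>h m ^ 5\<close>; the factor in
    q^25 supplies the missing \<open>h (m*5+4)\<close>.\<close>
  have 2: "g (Suc (m*5)) * g (Suc (m*5+1)) * g (Suc (m*5+2)) * g (Suc (m*5+3)) * g (Suc (m*5+4))
      * (1 - fps_X^25 * (fps_X^25)^m)
      = h (m*5) * h (m*5+1) * h (m*5+2) * h (m*5+3) * h (m*5+4) * h m ^ 5" for m
  proof -
    have d: "\<not> 5 dvd Suc (m*5)" "\<not> 5 dvd Suc (m*5+1)" "\<not> 5 dvd Suc (m*5+2)" "\<not> 5 dvd Suc (m*5+3)" "5 dvd Suc (m*5+4)"
      by presburger+
    have e: "fps_X^5 * (fps_X^5) ^ i = (fps_X ^ (5 * Suc i) :: complex fps)" for i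
      by (simp only: power_mult power_Suc)
    have e': "fps_X^25 * (fps_X^25) ^ m = (fps_X ^ (5 * Suc (m*5+4)) :: complex fps)"
      unfolding power_mult[symmetric] power_add[symmetric] by simp
    have e'': "Suc (m*5+4) = 5 * Suc m" by simp
    show ?thesis unfolding h_def e e' using d by (simp only: g_def if_True if_False simp_thms e'') (simp only: mult_ac)
  qed
  have x6: "x * x ^ 5 = x ^ 6" for x :: "complex fps"
    using power_Suc[of x 5] by simp
  have FN: "F N = prod h {..<N*5} * prod h {..<N} ^ 5" for N
    by (simp only: F_def 1 prod_lessThan_mult_5[where f="\<lambda>i. g (Suc i)"] prod_lessThan_mult_5[where f=h]
        prod_power_distrib prod.distrib[symmetric] 2)
  have "(\<lambda>N. prod h {..<N*5} * prod h {..<N} ^ 5)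
      \<longlonglongrightarrow> (qpoch (fps_X^5) (fps_X^5) * qpoch (fps_X^5) (fps_X^5) ^ 5 :: complex fps)"
    unfolding h_def by (intro tendsto_mult_fps tendsto_power_fps tendsto_qpoch tendsto_qpoch_subseq) auto
  then have "(\<lambda>N. F N) \<longlonglongrightarrow> (qpoch (fps_X^5) (fps_X^5) * qpoch (fps_X^5) (fps_X^5) ^ 5)"
    by (simp only: FN)
  then show "F \<longlonglongrightarrow> qpoch (fps_X^5) (fps_X^5) ^ 6"
    by (subst (asm) x6) simp
qed

subsection \<open>Bilateral series and the Jacobi triple product\<close>

text \<open>The series of all \<open>c n\<close> q^(\<open>e n\<close>), collected by exponent. An
  infinite fibre of \<open>e\<close> would make \<open>sum\<close> return its default value 0;
  \<open>finite_fibres\<close> excludes this.\<close>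

definition bilateral_series :: "(int \<Rightarrow> complex) \<Rightarrow> (int \<Rightarrow> nat) \<Rightarrow> complex fps" where
  "bilateral_series c e = Abs_fps (\<lambda>m. \<Sum>n | e n = m. c n)"

definition finite_fibres :: "(int \<Rightarrow> nat) \<Rightarrow> bool" where
  "finite_fibres e \<longleftrightarrow> (\<forall>m. finite {n. e n = m})"

lemma fps_nth_bilateral_series [simp]: "fps_nth (bilateral_series c e) m = (\<Sum>n | e n = m. c n)"
  by (simp add: bilateral_series_def)

lemma finite_fibresI:
  assumes "\<And>n. \<bar>n\<bar> \<le> int (e n) + 1"
  shows "finite_fibres e"
  unfolding finite_fibres_def
proof
  fix m
  have "{n. e n = m} \<subseteq> {- int m - 1..int m + 1}"
  proof
    fix n assume "n \<in> {n. e n = m}"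
    then show "n \<in> {- int m - 1..int m + 1}" using assms[of n] by auto
  qed
  then show "finite {n. e n = m}" by (rule finite_subset) simp
qed

lemma bilateral_series_add: "bilateral_series c e + bilateral_series d e = bilateral_series (\<lambda>n. c n + d n) e"
  by (simp add: fps_eq_iff sum.distrib)

lemma bilateral_series_cmult: "fps_const k * bilateral_series c e = bilateral_series (\<lambda>n. k * c n) e"
  by (simp add: fps_eq_iff sum_distrib_left)

lemma bilateral_series_reindex:
  assumes "bij f"
  shows "bilateral_series c e = bilateral_series (\<lambda>n. c (f n)) (\<lambda>n. e (f n))"
proof (rule fps_ext)
  fix m
  have "(\<Sum>n | e n = m. c n) = (\<Sum>n | e (f n) = m. c (f n))"
  proof (rule sum.reindex_bij_betw[symmetric])
    show "bij_betw f {n. e (f n) = m} {n. e n = m}"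
      using assms by (auto simp: bij_betw_def bij_def inj_on_def surj_def image_iff)
  qed
  then show "fps_nth (bilateral_series c e) m = fps_nth (bilateral_series (\<lambda>n. c (f n)) (\<lambda>n. e (f n))) m" by simp
qed

lemma bilateral_series_compose:
  assumes "k > 0"
  shows "bilateral_series c (\<lambda>n. k * e n + r) = fps_X ^ r * (bilateral_series c e oo fps_X ^ k)"
proof (rule fps_ext)
  fix m
  have "{n. k * e n + r = m} = (if m \<ge> r \<and> k dvd (m - r) then {n. e n = (m - r) div k} else {})"
    using assms by auto
  then show "fps_nth (bilateral_series c (\<lambda>n. k * e n + r)) m = fps_nth (fps_X ^ r * (bilateral_series c e oo fps_X ^ k)) m"
    by (simp add: fps_X_power_mult_nth fps_nth_compose_X_power)
qed

text \<open>Each coefficient is a finite sum over a fibre, which is grouped by n modulo 5.\<close>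

lemma bilateral_series_dissect5:
  assumes "finite_fibres e"
  shows "bilateral_series c e = bilateral_series (\<lambda>k. c (5*k)) (\<lambda>k. e (5*k)) + bilateral_series (\<lambda>k. c (5*k+1)) (\<lambda>k. e (5*k+1))
    + bilateral_series (\<lambda>k. c (5*k+2)) (\<lambda>k. e (5*k+2)) + bilateral_series (\<lambda>k. c (5*k+3)) (\<lambda>k. e (5*k+3))
    + bilateral_series (\<lambda>k. c (5*k+4)) (\<lambda>k. e (5*k+4))"
proof (rule fps_ext)
  fix m
  have fin: "finite {n. e n = m}" using assms by (simp add: finite_fibres_def)
  have part: "(\<Sum>k | e (5*k+r) = m. c (5*k+r)) = (\<Sum>n | e n = m \<and> n mod 5 = r. c n)" if "r \<in> {0..4}" for r
  proof (rule sum.reindex_bij_betw)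
    have "n = 5 * (n div 5) + r" if "n mod 5 = r" for n using that by presburger
    then show "bij_betw (\<lambda>k. 5*k+r) {k. e (5*k+r) = m} {n. e n = m \<and> n mod 5 = r}"
      using \<open>r \<in> {0..4}\<close> by (intro bij_betwI[where g="\<lambda>n. n div 5"]) auto
  qed
  have "(\<Sum>n | e n = m. c n) = (\<Sum>r\<in>{0..4}. \<Sum>n | n \<in> {n. e n = m} \<and> n mod 5 = r. c n)"
    by (rule sum.group[symmetric]) (use fin in auto)
  also have "\<dots> = (\<Sum>r\<in>{0..4}. \<Sum>k | e (5*k+r) = m. c (5*k+r))"
    by (rule sum.cong[OF refl], subst part) auto
  also have "{0..4::int} = {0,1,2,3,4}" by auto
  finally show "fps_nth (bilateral_series c e) m = fps_nth (bilateral_series (\<lambda>k. c (5*k)) (\<lambda>k. e (5*k)) + bilateral_series (\<lambda>k. c (5*k+1)) (\<lambda>k. e (5*k+1))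
    + bilateral_series (\<lambda>k. c (5*k+2)) (\<lambda>k. e (5*k+2)) + bilateral_series (\<lambda>k. c (5*k+3)) (\<lambda>k. e (5*k+3))
    + bilateral_series (\<lambda>k. c (5*k+4)) (\<lambda>k. e (5*k+4))) m"
    by (simp add: add_ac)
qed

text \<open>A set of summation indices that contains the fibre over \<open>m\<close> already yields
  the exact coefficient \<open>m\<close>. This links the coefficientwise definition to the infinite
  sum that defines S.\<close>

lemma has_sum_bilateral_series:
  assumes "finite_fibres e"
  shows "((\<lambda>n. fps_const (c n) * fps_X ^ e n) has_sum bilateral_series c e) UNIV"
  unfolding has_sum_def
proof (rule tendsto_fpsI)
  fix m
  have fin: "finite {n. e n = m}" using assms by (simp add: finite_fibres_def)
  show "\<forall>\<^sub>F F in finite_subsets_at_top UNIV. fps_nth (\<Sum>n\<in>F. fps_const (c n) * fps_X ^ e n) m = fps_nth (bilateral_series c e) m"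
    unfolding eventually_finite_subsets_at_top
  proof (intro exI[of _ "{n. e n = m}"] conjI allI impI fin)
    fix F :: "int set" assume F: "finite F \<and> {n. e n = m} \<subseteq> F \<and> F \<subseteq> UNIV"
    have "(\<Sum>n\<in>F. c n * (if m = e n then 1 else 0)) = (\<Sum>n\<in>{n. e n = m}. c n)"
      using F by (intro sum.mono_neutral_cong_right) auto
    then show "fps_nth (\<Sum>n\<in>F. fps_const (c n) * fps_X ^ e n) m = fps_nth (bilateral_series c e) m"
      by (simp add: fps_sum_nth)
  qed auto
qed

lemma tendsto_bilateral_series:
  assumes "finite_fibres e"
  shows "(\<lambda>N. \<Sum>n\<in>{- int N..int N}. fps_const (c n) * fps_X ^ e n) \<longlonglongrightarrow> bilateral_series c e"
proof -
  have "filterlim (\<lambda>N. {- int N..int N}) (finite_subsets_at_top UNIV) sequentially"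
    unfolding filterlim_finite_subsets_at_top
  proof (intro allI impI)
    fix X :: "int set" assume X: "finite X \<and> X \<subseteq> UNIV"
    define M where "M = (\<Sum>x\<in>X. nat \<bar>x\<bar>)"
    have "nat \<bar>x\<bar> \<le> M" if "x \<in> X" for x
      unfolding M_def using X that by (intro member_le_sum) auto
    then have "X \<subseteq> {- int N..int N}" if "N \<ge> M" for N using that by force
    then show "\<forall>\<^sub>F N in sequentially. finite {- int N..int N} \<and> X \<subseteq> {- int N..int N} \<and> {- int N..int N} \<subseteq> UNIV"
      unfolding eventually_sequentially by auto
  qed
  from filterlim_compose[OF has_sum_bilateral_series[OF assms, of c, unfolded has_sum_def] this] show ?thesis .
qed

lemma fps_X_power_dvd_imp_nth_eq:
  fixes f g :: "complex fps"
  assumes "fps_X ^ N dvd f - g" "m < N"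
  shows "fps_nth f m = fps_nth g m"
proof -
  obtain h where "f - g = fps_X ^ N * h" using assms(1) by (elim dvdE)
  then have "fps_nth (f - g) m = 0" using assms(2) by (simp add: fps_X_power_mult_nth)
  then show ?thesis by simp
qed

text \<open>Congruence modulo growing powers of q forces equal limits. In this form the finite
  triple product identity passes to the limit.\<close>

lemma tendsto_fps_X_power_dvd:
  fixes f g :: "nat \<Rightarrow> complex fps"
  assumes "\<And>N. fps_X ^ N dvd f N - g N" "g \<longlonglongrightarrow> L"
  shows "f \<longlonglongrightarrow> L"
proof (rule tendsto_fpsI)
  fix n
  have "\<forall>\<^sub>F N in sequentially. fps_nth (g N) n = fps_nth L n"
    using assms(2) by (simp add: tendsto_fps_iff)
  then show "\<forall>\<^sub>F N in sequentially. fps_nth (f N) n = fps_nth L n"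
    using eventually_gt_at_top[of n] by eventually_elim (use fps_X_power_dvd_imp_nth_eq[OF assms(1)] in metis)
qed

section \<open>Gaussian binomial coefficients and the finite triple product\<close>

definition qfact :: "complex fps \<Rightarrow> nat \<Rightarrow> complex fps" where
  "qfact Q k = (\<Prod>i<k. 1 - Q * Q ^ i)"

lemma qfact_Suc: "qfact Q (Suc k) = qfact Q k * (1 - Q ^ Suc k)"
  by (simp add: qfact_def)

lemma qfact_0 [simp]: "qfact Q 0 = 1"
  by (simp add: qfact_def)

text \<open>The Gaussian binomial coefficient \<open>[2N, N+n]\<close> in base \<open>Q\<close>.\<close>

definition central_qbinomial :: "complex fps \<Rightarrow> nat \<Rightarrow> int \<Rightarrow> complex fps" where
  "central_qbinomial Q N n = (if \<bar>n\<bar> \<le> int N then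
     qfact Q (2 * N) * inverse (qfact Q (nat (int N - n))) * inverse (qfact Q (nat (int N + n))) else 0)"

context
  fixes Q :: "complex fps"
  assumes Q0: "fps_nth Q 0 = 0"
begin

lemma fps_nth_qfact_0: "fps_nth (qfact Q k) 0 = 1"
  by (induction k) (simp_all add: qfact_Suc Q0)

lemma qfact_inverse [simp]: "qfact Q k * inverse (qfact Q k) = 1"
  by (simp add: inverse_mult_eq_1' fps_nth_qfact_0)

text \<open>Used to put neighbouring Gaussian coefficients over a common denominator, after which
  their recurrence is a polynomial identity.\<close>

lemma inverse_qfact_Suc: "inverse (qfact Q k) = inverse (qfact Q (Suc k)) * (1 - Q ^ Suc k)"
proof -
  have "qfact Q (Suc k) * inverse (qfact Q k) = qfact Q (Suc k) * (inverse (qfact Q (Suc k)) * (1 - Q ^ Suc k))"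
  proof -
    have "qfact Q (Suc k) * inverse (qfact Q k) = (1 - Q ^ Suc k) * (qfact Q k * inverse (qfact Q k))"
      by (simp only: qfact_Suc mult_ac)
    also have "\<dots> = (qfact Q (Suc k) * inverse (qfact Q (Suc k))) * (1 - Q ^ Suc k)"
      by (simp only: qfact_inverse mult_ac)
    finally show ?thesis by (simp only: mult_ac)
  qed
  moreover have "qfact Q (Suc k) \<noteq> 0" using fps_nth_qfact_0[of "Suc k"] by auto
  ultimately show ?thesis by (metis mult_left_cancel)
qed

text \<open>The q-Pascal rule in its two forms, applied one after the other: passing from 2N to 2N +
  2 keeps the lower index centred.\<close>

lemma central_qbinomial_rec:
  assumes "\<bar>n\<bar> \<le> int N + 1"
  shows "central_qbinomial Q (Suc N) n = (1 + Q ^ (2 * N + 1)) * central_qbinomial Q N n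
     + Q ^ nat (int N - n + 1) * central_qbinomial Q N (n - 1) + Q ^ nat (int N + n + 1) * central_qbinomial Q N (n + 1)"
proof -
  consider "\<bar>n\<bar> \<le> int N" | "n = int N + 1" | "n = - int N - 1" using assms by linarith
  then show ?thesis
  proof cases
    case 1
    define r s where "r = nat (int N - n)" and "s = nat (int N + n)"
    define ir js where "ir = inverse (qfact Q (Suc r))" and "js = inverse (qfact Q (Suc s))"
    have rs: "r + s = 2 * N" using 1 by (simp add: r_def s_def)
    have c0: "central_qbinomial Q N n = qfact Q (2*N) * (ir * (1 - Q ^ Suc r)) * (js * (1 - Q ^ Suc s))"
      using 1 by (simp add: central_qbinomial_def r_def[symmetric] s_def[symmetric] ir_def js_def inverse_qfact_Suc[symmetric] del: power_Suc)
    have c1: "central_qbinomial Q N (n - 1) = qfact Q (2*N) * ir * ((js * (1 - Q ^ Suc s)) * (1 - Q ^ s))"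
    \<comment> \<open>For \<open>s = 0\<close> the left side is 0 by definition, since
      \<open>n - 1\<close> leaves the range, and on the right the factor \<open>1 - Q ^ s\<close>
      vanishes. The case \<open>r = 0\<close> below is symmetric.\<close>
    proof (cases s)
      case 0
      then have "\<not> \<bar>n - 1\<bar> \<le> int N" using 1 by (auto simp: s_def)
      then show ?thesis using 0 by (simp add: central_qbinomial_def)
    next
      case (Suc s')
      then have "\<bar>n - 1\<bar> \<le> int N" "nat (int N - (n - 1)) = Suc r" "nat (int N + (n - 1)) = s'"
        using 1 by (auto simp: s_def r_def)
      then show ?thesis using Suc
        by (simp add: central_qbinomial_def ir_def js_def inverse_qfact_Suc[symmetric] del: power_Suc)
    qed
    have c2: "central_qbinomial Q N (n + 1) = qfact Q (2*N) * ((ir * (1 - Q ^ Suc r)) * (1 - Q ^ r)) * js"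
    proof (cases r)
      case 0
      then have "\<not> \<bar>n + 1\<bar> \<le> int N" using 1 by (auto simp: r_def)
      then show ?thesis using 0 by (simp add: central_qbinomial_def)
    next
      case (Suc r')
      then have "\<bar>n + 1\<bar> \<le> int N" "nat (int N - (n + 1)) = r'" "nat (int N + (n + 1)) = Suc s"
        using 1 by (auto simp: s_def r_def)
      then show ?thesis using Suc
        by (simp add: central_qbinomial_def ir_def js_def inverse_qfact_Suc[symmetric] del: power_Suc)
    qed
    have "\<bar>n\<bar> \<le> int (Suc N)" "nat (int (Suc N) - n) = Suc r" "nat (int (Suc N) + n) = Suc s" "2 * Suc N = Suc (Suc (2 * N))"
      using 1 by (auto simp: s_def r_def)
    then have c3: "central_qbinomial Q (Suc N) n = qfact Q (2*N) * (1 - Q ^ Suc (2*N)) * (1 - Q ^ Suc (Suc (2*N))) * ir * js"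
      by (simp only: central_qbinomial_def qfact_Suc if_True ir_def js_def)
    define u v where "u = Q ^ r" and "v = Q ^ s"
    have uv: "Q ^ (2*N) = u * v" by (simp add: u_def v_def rs[symmetric] power_add)
    have e: "nat (int N - n + 1) = Suc r" "nat (int N + n + 1) = Suc s" using 1 by (auto simp: s_def r_def)
    have alg: "f * (1 - Q * (u * v)) * (1 - Q * (Q * (u * v))) * i * j =
        (1 + Q * (u * v)) * (f * (i * (1 - Q * u)) * (j * (1 - Q * v)))
        + Q * u * (f * i * (j * (1 - Q * v) * (1 - v))) + Q * v * (f * (i * (1 - Q * u) * (1 - u)) * j)"
      for f Q u v i j :: "complex fps"
      by (simp add: algebra_simps)
    show ?thesis
      unfolding c0 c1 c2 c3 e Suc_eq_plus1[symmetric] power_Suc uv u_def[symmetric] v_def[symmetric]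
      by (rule alg)
  next
    \<comment> \<open>At the two ends only one neighbour lies in the range, its power of
      \<open>Q\<close> has exponent 0, and both sides equal 1.\<close>
    case 2
    have "nat (2 * int N) = 2 * N" by linarith
    with 2 show ?thesis using qfact_inverse[of "2 * N"] qfact_inverse[of "2 * Suc N"]
      by (simp add: central_qbinomial_def nat_add_distrib mult_2[symmetric])
  next
    case 3
    have "nat (2 * int N) = 2 * N" by linarith
    with 3 show ?thesis using qfact_inverse[of "2 * N"] qfact_inverse[of "2 * Suc N"]
      by (simp add: central_qbinomial_def nat_add_distrib mult_2[symmetric])
  qed
qed

text \<open>The term \<open>t n\<close> stands for \<open>(-1)\<^sup>n a\<^sup>n Q\<^bsup>n(n-1)/2\<^esup>\<close>. It is characterised by \<open>up\<close> and
  \<open>down\<close> because \<open>a\<close> and \<open>b\<close> need not be invertible.\<close>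

lemma finite_jacobi_triple:
  fixes t :: "int \<Rightarrow> complex fps"
  assumes ab: "a * b = Q" and t0: "t 0 = 1"
    and up: "\<And>n N. \<bar>n\<bar> \<le> int N \<Longrightarrow> a * Q ^ N * t n = - (Q ^ nat (int N - n) * t (n + 1))"
    and down: "\<And>n N. \<bar>n\<bar> \<le> int N \<Longrightarrow> b * Q ^ N * t n = - (Q ^ nat (int N + n) * t (n - 1))"
  shows "(\<Prod>k<N. (1 - a * Q ^ k) * (1 - b * Q ^ k)) = (\<Sum>n\<in>{- int N..int N}. central_qbinomial Q N n * t n)"
proof (induction N)
  case 0
  show ?case by (simp add: central_qbinomial_def t0 qfact_inverse)
next
  case (Suc N)
  let ?I = "{- int N..int N}" and ?J = "{- int (Suc N)..int (Suc N)}"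
  have zero: "central_qbinomial Q N n = 0" if "n \<notin> ?I" for n using that by (auto simp: central_qbinomial_def)
  \<comment> \<open>The new pair of factors acts on a single term: \<open>a * b = Q\<close> produces
    the middle part, while \<open>up\<close> and \<open>down\<close> move the index by one.\<close>
  have fac: "(1 - a * Q ^ N) * (1 - b * Q ^ N) * t n =
     (1 + Q ^ (2*N+1)) * t n + Q ^ nat (int N - n) * t (n + 1) + Q ^ nat (int N + n) * t (n - 1)" if "n \<in> ?I" for n
  proof -
    have "(1 - a * Q ^ N) * (1 - b * Q ^ N) * t n
      = (1 + (a * b) * (Q ^ N * Q ^ N)) * t n - a * Q ^ N * t n - b * Q ^ N * t n"
      by (simp add: algebra_simps)
    also have "(a * b) * (Q ^ N * Q ^ N) = Q ^ (2*N+1)"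
      unfolding ab by (simp add: mult_2 power_add)
    also have "a * Q ^ N * t n = - (Q ^ nat (int N - n) * t (n + 1))" using that by (intro up) auto
    also have "b * Q ^ N * t n = - (Q ^ nat (int N + n) * t (n - 1))" using that by (intro down) auto
    finally show ?thesis by simp
  qed
  have "(\<Prod>k<Suc N. (1 - a * Q ^ k) * (1 - b * Q ^ k)) = (\<Sum>n\<in>?I. central_qbinomial Q N n * ((1 - a * Q ^ N) * (1 - b * Q ^ N) * t n))"
    by (simp only: prod.lessThan_Suc Suc.IH sum_distrib_right) (simp only: mult_ac)
  also have "\<dots> = (\<Sum>n\<in>?I. (1 + Q ^ (2*N+1)) * central_qbinomial Q N n * t n) + (\<Sum>n\<in>?I. Q ^ nat (int N - n) * central_qbinomial Q N n * t (n
      + 1))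
      + (\<Sum>n\<in>?I. Q ^ nat (int N + n) * central_qbinomial Q N n * t (n - 1))"
    unfolding sum.distrib[symmetric] by (intro sum.cong refl) (simp only: fac, simp only: distrib_left mult_ac)
  \<comment> \<open>The three sums are brought to the range \<open>?J\<close> and to the same
    \<open>t n\<close>. The shifts of index and the enlarged range add only terms whose Gaussian
    coefficient is 0.\<close>
  also have "(\<Sum>n\<in>?I. (1 + Q ^ (2*N+1)) * central_qbinomial Q N n * t n) = (\<Sum>n\<in>?J. (1 + Q ^ (2*N+1)) * central_qbinomial Q N n * t n)"
    by (rule sum.mono_neutral_left) (auto simp: zero)
  also have "(\<Sum>n\<in>?I. Q ^ nat (int N - n) * central_qbinomial Q N n * t (n
      + 1)) = (\<Sum>n\<in>?J. Q ^ nat (int N - n + 1) * central_qbinomial Q N (n - 1) * t n)"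
  proof -
    have "(\<Sum>n\<in>?I. Q ^ nat (int N - n) * central_qbinomial Q N n * t (n
      + 1)) = (\<Sum>n\<in>(\<lambda>n. n + 1) ` ?I. Q ^ nat (int N - n + 1) * central_qbinomial Q N (n
      - 1) * t n)"
      by (subst sum.reindex) (auto simp: inj_on_def)
    also have "\<dots> = (\<Sum>n\<in>?J. Q ^ nat (int N - n + 1) * central_qbinomial Q N (n - 1) * t n)"
    proof (rule sum.mono_neutral_left)
      show "\<forall>i\<in>?J - (\<lambda>n. n + 1) ` ?I. Q ^ nat (int N - i + 1) * central_qbinomial Q N (i - 1) * t i = 0"
      proof
        fix i assume i: "i \<in> ?J - (\<lambda>n. n + 1) ` ?I"
        then have "i - 1 \<notin> ?I" by (metis DiffE diff_add_cancel imageI)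
        then show "Q ^ nat (int N - i + 1) * central_qbinomial Q N (i - 1) * t i = 0" by (simp add: zero)
      qed
    qed auto
    finally show ?thesis .
  qed
  also have "(\<Sum>n\<in>?I. Q ^ nat (int N + n) * central_qbinomial Q N n * t (n
      - 1)) = (\<Sum>n\<in>?J. Q ^ nat (int N + n + 1) * central_qbinomial Q N (n + 1) * t n)"
  proof -
    have "(\<Sum>n\<in>?I. Q ^ nat (int N + n) * central_qbinomial Q N n * t (n
      - 1)) = (\<Sum>n\<in>(\<lambda>n. n - 1) ` ?I. Q ^ nat (int N + n + 1) * central_qbinomial Q N (n
      + 1) * t n)"
      by (subst sum.reindex) (auto simp: inj_on_def)
    also have "\<dots> = (\<Sum>n\<in>?J. Q ^ nat (int N + n + 1) * central_qbinomial Q N (n + 1) * t n)"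
    proof (rule sum.mono_neutral_left)
      show "\<forall>i\<in>?J - (\<lambda>n. n - 1) ` ?I. Q ^ nat (int N + i + 1) * central_qbinomial Q N (i + 1) * t i = 0"
      proof
        fix i assume i: "i \<in> ?J - (\<lambda>n. n - 1) ` ?I"
        then have "i + 1 \<notin> ?I" by (metis DiffE add_diff_cancel_right' imageI)
        then show "Q ^ nat (int N + i + 1) * central_qbinomial Q N (i + 1) * t i = 0" by (simp add: zero)
      qed
    qed auto
    finally show ?thesis .
  qed
  also have "(\<Sum>n\<in>?J. (1 + Q ^ (2*N+1)) * central_qbinomial Q N n * t n) + (\<Sum>n\<in>?J. Q ^ nat (int N - n
      + 1) * central_qbinomial Q N (n - 1) * t n)
      + (\<Sum>n\<in>?J. Q ^ nat (int N + n + 1) * central_qbinomial Q N (n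
      + 1) * t n) = (\<Sum>n\<in>?J. central_qbinomial Q (Suc N) n * t n)"
    unfolding sum.distrib[symmetric] by (intro sum.cong refl) (subst central_qbinomial_rec, auto simp: distrib_right)
  finally show ?case .
qed

text \<open>Since q divides \<open>Q\<close>, all factors beyond the first \<open>k\<close> are 1
  modulo q^(k+1).\<close>

lemma X_power_dvd_qpoch_minus_qfact:
  assumes "k \<le> m"
  shows "fps_X ^ Suc k dvd qfact Q m - qfact Q k" "fps_X ^ Suc k dvd qpoch Q Q - qfact Q k"
proof -
  have X: "fps_X dvd Q"
  proof -
    have "Q = fps_shift 1 Q * fps_X ^ 1"
      by (intro fps_ext) (use Q0 in \<open>auto simp: fps_X_power_mult_right_nth simp del: power_one_right\<close>)
    then show ?thesis by (metis dvd_triv_right power_one_right)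
  qed
  have fin: "fps_X ^ Suc k dvd qfact Q m - qfact Q k" if "k \<le> m" for m
    using that
  proof (induction m rule: dec_induct)
    case (step m)
    have eq: "qfact Q (Suc m) - qfact Q k = (qfact Q m - qfact Q k) - qfact Q m * Q ^ Suc m"
      by (simp add: qfact_Suc algebra_simps)
    have "fps_X ^ Suc k dvd Q ^ Suc m"
      using step.hyps dvd_power_same[OF X, of "Suc m"] by (meson Suc_le_mono dvd_trans le_imp_power_dvd)
    then show ?case unfolding eq by (intro dvd_diff dvd_mult step.IH)
  qed simp
  then show "fps_X ^ Suc k dvd qfact Q m - qfact Q k" using assms by simp
  have "fps_nth (qpoch Q Q - qfact Q k) i = 0" if "i \<le> k" for i
  proof -
    have "\<forall>\<^sub>F N in sequentially. fps_nth (qfact Q N) i = fps_nth (qpoch Q Q) i"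
      using tendsto_qpoch[OF Q0 Q0] by (simp add: tendsto_fps_iff qfact_def)
    then obtain N where N: "\<And>m. m \<ge> N \<Longrightarrow> fps_nth (qfact Q m) i = fps_nth (qpoch Q Q) i"
      by (auto simp: eventually_sequentially)
    have "fps_nth (qfact Q (max N k)) i = fps_nth (qfact Q k) i"
      using fps_X_power_dvd_imp_nth_eq[OF fin[of "max N k"], of i] \<open>i \<le> k\<close> by simp
    then show ?thesis using N[of "max N k"] by simp
  qed
  then have "qpoch Q Q - qfact Q k = fps_shift (Suc k) (qpoch Q Q - qfact Q k) * fps_X ^ Suc k"
    by (intro fps_ext) (simp add: fps_X_power_mult_right_nth del: power_Suc)
  then show "fps_X ^ Suc k dvd qpoch Q Q - qfact Q k" by (metis dvd_triv_right)
qed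

text \<open>The central coefficient tends to the reciprocal of the infinite product. The error comes
  from truncating at N - n and at N + n factors, so the smaller of the two gives its order.\<close>

lemma X_power_dvd_central_qbinomial:
  assumes "\<bar>n\<bar> \<le> int N"
  shows "fps_X ^ nat (int N - \<bar>n\<bar> + 1) dvd central_qbinomial Q N n * qpoch Q Q - 1"
proof -
  define r s where "r = nat (int N - n)" and "s = nat (int N + n)"
  have alg: "i * j * (a * p) - (r * i) * (s * j) = i * j * (a * (p - s) + s * (a - r))"
    for a p r s i j :: "complex fps"
    by (simp add: algebra_simps)
  let ?ir = "inverse (qfact Q r)" and ?is = "inverse (qfact Q s)"
  have rs: "r \<le> 2 * N" "s \<le> 2 * N" "nat (int N - \<bar>n\<bar> + 1) \<le> Suc r" "nat (int N - \<bar>n\<bar> + 1) \<le> Suc s"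
    using assms by (auto simp: r_def s_def)
  have "central_qbinomial Q N n * qpoch Q Q
      - 1 = ?ir * ?is * (qfact Q (2*N) * qpoch Q Q) - (qfact Q r * ?ir) * (qfact Q s * ?is)"
    using assms by (simp add: central_qbinomial_def r_def[symmetric] s_def[symmetric] qfact_inverse mult_ac)
  also have "\<dots> = ?ir * ?is * (qfact Q (2*N) * (qpoch Q Q - qfact Q s) + qfact Q s * (qfact Q (2*N) - qfact Q r))"
    by (rule alg)
  finally have eq: "central_qbinomial Q N n * qpoch Q Q - 1 = \<dots>" .
  have "fps_X ^ nat (int N - \<bar>n\<bar> + 1) dvd qpoch Q Q - qfact Q s"
    using X_power_dvd_qpoch_minus_qfact(2)[of s s] rs by (meson dvd_trans le_imp_power_dvd order_refl)
  moreover have "fps_X ^ nat (int N - \<bar>n\<bar> + 1) dvd qfact Q (2*N) - qfact Q r"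
    using X_power_dvd_qpoch_minus_qfact(1)[of r "2*N"] rs by (meson dvd_trans le_imp_power_dvd)
  ultimately show ?thesis unfolding eq by (intro dvd_mult dvd_add)
qed

end

text \<open>This is \<open>p n(n-1)/2 + i n\<close>; the exponent is nonnegative, so that \<^const>\<open>nat\<close> does not truncate, when \<open>i \<le> p\<close>.\<close>

definition theta_exp :: "nat \<Rightarrow> nat \<Rightarrow> int \<Rightarrow> nat" where
  "theta_exp p i n = nat (int p * (n * (n - 1) div 2) + int i * n)"

text \<open>Doubling clears the division by 2, so that later comparisons of exponents are polynomial
  identities over the integers.\<close>

lemma int_theta_exp:
  assumes "i \<le> p"
  shows "2 * int (theta_exp p i n) = int p * (n * (n - 1)) + 2 * int i * n"
proof -
  have "int p * (n * (n - 1)) + 2 * int i * n \<ge> 0"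
  proof (cases "n \<ge> 0")
    case True
    then have "n = 0 \<or> n * (n - 1) \<ge> 0" by (cases "n = 0") (auto intro: mult_nonneg_nonneg)
    then show ?thesis using True by auto
  next
    case False
    \<comment> \<open>In terms of -n the linear coefficient changes from \<open>i\<close> to
      \<open>p - i\<close>, which is where \<open>i \<le> p\<close> enters.\<close>
    have "int p * (n * (n - 1)) + 2 * int i * n = (-n) * (int p * (- n - 1) + 2 * (int p - int i))"
      by (simp add: algebra_simps)
    moreover have "(-n) * (int p * (- n - 1) + 2 * (int p - int i)) \<ge> 0"
      using False assms by (intro mult_nonneg_nonneg add_nonneg_nonneg) auto
    ultimately show ?thesis by (simp only:)
  qed
  moreover define h where "h = n * (n - 1) div 2"
  have h: "n * (n - 1) = 2 * h" by (simp add: h_def)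
  have eq: "int p * (2 * h) + 2 * int i * n = 2 * (int p * h + int i * n)"
    by (simp only: distrib_left mult_ac)
  ultimately have "int p * h + int i * n \<ge> 0" unfolding h by linarith
  then show ?thesis
    unfolding theta_exp_def h_def[symmetric] unfolding h eq by simp
qed

text \<open>The growth bound serves twice: it makes the fibres finite, and it offsets the loss of
  |n| in the order of the error of the Gaussian coefficients.\<close>

lemma theta_exp_ge:
  assumes "i \<le> p" "p > 0"
  shows "\<bar>n\<bar> \<le> int (theta_exp p i n) + 1"
proof -
  have "2 * (\<bar>n\<bar> - 1) \<le> int p * (n * (n - 1)) + 2 * int i * n"
  proof (cases "n \<ge> 1")
    case True
    have "2 * (n - 1) \<le> n * (n - 1)"
      using True mult_right_mono[of 2 n "n - 1"] by (cases "n = 1") auto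
    moreover have "1 * (n * (n - 1)) \<le> int p * (n * (n - 1))"
      using True assms by (intro mult_right_mono mult_nonneg_nonneg) auto
    moreover have "2 * int i * n \<ge> 0" using True by simp
    moreover have "\<bar>n\<bar> = n" using True by simp
    ultimately show ?thesis by (simp only: mult_1_left)
  next
    case False
    define m where "m = - n"
    have m: "m \<ge> 0" using False by (simp add: m_def)
    have "2 * (m - 1) \<le> m * (m - 1)"
      using m mult_right_mono[of 2 m "m - 1"] by (cases "m = 0"; cases "m = 1") auto
    also have "\<dots> \<le> int p * (m * (m - 1))"
      using m assms mult_right_mono[of 1 "int p" "m * (m - 1)"] by (cases "m = 0") auto
    also have "\<dots> \<le> int p * (m * (m - 1)) + 2 * (int p - int i) * m"
      using m assms by simp
    also have "\<dots> = int p * (n * (n - 1)) + 2 * int i * n"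
      by (simp add: m_def algebra_simps)
    finally show ?thesis using m by (simp add: m_def)
  qed
  then have "2 * (\<bar>n\<bar> - 1) \<le> 2 * int (theta_exp p i n)"
    by (simp only: int_theta_exp[OF assms(1)])
  then show ?thesis by simp
qed

lemma finite_fibres_theta_exp: "i \<le> p \<Longrightarrow> p > 0 \<Longrightarrow> finite_fibres (theta_exp p i)"
  by (intro finite_fibresI theta_exp_ge)

text \<open>The product side remains a sequence of partial products because for \<open>i = 0\<close>
  the parameter \<open>a\<close> is a nonzero constant, outside the scope of
  \<open>tendsto_qpoch\<close>. The finite identity reduces the claim to an error that vanishes
  modulo q^N.\<close>

theorem jacobi_triple:
  assumes z: "z \<noteq> 0" and i: "i \<le> p" and p: "p > 0"
  defines "a \<equiv> fps_const z * fps_X ^ i" and "b \<equiv> fps_const (1 / z) * fps_X ^ (p - i)" and "Q \<equiv> fps_X ^ p"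
  shows "(\<lambda>N. (\<Prod>k<N. (1 - a * Q ^ k) * (1 - b * Q ^ k)) * qpoch Q Q)
     \<longlonglongrightarrow> bilateral_series (\<lambda>n. (- z) powi n) (theta_exp p i)"
proof (rule tendsto_fps_X_power_dvd)
  let ?t = "\<lambda>n. fps_const ((- z) powi n) * fps_X ^ theta_exp p i n :: complex fps"
  show "(\<lambda>N. \<Sum>n\<in>{- int N..int N}. ?t n) \<longlonglongrightarrow> bilateral_series (\<lambda>n. (- z) powi n) (theta_exp p i)"
    by (intro tendsto_bilateral_series finite_fibres_theta_exp i p)
  fix N
  have Q0: "fps_nth Q 0 = 0" using p by (simp add: Q_def)
  have ie: "2 * int (theta_exp p i n) = int p * (n * (n - 1)) + 2 * int i * n" for n
    by (rule int_theta_exp[OF i])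
  have "(\<Prod>k<N. (1 - a * Q ^ k) * (1 - b * Q ^ k)) = (\<Sum>n\<in>{- int N..int N}. central_qbinomial Q N n * ?t n)"
  proof (rule finite_jacobi_triple[OF Q0])
    have "a * b = fps_const (z * (1 / z)) * (fps_X ^ i * fps_X ^ (p - i))"
      unfolding a_def b_def fps_const_mult[symmetric] by (simp only: mult_ac)
    then show "a * b = Q" using z i by (simp add: Q_def flip: power_add)
    show "?t 0 = 1" by (simp add: theta_exp_def)
  next
    fix n :: int and N :: nat assume n: "\<bar>n\<bar> \<le> int N"
    have "2 * int (i + p * N + theta_exp p i n) = 2 * int (p * nat (int N - n) + theta_exp p i (n + 1))"
      using n by (simp add: distrib_left ie algebra_simps)
    then have e: "i + p * N + theta_exp p i n = p * nat (int N - n) + theta_exp p i (n + 1)"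
      by (metis mult_cancel_left of_nat_eq_iff zero_neq_numeral)
    have c: "z * (- z) powi n = - ((- z) powi (n + 1))"
      using z by (simp add: power_int_add)
    have "a * Q ^ N * ?t n = fps_const (z * (- z) powi n) * fps_X ^ (i + p * N + theta_exp p i n)"
      unfolding a_def Q_def fps_const_mult[symmetric] power_add power_mult by (simp only: mult_ac)
    also have "\<dots> = - (Q ^ nat (int N - n) * ?t (n + 1))"
      unfolding c e Q_def power_add power_mult fps_const_neg[symmetric] by (simp only: mult_ac mult_minus_left)
    finally show "a * Q ^ N * ?t n = - (Q ^ nat (int N - n) * ?t (n + 1))" .
    have "2 * int ((p - i) + p * N + theta_exp p i n) = 2 * int (p * nat (int N + n) + theta_exp p i (n - 1))"
      using n i by (simp add: distrib_left ie of_nat_diff algebra_simps)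
    then have e: "(p - i) + p * N + theta_exp p i n = p * nat (int N + n) + theta_exp p i (n - 1)"
      by (metis mult_cancel_left of_nat_eq_iff zero_neq_numeral)
    have c: "(1 / z) * (- z) powi n = - ((- z) powi (n - 1))"
      using z by (simp add: power_int_diff)
    have "b * Q ^ N * ?t n = fps_const ((1 / z) * (- z) powi n) * fps_X ^ ((p - i) + p * N + theta_exp p i n)"
      unfolding b_def Q_def fps_const_mult[symmetric] power_add power_mult by (simp only: mult_ac)
    also have "\<dots> = - (Q ^ nat (int N + n) * ?t (n - 1))"
      unfolding c e Q_def power_add power_mult fps_const_neg[symmetric] by (simp only: mult_ac mult_minus_left)
    finally show "b * Q ^ N * ?t n = - (Q ^ nat (int N + n) * ?t (n - 1))" .
  qed
  then have eq: "(\<Prod>k<N. (1 - a * Q ^ k) * (1 - b * Q ^ k)) * qpoch Q Q - (\<Sum>n\<in>{- int N..int N}. ?t n)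
      = (\<Sum>n\<in>{- int N..int N}. (central_qbinomial Q N n * qpoch Q Q - 1) * ?t n)"
    by (simp only: sum_distrib_right sum_subtractf[symmetric]) (simp add: algebra_simps)
  have "fps_X ^ N dvd (central_qbinomial Q N n * qpoch Q Q - 1) * ?t n" if n: "n \<in> {- int N..int N}" for n
  proof -
    have "fps_X ^ nat (int N - \<bar>n\<bar>
      + 1) * fps_X ^ theta_exp p i n dvd (central_qbinomial Q N n * qpoch Q Q - 1) * ?t n"
      using n by (intro mult_dvd_mono X_power_dvd_central_qbinomial[OF Q0] dvd_mult) auto
    \<comment> \<open>The Gaussian coefficient contributes order N - |n| + 1 and the power of q
      contributes at least |n| - 1, together at least N.\<close>
    moreover have "N \<le> nat (int N - \<bar>n\<bar> + 1) + theta_exp p i n"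
      using n theta_exp_ge[OF i p, of n] by auto
    ultimately show ?thesis
      unfolding power_add[symmetric] by (meson dvd_trans le_imp_power_dvd)
  qed
  then show "fps_X ^ N dvd (\<Prod>k<N. (1 - a * Q ^ k) * (1 - b * Q ^ k)) * qpoch Q Q - (\<Sum>n\<in>{- int N..int N}. ?t n)"
    unfolding eq by (rule dvd_sum)
qed

subsection \<open>Five-dissections of theta series\<close>

definition fA :: "complex fps" where "fA = qpochs [fps_X, fps_X^4] (fps_X^5)"
definition fB :: "complex fps" where "fB = qpochs [fps_X^2, fps_X^3] (fps_X^5)"
definition fE1 :: "complex fps" where "fE1 = qpoch fps_X fps_X"
definition fE5 :: "complex fps" where "fE5 = qpoch (fps_X^5) (fps_X^5)"

lemma fE1_eq: "fE1 = fA * fB * fE5"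
  unfolding fE1_def fA_def fB_def fE5_def by (rule qpoch_split5) simp

lemma fE5_eq_compose: "fE5 = (fE1 oo fps_X ^ 5)"
  unfolding fE1_def fE5_def by (subst qpoch_compose) auto

lemma fps_nth_0_products [simp]: "fps_nth fA 0 = 1" "fps_nth fB 0 = 1" "fps_nth fE1 0 = 1" "fps_nth fE5 0 = 1"
  by (simp_all add: fA_def fB_def fE1_def fE5_def qpochs_def)

lemma jacobi_triple_qpoch:
  assumes "0 < i" "i < p"
  shows "qpoch (fps_X ^ i) (fps_X ^ p) * qpoch (fps_X ^ (p - i)) (fps_X ^ p) * qpoch (fps_X ^ p) (fps_X ^ p)
     = bilateral_series (\<lambda>n. (-1) powi n) (theta_exp p i)"
proof (rule LIMSEQ_unique)
  show "(\<lambda>N. (\<Prod>k<N. (1 - fps_X ^ i * (fps_X ^ p) ^ k) * (1 - fps_X ^ (p - i) * (fps_X ^ p) ^ k)) * qpoch (fps_X ^ p) (fps_X ^ p))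
     \<longlonglongrightarrow> bilateral_series (\<lambda>n. (-1) powi n) (theta_exp p i)"
    using jacobi_triple[of 1 i p] assms by simp
  show "(\<lambda>N. (\<Prod>k<N. (1 - fps_X ^ i * (fps_X ^ p) ^ k) * (1 - fps_X ^ (p - i) * (fps_X ^ p) ^ k)) * qpoch (fps_X ^ p) (fps_X ^ p))
     \<longlonglongrightarrow> (qpoch (fps_X ^ i) (fps_X ^ p) * qpoch (fps_X ^ (p - i)) (fps_X ^ p) * qpoch (fps_X ^ p) (fps_X ^ p) :: complex fps)"
    unfolding prod.distrib using assms
    by (intro tendsto_mult_fps tendsto_qpoch tendsto_const) auto
qed

text \<open>The exponent \<open>theta_exp 5 3 n\<close> is n(5n+1)/2. In the companion identity that
  follows, \<open>theta_exp 5 4 n\<close> is n(5n+3)/2.\<close>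

lemma theta1_product: "bilateral_series (\<lambda>n. (-1) powi n) (theta_exp 5 3) = fB * fE5"
  using jacobi_triple_qpoch[of 3 5] by (simp add: fB_def fE5_def qpochs_def mult_ac)

lemma theta2_product: "bilateral_series (\<lambda>n. (-1) powi n) (theta_exp 5 4) = fA * fE5"
  using jacobi_triple_qpoch[of 4 5] by (simp add: fA_def fE5_def qpochs_def mult_ac)

text \<open>\<open>J z = \<Sum> (-1)\<^sup>n z\<^sup>n q\<^bsup>n(n-1)/2\<^esup>\<close>, and \<open>K = 2 z (dJ/dz) - J\<close> is the combination of \<open>J\<close> and its derivative
  that respects the symmetry \<open>n \<mapsto> 1 - n\<close>.\<close>

definition J :: "complex \<Rightarrow> complex fps" where
  "J z = bilateral_series (\<lambda>n. (- z) powi n) (theta_exp 1 0)"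

definition K :: "complex \<Rightarrow> complex fps" where
  "K z = bilateral_series (\<lambda>n. (2 * of_int n - 1) * (- z) powi n) (theta_exp 1 0)"

text \<open>The triple product with \<open>i = 0\<close> and \<open>p = 1\<close>; its very first
  factor is the constant 1 - z, which is split off so that the remaining products start at zq and
  q/z.\<close>

lemma J_eq:
  assumes "z \<noteq> 0"
  shows "J z = fps_const (1 - z) * (qpoch (fps_const z * fps_X) fps_X * qpoch (fps_const (1 / z) * fps_X) fps_X * fE1)"
proof (rule LIMSEQ_unique)
  let ?F = "\<lambda>N. (\<Prod>k<N. (1 - fps_const z * fps_X ^ k) * (1 - fps_const (1 / z) * fps_X * fps_X ^ k)) * fE1"
  show "(\<lambda>N. ?F (Suc N)) \<longlonglongrightarrow> J z"
    using LIMSEQ_Suc[OF jacobi_triple[of z 0 1]] assms by (simp add: J_def fE1_def)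
  have "(\<Prod>k<Suc N. (1 - fps_const z * fps_X ^ k)) = fps_const (1 - z) * (\<Prod>k<N. 1 - fps_const z * fps_X * fps_X ^ k)" for N
    by (subst prod.lessThan_Suc_shift) (simp add: mult.assoc)
  then have "?F (Suc N) = fps_const (1 - z) * ((\<Prod>k<N. 1 - fps_const z * fps_X * fps_X ^ k)
       * (\<Prod>k<Suc N. 1 - fps_const (1 / z) * fps_X * fps_X ^ k) * fE1)" for N
    by (simp only: prod.distrib mult.assoc)
  then show "(\<lambda>N. ?F (Suc N)) \<longlonglongrightarrow> fps_const (1 - z) * (qpoch (fps_const z * fps_X) fps_X * qpoch (fps_const (1 / z) * fps_X) fps_X * fE1)"
    by (simp only:) (intro tendsto_mult_fps tendsto_const tendsto_qpoch LIMSEQ_Suc[OF tendsto_qpoch], auto)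
qed

lemma theta_exp_eqI:
  assumes "i \<le> p" "2 * int r = int p * (n * (n - 1)) + 2 * int i * n"
  shows "theta_exp p i n = r"
  using int_theta_exp[OF assms(1), of n] assms(2) by simp

text \<open>As z^5 = 1, the power of -z in class r is (-z)^r (-1)^k. Classes 0 and 1 lead to
  exponents n(5n+1)/2, classes 2 and 4 to n(5n+3)/2, and class 3 again to triangular numbers, now in
  q^25. Reversing k in classes 0 and 4 produces the arguments \<open>- 5 * k\<close> and
  \<open>- 5 * k - 1\<close>. The weight \<open>g\<close> is left free to cover both
  \<open>J\<close> and \<open>K\<close>.\<close>

lemma theta_dissect5:
  assumes z: "z ^ 5 = 1"
  shows "bilateral_series (\<lambda>n. g n * (- z) powi n) (theta_exp 1 0) =
     (bilateral_series (\<lambda>k. g (- 5 * k) * (-1) powi k) (theta_exp 5 3) oo fps_X ^ 5)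
   - fps_const z * (bilateral_series (\<lambda>k. g (5 * k + 1) * (-1) powi k) (theta_exp 5 3) oo fps_X ^ 5)
   + fps_const (z^2) * (fps_X * (bilateral_series (\<lambda>k. g (5 * k + 2) * (-1) powi k) (theta_exp 5 4) oo fps_X ^ 5))
   - fps_const (z^3) * (fps_X ^ 3 * (bilateral_series (\<lambda>k. g (5 * k
      + 3) * (-1) powi k) (theta_exp 1 1) oo fps_X ^ 25))
   - fps_const (z^4) * (fps_X * (bilateral_series (\<lambda>k. g (- 5 * k - 1) * (-1) powi k) (theta_exp 5 4) oo fps_X ^ 5))"
proof -
  have nz: "z \<noteq> 0" using z by auto
  have pw: "(- z) powi (5 * k + int r) = (- z) ^ r * (-1) powi k" for k r
  proof -
    have "(- z) powi (5 * k + int r) = ((- z) ^ 5) powi k * (- z) ^ r"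
      using nz by (subst power_int_add) (auto simp: power_int_mult)
    also have "(- z) ^ 5 = -1" using z by (simp add: power_minus_odd)
    finally show ?thesis by (simp add: mult.commute)
  qed
  have 0: "bilateral_series (\<lambda>k. g (5*k) * (- z) powi (5*k)) (\<lambda>k. theta_exp 1 0 (5*k))
     = (bilateral_series (\<lambda>k. g (- 5 * k) * (-1) powi k) (theta_exp 5 3) oo fps_X ^ 5)"
  proof -
    have e: "theta_exp 1 0 (5 * - k) = 5 * theta_exp 5 3 k + 0" for k
      by (intro theta_exp_eqI) (use int_theta_exp[of 3 5 k] in \<open>simp_all add: algebra_simps\<close>)
    have m: "(-1) powi (- k) = ((-1) powi k :: complex)" for k :: int
      by (rule power_int_minus_one_minus)
    have c: "g (5 * - k) * (- z) powi (5 * - k) = g (- 5 * k) * (-1) powi k" for k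
      using pw[of "- k" 0] m[of k] by simp
    have "bilateral_series (\<lambda>k. g (5*k) * (- z) powi (5*k)) (\<lambda>k. theta_exp 1 0 (5*k))
      = bilateral_series (\<lambda>k. g (5 * - k) * (- z) powi (5 * - k)) (\<lambda>k. theta_exp 1 0 (5 * - k))"
      by (rule bilateral_series_reindex) (auto intro!: bij_betwI[where g = uminus])
    also have "\<dots> = bilateral_series (\<lambda>k. g (- 5 * k) * (-1) powi k) (\<lambda>k. 5 * theta_exp 5 3 k + 0)"
      by (simp only: e c)
    also have "\<dots> = (bilateral_series (\<lambda>k. g (- 5 * k) * (-1) powi k) (theta_exp 5 3) oo fps_X ^ 5)"
      by (subst bilateral_series_compose) auto
    finally show ?thesis .
  qed
  have 1: "bilateral_series (\<lambda>k. g (5*k+1) * (- z) powi (5*k+1)) (\<lambda>k. theta_exp 1 0 (5*k+1))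
     = - fps_const z * (bilateral_series (\<lambda>k. g (5 * k + 1) * (-1) powi k) (theta_exp 5 3) oo fps_X ^ 5)"
  proof -
    have e: "theta_exp 1 0 (5 * k + 1) = 5 * theta_exp 5 3 k + 0" for k
      by (intro theta_exp_eqI) (use int_theta_exp[of 3 5 k] in \<open>simp_all add: algebra_simps\<close>)
    have c: "g (5*k+1) * (- z) powi (5*k+1) = (- z) * (g (5*k+1) * (-1) powi k)" for k
      using pw[of k 1] by simp
    have "bilateral_series (\<lambda>k. g (5*k+1) * (- z) powi (5*k+1)) (\<lambda>k. theta_exp 1 0 (5*k+1))
      = fps_const (- z) * bilateral_series (\<lambda>k. g (5 * k + 1) * (-1) powi k) (\<lambda>k. 5 * theta_exp 5 3 k + 0)"
      by (simp only: e c bilateral_series_cmult)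
    then show ?thesis by (subst (asm) bilateral_series_compose) auto
  qed
  have 2: "bilateral_series (\<lambda>k. g (5*k+2) * (- z) powi (5*k+2)) (\<lambda>k. theta_exp 1 0 (5*k+2))
     = fps_const (z^2) * (fps_X * (bilateral_series (\<lambda>k. g (5 * k + 2) * (-1) powi k) (theta_exp 5 4) oo fps_X ^ 5))"
  proof -
    have e: "theta_exp 1 0 (5 * k + 2) = 5 * theta_exp 5 4 k + 1" for k
      by (intro theta_exp_eqI) (use int_theta_exp[of 4 5 k] in \<open>simp_all add: algebra_simps\<close>)
    have c: "g (5*k+2) * (- z) powi (5*k+2) = (z^2) * (g (5*k+2) * (-1) powi k)" for k
      using pw[of k 2] by simp
    have "bilateral_series (\<lambda>k. g (5*k+2) * (- z) powi (5*k+2)) (\<lambda>k. theta_exp 1 0 (5*k+2))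
      = fps_const (z^2) * bilateral_series (\<lambda>k. g (5 * k + 2) * (-1) powi k) (\<lambda>k. 5 * theta_exp 5 4 k + 1)"
      by (simp only: e c bilateral_series_cmult)
    then show ?thesis by (subst (asm) bilateral_series_compose) auto
  qed
  have 3: "bilateral_series (\<lambda>k. g (5*k+3) * (- z) powi (5*k+3)) (\<lambda>k. theta_exp 1 0 (5*k+3))
     = - fps_const (z^3) * (fps_X ^ 3 * (bilateral_series (\<lambda>k. g (5 * k
      + 3) * (-1) powi k) (theta_exp 1 1) oo fps_X ^ 25))"
  proof -
    have e: "theta_exp 1 0 (5 * k + 3) = 25 * theta_exp 1 1 k + 3" for k
      by (intro theta_exp_eqI) (use int_theta_exp[of 1 1 k] in \<open>simp_all add: algebra_simps\<close>)
    have c: "g (5*k+3) * (- z) powi (5*k+3) = (- (z^3)) * (g (5*k+3) * (-1) powi k)" for k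
      using pw[of k 3] by simp
    have "bilateral_series (\<lambda>k. g (5*k+3) * (- z) powi (5*k+3)) (\<lambda>k. theta_exp 1 0 (5*k+3))
      = fps_const (- (z^3)) * bilateral_series (\<lambda>k. g (5 * k
      + 3) * (-1) powi k) (\<lambda>k. 25 * theta_exp 1 1 k + 3)"
      by (simp only: e c bilateral_series_cmult)
    then show ?thesis by (subst (asm) bilateral_series_compose) auto
  qed
  have 4: "bilateral_series (\<lambda>k. g (5*k+4) * (- z) powi (5*k+4)) (\<lambda>k. theta_exp 1 0 (5*k+4))
     = - fps_const (z^4) * (fps_X * (bilateral_series (\<lambda>k. g (- 5 * k
      - 1) * (-1) powi k) (theta_exp 5 4) oo fps_X ^ 5))"
  proof -
    have e: "theta_exp 1 0 (5 * (- k - 1) + 4) = 5 * theta_exp 5 4 k + 1" for k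
      by (intro theta_exp_eqI) (use int_theta_exp[of 4 5 k] in \<open>simp_all add: algebra_simps\<close>)
    have m: "(-1) powi (- k - 1) = (- ((-1) powi k) :: complex)" for k :: int
      by (simp add: power_int_diff power_int_minus_one_minus)
    have i: "5 * (- k - 1) + 4 = - 5 * k - (1 :: int)" for k by simp
    have c: "g (5 * (- k - 1) + 4) * (- z) powi (5 * (- k - 1) + 4) = - (z^4) * (g (- 5 * k - 1) * (-1) powi k)" for k
    proof -
      have "(- z) powi (5 * (- k - 1) + 4) = z^4 * - ((-1) powi k)"
        using pw[of "- k - 1" 4] m[of k] by simp
      then show ?thesis unfolding i by simp
    qed
    have "bilateral_series (\<lambda>k. g (5*k+4) * (- z) powi (5*k+4)) (\<lambda>k. theta_exp 1 0 (5*k+4))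
      = bilateral_series (\<lambda>k. g (5 * (- k - 1) + 4) * (- z) powi (5 * (- k - 1) + 4)) (\<lambda>k. theta_exp 1 0 (5 * (- k - 1) + 4))"
      by (rule bilateral_series_reindex) (auto intro!: bij_betwI[where g = "\<lambda>k. - k - 1"])
    also have "\<dots> = fps_const (- (z^4)) * bilateral_series (\<lambda>k. g (- 5 * k
      - 1) * (-1) powi k) (\<lambda>k. 5 * theta_exp 5 4 k + 1)"
      by (simp only: e c bilateral_series_cmult)
    finally show ?thesis by (subst (asm) bilateral_series_compose) auto
  qed
  show ?thesis
    by (subst bilateral_series_dissect5, simp add: finite_fibres_theta_exp)
      (simp only: 0 1 2 3 4 mult_minus_left add_uminus_conv_diff)
qed

definition fS :: "complex fps" where
  "fS = bilateral_series (\<lambda>n. of_int n * (-1) powi n) (theta_exp 5 3)"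

definition fT :: "complex fps" where
  "fT = bilateral_series (\<lambda>n. of_int n * (-1) powi n) (theta_exp 5 4)"

lemma fS_eq: "(\<Sum>\<^sub>\<infinity>n::int. fps_const ((-1) powi n * of_int n) * fps_X ^ nat (n * (5 * n + 1) div 2)) = fS"
proof (rule infsumI)
  have "theta_exp 5 3 n = nat (n * (5 * n + 1) div 2)" for n
  proof (rule theta_exp_eqI)
    have "n * (5 * n + 1) \<ge> 0"
      using int_theta_exp[of 3 5 n] by (simp add: algebra_simps)
    moreover have "even (n * (5 * n + 1))" by simp
    ultimately have "2 * int (nat (n * (5 * n + 1) div 2)) = n * (5 * n + 1)" by simp
    then show "2 * int (nat (n * (5 * n + 1) div 2)) = int 5 * (n * (n - 1)) + 2 * int 3 * n"
      by (simp add: algebra_simps)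
  qed simp
  then show "((\<lambda>n. fps_const ((-1) powi n * of_int n) * fps_X ^ nat (n * (5 * n + 1) div 2)) has_sum fS) UNIV"
    using has_sum_bilateral_series[of "theta_exp 5 3" "\<lambda>n. of_int n * (-1) powi n"] finite_fibres_theta_exp[of 3 5]
    by (simp add: fS_def mult.commute)
qed

lemma bilateral_series_theta1_affine:
  "bilateral_series (\<lambda>n. (a + b * of_int n) * (-1) powi n) (theta_exp 5 3) = fps_const a * (fB * fE5) + fps_const b * fS"
  unfolding fS_def theta1_product[symmetric] bilateral_series_cmult bilateral_series_add by (simp add: algebra_simps)

lemma bilateral_series_theta2_affine:
  "bilateral_series (\<lambda>n. (a + b * of_int n) * (-1) powi n) (theta_exp 5 4) = fps_const a * (fA * fE5) + fps_const b * fT"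
  unfolding fT_def theta2_product[symmetric] bilateral_series_cmult bilateral_series_add by (simp add: algebra_simps)

lemma theta_exp_triangular_shift: "theta_exp 1 0 (n + 1) = theta_exp 1 1 n"
  by (rule theta_exp_eqI) (use int_theta_exp[of 1 1 n] in \<open>simp_all add: algebra_simps\<close>)

text \<open>The shift of n by one brings class 3 of the dissection back to the series at z = 1,
  where \<open>J\<close> vanishes and \<open>K\<close> is a multiple of E1^3.\<close>

lemma bilateral_series_triangular: "bilateral_series (\<lambda>n. g n * (-1) powi n) (theta_exp 1 1) = - bilateral_series (\<lambda>n. g (n - 1) * (-1) powi n) (theta_exp 1 0)"
proof -
  have "bilateral_series (\<lambda>n. g (n - 1) * (-1) powi n) (theta_exp 1 0)
    = bilateral_series (\<lambda>n. g (n + 1 - 1) * (-1) powi (n + 1)) (\<lambda>n. theta_exp 1 0 (n + 1))"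
    by (rule bilateral_series_reindex) (auto intro!: bij_betwI[where g = "\<lambda>n. n - 1"])
  also have "\<dots> = bilateral_series (\<lambda>n. (-1) * (g n * (-1) powi n)) (theta_exp 1 1)"
    unfolding theta_exp_triangular_shift by (simp add: power_int_add)
  also have "\<dots> = fps_const (-1) * bilateral_series (\<lambda>n. g n * (-1) powi n) (theta_exp 1 1)"
    by (rule bilateral_series_cmult[symmetric])
  finally show ?thesis by (simp flip: fps_const_neg)
qed

text \<open>The prefix \<open>c\<close> marks the substitution \<open>q \<mapsto> q\<^sup>5\<close>. The series \<open>cM1\<close> and \<open>cM2\<close> are
  \<open>\<Sum> (-1)\<^sup>n (10n+1) q\<^bsup>n(5n+1)/2\<^esup>\<close> and \<open>\<Sum> (-1)\<^sup>n (10n+3) q\<^bsup>n(5n+3)/2\<^esup>\<close> after this substitution.\<close>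

definition cA :: "complex fps" where "cA = (fA oo fps_X ^ 5)"
definition cB :: "complex fps" where "cB = (fB oo fps_X ^ 5)"
definition cE :: "complex fps" where "cE = (fE5 oo fps_X ^ 5)"
definition cM1 :: "complex fps" where "cM1 = ((fB * fE5 + 10 * fS) oo fps_X ^ 5)"
definition cM2 :: "complex fps" where "cM2 = ((3 * (fA * fE5) + 10 * fT) oo fps_X ^ 5)"

lemma fE5_eq: "fE5 = cA * cB * cE"
  by (subst fE5_eq_compose, subst fE1_eq) (simp add: cA_def cB_def cE_def fps_compose_mult_distrib)

lemma cE_eq: "cE = qpoch (fps_X ^ 25) (fps_X ^ 25)"
proof -
  have "fps_X ^ 5 oo fps_X ^ 5 = (fps_X ^ 25 :: complex fps)"
    by (subst fps_X_power_compose) (simp_all flip: power_mult)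
  then show ?thesis unfolding cE_def fE5_def by (subst qpoch_compose) auto
qed

lemma J_1: "J 1 = 0"
  by (simp add: J_eq)

text \<open>Class 3 contributes a multiple of \<open>J 1 = 0\<close>, and the other four classes
  agree in pairs.\<close>

lemma J_dissect:
  assumes z: "z ^ 5 = 1"
  shows "J z = fps_const (1 - z) * (cB * cE) + fps_const (z^2 - z^4) * (fps_X * (cA * cE))"
proof -
  have 1: "(bilateral_series (\<lambda>n. (-1) powi n) (theta_exp 5 3) oo fps_X ^ 5) = cB * cE"
    unfolding theta1_product cB_def cE_def by (simp add: fps_compose_mult_distrib)
  have 2: "(bilateral_series (\<lambda>n. (-1) powi n) (theta_exp 5 4) oo fps_X ^ 5) = cA * cE"
    unfolding theta2_product cA_def cE_def by (simp add: fps_compose_mult_distrib)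
  have 3: "bilateral_series (\<lambda>n. (-1) powi n) (theta_exp 1 1) = 0"
    using bilateral_series_triangular[of "\<lambda>_. 1"] J_1 by (simp add: J_def)
  have "J z = cB * cE - fps_const z * (cB * cE) + fps_const (z^2) * (fps_X * (cA * cE)) - fps_const (z^4) * (fps_X * (cA * cE))"
    using theta_dissect5[OF z, of "\<lambda>_. 1"] unfolding J_def mult_1_left 1 2 3 by simp
  also have "\<dots> = (1 - fps_const z) * (cB * cE) + (fps_const (z^2) - fps_const (z^4)) * (fps_X * (cA * cE))"
    by (simp only: left_diff_distrib mult_1_left) (simp only: add_diff_eq)
  also have "\<dots> = fps_const (1 - z) * (cB * cE) + fps_const (z^2 - z^4) * (fps_X * (cA * cE))"
    by (simp only: fps_const_sub[symmetric] fps_const_1_eq_1)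
  finally show ?thesis .
qed

lemma numeral_compose: "(numeral k oo f) = (numeral k :: 'a::comm_ring_1 fps)"
  by (simp only: numeral_fps_const fps_const_compose)

text \<open>The weight 2n - 1 becomes affine in k on each class; on class 3 it is 5 times the same
  weight after a shift, so this class is a multiple of \<open>K 1\<close>. The value of
  \<open>K 1\<close>, Jacobi's identity for E1^3, is a hypothesis because it is derived further
  below from partition generating functions.\<close>

lemma K_dissect:
  assumes z: "z ^ 5 = 1" and K1: "K 1 = - 2 * fE1 ^ 3"
  shows "K z = - fps_const (1 + z) * cM1 + fps_const (z^2 + z^4) * (fps_X * cM2) - fps_const (10 * z^3) * (fps_X ^ 3 * cE ^ 3)"
proof -
  have rearrange: "- m - c1 * m + c2 * (x * n) - c3 * (y * (10 * e)) - c4 * (x * (- n))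
      = - (1 + c1) * m + (c2 + c4) * (x * n) - (10 * c3) * (y * e)" for m n c1 c2 c3 c4 x y e :: "complex fps"
    by (simp add: algebra_simps)
  let ?g = "\<lambda>n::int. 2 * of_int n - 1 :: complex"
  let ?b = "\<lambda>h. bilateral_series (\<lambda>n. h n * (-1) powi n)"
  have c: "fps_const 1 = (1 :: complex fps)" "fps_const 3 = (3 :: complex fps)" "fps_const 10 = (10 :: complex fps)"
    "fps_const (-1) = (- 1 :: complex fps)" "fps_const (-3) = (- 3 :: complex fps)" "fps_const (-10) = (- 10 :: complex fps)"
    by (simp_all only: fps_const_neg[symmetric] fps_const_1_eq_1 numeral_fps_const)
  have 0: "?b (\<lambda>k. ?g (- 5 * k)) (theta_exp 5 3) = - (fB * fE5 + 10 * fS)"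
  proof -
    have "(\<lambda>k. ?g (- 5 * k) * (-1) powi k) = (\<lambda>n. (- 1 + (- 10) * of_int n) * (-1) powi n)"
      by (simp add: fun_eq_iff algebra_simps)
    then show ?thesis by (simp only: bilateral_series_theta1_affine c) simp
  qed
  have 1: "?b (\<lambda>k. ?g (5 * k + 1)) (theta_exp 5 3) = fB * fE5 + 10 * fS"
  proof -
    have "(\<lambda>k. ?g (5 * k + 1) * (-1) powi k) = (\<lambda>n. (1 + 10 * of_int n) * (-1) powi n)"
      by (simp add: fun_eq_iff algebra_simps)
    then show ?thesis by (simp only: bilateral_series_theta1_affine c) simp
  qed
  have 2: "?b (\<lambda>k. ?g (5 * k + 2)) (theta_exp 5 4) = 3 * (fA * fE5) + 10 * fT"
  proof -
    have "(\<lambda>k. ?g (5 * k + 2) * (-1) powi k) = (\<lambda>n. (3 + 10 * of_int n) * (-1) powi n)"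
      by (simp add: fun_eq_iff algebra_simps)
    then show ?thesis by (simp only: bilateral_series_theta2_affine c)
  qed
  have 4: "?b (\<lambda>k. ?g (- 5 * k - 1)) (theta_exp 5 4) = - (3 * (fA * fE5) + 10 * fT)"
  proof -
    have "(\<lambda>k. ?g (- 5 * k - 1) * (-1) powi k) = (\<lambda>n. (- 3 + (- 10) * of_int n) * (-1) powi n)"
      by (simp add: fun_eq_iff algebra_simps)
    then show ?thesis by (simp only: bilateral_series_theta2_affine c) simp
  qed
  have 3: "?b (\<lambda>k. ?g (5 * k + 3)) (theta_exp 1 1) = 10 * fE1 ^ 3"
  proof -
    have "?b (\<lambda>k. ?g (5 * k + 3)) (theta_exp 1 1) = - ?b (\<lambda>k. ?g (5 * (k - 1) + 3)) (theta_exp 1 0)"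
      by (rule bilateral_series_triangular)
    also have "(\<lambda>k. ?g (5 * (k - 1) + 3) * (-1) powi k) = (\<lambda>k. 5 * (?g k * (- 1) powi k))"
      by (simp add: algebra_simps)
    also have "- bilateral_series (\<lambda>k. 5 * (?g k * (- 1) powi k)) (theta_exp 1 0) = - (fps_const 5 * K 1)"
      unfolding K_def bilateral_series_cmult ..
    also have "\<dots> = 10 * fE1 ^ 3" unfolding K1 by (simp flip: numeral_fps_const)
    finally show ?thesis .
  qed
  have c25: "(10 * fE1 ^ 3 oo fps_X ^ 25) = 10 * cE ^ 3"
  proof -
    have "(10 * fE1 ^ 3 oo fps_X ^ 25) = 10 * (fE1 oo fps_X ^ 25) ^ 3"
      by (simp add: fps_compose_mult_distrib fps_compose_power numeral_compose)
    moreover have "(fE1 oo fps_X ^ 25) = cE"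
      unfolding fE1_def cE_eq by (subst qpoch_compose) auto
    ultimately show ?thesis by simp
  qed
  have "K z = - cM1 - fps_const z * cM1 + fps_const (z^2) * (fps_X * cM2)
      - fps_const (z^3) * (fps_X ^ 3 * (10 * cE ^ 3)) - fps_const (z^4) * (fps_X * (- cM2))"
    using theta_dissect5[OF z, of ?g]
    unfolding K_def 0 1 2 3 4 fps_compose_uminus c25 cM1_def[symmetric] cM2_def[symmetric] .
  also have "\<dots> = - (1 + fps_const z) * cM1 + (fps_const (z^2) + fps_const (z^4)) * (fps_X * cM2) - (10 * fps_const (z^3)) * (fps_X ^ 3 * cE ^ 3)"
    by (rule rearrange)
  also have "\<dots> = - fps_const (1 + z) * cM1 + fps_const (z^2 + z^4) * (fps_X * cM2) - fps_const (10 * z^3) * (fps_X ^ 3 * cE ^ 3)"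
    by (simp only: fps_const_add[symmetric] fps_const_mult[symmetric] fps_const_1_eq_1 numeral_fps_const)
  finally show ?thesis .
qed

subsection \<open>Generating functions of partitions by number of parts\<close>

definition partitions_of :: "nat \<Rightarrow> nat multiset set" where
  "partitions_of m = {p. is_partition p \<and> sum_mset p = m}"

definition partition_gf :: "(nat multiset \<Rightarrow> complex) \<Rightarrow> complex fps" where
  "partition_gf w = Abs_fps (\<lambda>m. \<Sum>p\<in>partitions_of m. w p)"

lemma finite_partitions_of [simp]: "finite (partitions_of m)"
  by (rule finite_subset[OF _ finite_partitions_le[of m]]) (auto simp: partitions_of_def)

text \<open>This is the series U(z); \<open>weighted_size_gf\<close> is z U'(z).\<close>

definition size_gf :: "complex \<Rightarrow> complex fps" where
  "size_gf z = partition_gf (\<lambda>p. z ^ size p)"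

definition weighted_size_gf :: "complex \<Rightarrow> complex fps" where
  "weighted_size_gf z = partition_gf (\<lambda>p. of_nat (size p) * z ^ size p)"

definition partitions_bounded :: "nat \<Rightarrow> nat \<Rightarrow> nat multiset set" where
  "partitions_bounded N m = {p. set_mset p \<subseteq> {1..N} \<and> sum_mset p = m}"

lemma partitions_bounded_eq: "m \<le> N \<Longrightarrow> partitions_bounded N m = partitions_of m"
proof -
  assume "m \<le> N"
  have "x \<le> sum_mset p" if "x \<in># p" for x and p :: "nat multiset"
    using that by (metis le_add1 multi_member_split sum_mset.add_mset)
  then show ?thesis
    using \<open>m \<le> N\<close> by (fastforce simp: partitions_bounded_def partitions_of_def is_partition_def Suc_le_eq intro: gr0I)
qed

lemma finite_partitions_bounded [simp]: "finite (partitions_bounded N m)"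
  by (rule finite_subset[OF _ finite_partitions_of[of m]]) (auto simp: partitions_of_def partitions_bounded_def is_partition_def)

text \<open>Either no part equals N + 1, or one copy of that part is removed; the rest may still
  contain it, hence \<open>Suc N\<close> on the right.\<close>

lemma partitions_bounded_Suc:
  "partitions_bounded (Suc N) m = partitions_bounded N m \<union> (if Suc N \<le> m then add_mset (Suc N) ` partitions_bounded (Suc N) (m - Suc N) else {})"
proof (rule set_eqI)
  fix p
  show "p \<in> partitions_bounded (Suc N) m \<longleftrightarrow> p \<in> partitions_bounded N m \<union> (if Suc N \<le> m then add_mset (Suc N) ` partitions_bounded (Suc N) (m - Suc N) else {})"
  proof (cases "Suc N \<in># p")
    case True
    then obtain r where r: "p = add_mset (Suc N) r" by (meson multi_member_split)
    then show ?thesis by (auto simp: partitions_bounded_def)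
  next
    case False
    then have "set_mset p \<subseteq> {1..Suc N} \<longleftrightarrow> set_mset p \<subseteq> {1..N}"
      by (auto simp: subset_iff le_Suc_eq)
    moreover have "p \<notin> add_mset (Suc N) ` X" for X using False by auto
    ultimately show ?thesis by (simp add: partitions_bounded_def)
  qed
qed

text \<open>For parts at most N the recurrence gives V(N+1) (1 - z q^(N+1)) = V(N), hence a finite
  product formula. Coefficient m of V(N) no longer changes once N is at least m.\<close>

lemma size_gf_qpoch: "size_gf z * qpoch (fps_const z * fps_X) fps_X = 1"
proof -
  define V where "V = (\<lambda>N. Abs_fps (\<lambda>m. \<Sum>p\<in>partitions_bounded N m. z ^ size p))"
  have rec: "V (Suc N) = V N + fps_const z * fps_X ^ Suc N * V (Suc N)" for N
  proof (rule fps_ext)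
    fix m
    have "(\<Sum>p\<in>partitions_bounded (Suc N) m. z ^ size p) = (\<Sum>p\<in>partitions_bounded N m. z ^ size p)
       + (if Suc N \<le> m then z * (\<Sum>p\<in>partitions_bounded (Suc N) (m - Suc N). z ^ size p) else 0)"
    proof (cases "Suc N \<le> m")
      case True
      have "(\<Sum>p\<in>partitions_bounded (Suc N) m. z ^ size p) = (\<Sum>p\<in>partitions_bounded N m. z ^ size p)
        + (\<Sum>p\<in>add_mset (Suc N) ` partitions_bounded (Suc N) (m - Suc N). z ^ size p)"
      proof (subst partitions_bounded_Suc, simp only: True if_True, rule sum.union_disjoint)
        have "Suc N \<notin># p" if "p \<in> partitions_bounded N m" for p
          using that unfolding partitions_bounded_def by force
        then show "partitions_bounded N m \<inter> add_mset (Suc N) ` partitions_bounded (Suc N) (m - Suc N) = {}"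
          unfolding disjoint_iff by (metis imageE union_single_eq_member)
      qed simp_all
      also have "(\<Sum>p\<in>add_mset (Suc N) ` partitions_bounded (Suc N) (m - Suc N). z ^ size p)
          = z * (\<Sum>p\<in>partitions_bounded (Suc N) (m - Suc N). z ^ size p)"
        by (subst sum.reindex) (auto simp: sum_distrib_left inj_on_def)
      finally show ?thesis using True by simp
    next
      case False
      then show ?thesis by (subst partitions_bounded_Suc) simp
    qed
    then show "fps_nth (V (Suc N)) m = fps_nth (V N + fps_const z * fps_X ^ Suc N * V (Suc N)) m"
      by (simp add: V_def mult.assoc fps_X_power_mult_nth not_less del: power_Suc)
  qed
  have one: "V N * (\<Prod>i<N. 1 - fps_const z * fps_X * fps_X ^ i) = 1" for N
  proof (induction N)
    case 0
    have "partitions_bounded 0 m = (if m = 0 then {{#}} else {})" for m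
      by (auto simp: partitions_bounded_def)
    then show ?case by (auto simp: V_def fps_eq_iff)
  next
    case (Suc N)
    have "V (Suc N) * (1 - fps_const z * fps_X * fps_X ^ N) = V (Suc N) - fps_const z * fps_X ^ Suc N * V (Suc N)"
      by (simp add: algebra_simps)
    also have "\<dots> = V N" unfolding diff_eq_eq by (rule rec)
    finally have eq: "V (Suc N) * (1 - fps_const z * fps_X * fps_X ^ N) = V N" .
    have "V (Suc N) * (\<Prod>i<Suc N. 1 - fps_const z * fps_X * fps_X ^ i)
      = (V (Suc N) * (1 - fps_const z * fps_X * fps_X ^ N)) * (\<Prod>i<N. 1 - fps_const z * fps_X * fps_X ^ i)"
      by (simp only: prod.lessThan_Suc mult_ac)
    then show ?case by (simp only: eq Suc.IH)
  qed
  have "V \<longlonglongrightarrow> size_gf z"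
  proof (rule tendsto_fpsI)
    fix m
    show "\<forall>\<^sub>F N in sequentially. fps_nth (V N) m = fps_nth (size_gf z) m"
      using eventually_ge_at_top[of m]
      by eventually_elim (simp add: V_def size_gf_def partition_gf_def partitions_bounded_eq)
  qed
  then have "(\<lambda>N. V N * (\<Prod>i<N. 1 - fps_const z * fps_X * fps_X ^ i)) \<longlonglongrightarrow> size_gf z * qpoch (fps_const z * fps_X) fps_X"
    by (intro tendsto_mult_fps tendsto_qpoch) auto
  then show ?thesis by (simp only: one LIMSEQ_const_iff)
qed

lemma size_gf_1: "size_gf 1 * fE1 = 1"
  using size_gf_qpoch[of 1] by (simp add: fE1_def)

lemma size_gf_J:
  assumes "z \<noteq> 0"
  shows "size_gf z * size_gf (1 / z) * J z = fps_const (1 - z) * fE1"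
proof -
  have "size_gf z * size_gf (1 / z) * J z = fps_const (1 - z) * (size_gf z * qpoch (fps_const z * fps_X) fps_X)
     * (size_gf (1 / z) * qpoch (fps_const (1 / z) * fps_X) fps_X) * fE1"
    unfolding J_eq[OF assms] by (simp only: mult_ac)
  then show ?thesis by (simp only: size_gf_qpoch mult_1_right)
qed

text \<open>The coefficientwise derivative in a complex parameter, not the formal derivative in \<open>q\<close>.\<close>

definition fps_has_deriv :: "(complex \<Rightarrow> complex fps) \<Rightarrow> complex fps \<Rightarrow> complex \<Rightarrow> bool" where
  "fps_has_deriv F F' z \<longleftrightarrow> (\<forall>m. ((\<lambda>w. fps_nth (F w) m) has_field_derivative fps_nth F' m) (at z))"

lemma fps_has_deriv_mult:
  assumes "fps_has_deriv F F' z" "fps_has_deriv G G' z"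
  shows "fps_has_deriv (\<lambda>w. F w * G w) (F' * G z + F z * G') z"
  unfolding fps_has_deriv_def
proof
  fix m
  have F: "((\<lambda>w. fps_nth (F w) i) has_field_derivative fps_nth F' i) (at z)"
    and G: "((\<lambda>w. fps_nth (G w) i) has_field_derivative fps_nth G' i) (at z)" for i
    using assms by (auto simp: fps_has_deriv_def)
  have "((\<lambda>w. \<Sum>i=0..m. fps_nth (F w) i * fps_nth (G w) (m - i)) has_field_derivative
     (\<Sum>i=0..m. fps_nth F' i * fps_nth (G z) (m - i) + fps_nth G' (m - i) * fps_nth (F z) i)) (at z)"
    by (intro DERIV_sum DERIV_mult F G)
  then show "((\<lambda>w. fps_nth (F w * G w) m) has_field_derivative fps_nth (F' * G z + F z * G') m) (at z)"
    by (simp add: fps_mult_nth sum.distrib mult.commute[of "fps_nth G' _"])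
qed

text \<open>The complement of 0 is open, so agreement there determines the derivative at a nonzero
  point; \<open>1 / w\<close> is meaningful only there.\<close>

lemma fps_has_deriv_unique:
  assumes F: "fps_has_deriv F F' z" and G: "fps_has_deriv G G' z" and eq: "\<And>w. w \<noteq> 0 \<Longrightarrow> F w = G w" and z: "z \<noteq> 0"
  shows "F' = G'"
proof (rule fps_ext)
  fix m
  have "((\<lambda>w. fps_nth (G w) m) has_field_derivative fps_nth F' m) (at z)"
  proof (rule has_field_derivative_transform_within_open)
    show "((\<lambda>w. fps_nth (F w) m) has_field_derivative fps_nth F' m) (at z)"
      using F by (simp add: fps_has_deriv_def)
    show "open (- {0 :: complex})" by (intro open_Compl closed_singleton)
  qed (use z eq in auto)
  moreover have "((\<lambda>w. fps_nth (G w) m) has_field_derivative fps_nth G' m) (at z)"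
    using G by (simp add: fps_has_deriv_def)
  ultimately show "fps_nth F' m = fps_nth G' m" by (rule DERIV_unique)
qed

lemma power_derivative_eq: "z \<noteq> 0 \<Longrightarrow> of_nat n * z ^ (n - Suc 0) = (1 / z) * (of_nat n * z ^ n)" for z :: complex
  by (cases n) auto

lemma fps_has_deriv_size_gf:
  assumes "z \<noteq> 0"
  shows "fps_has_deriv size_gf (fps_const (1 / z) * weighted_size_gf z) z"
  unfolding fps_has_deriv_def size_gf_def weighted_size_gf_def partition_gf_def fps_nth_Abs_fps fps_mult_left_const_nth sum_distrib_left
  by (intro allI DERIV_sum) (auto intro!: derivative_eq_intros simp: power_derivative_eq[OF assms] assms)

lemma fps_has_deriv_size_gf_inverse:
  assumes "z \<noteq> 0"
  shows "fps_has_deriv (\<lambda>w. size_gf (1 / w)) (fps_const (- 1 / z) * weighted_size_gf (1 / z)) z"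
  unfolding fps_has_deriv_def
proof
  fix m
  have 1: "((\<lambda>w. fps_nth (size_gf w) m) has_field_derivative z * fps_nth (weighted_size_gf (1 / z)) m) (at (1 / z))"
    using fps_has_deriv_size_gf[of "1 / z"] assms by (simp add: fps_has_deriv_def)
  have 2: "((\<lambda>w. 1 / w) has_field_derivative - (1 / z ^ 2)) (at z)"
    using assms by (auto intro!: derivative_eq_intros simp: power2_eq_square)
  have "((\<lambda>w. fps_nth (size_gf (1 / w)) m) has_field_derivative (z * fps_nth (weighted_size_gf (1 / z)) m) * (- (1 / z ^ 2))) (at z)"
    by (rule DERIV_chain2[OF 1 2])
  then show "((\<lambda>w. fps_nth (size_gf (1 / w)) m) has_field_derivative fps_nth (fps_const (- 1 / z) * weighted_size_gf (1 / z)) m) (at z)"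
    using assms by (simp add: power2_eq_square)
qed

text \<open>This is z dJ/dz.\<close>

definition J1 :: "complex \<Rightarrow> complex fps" where
  "J1 z = bilateral_series (\<lambda>n. of_int n * (- z) powi n) (theta_exp 1 0)"

lemma K_J1: "K z = 2 * J1 z - J z"
proof -
  have "2 * J1 z - J z = fps_const 2 * J1 z + fps_const (-1) * J z"
    by (simp add: numeral_fps_const[symmetric] fps_const_neg[symmetric] del: fps_const_neg)
  also have "\<dots> = K z"
    unfolding J1_def J_def K_def bilateral_series_cmult bilateral_series_add by (simp add: algebra_simps)
  finally show ?thesis ..
qed

lemma fps_has_deriv_J:
  assumes "z \<noteq> 0"
  shows "fps_has_deriv J (fps_const (1 / z) * J1 z) z"
  unfolding fps_has_deriv_def
proof
  fix m
  have "((\<lambda>w. (- w) powi n) has_field_derivative (1 / z) * (of_int n * (- z) powi n)) (at z)" for n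
  proof -
    have "((\<lambda>w. (- w) powi n) has_field_derivative of_int n * (- z) powi (n - 1) * (- 1)) (at z)"
      using assms by (auto intro!: derivative_eq_intros)
    moreover have "of_int n * (- z) powi (n - 1) * (- 1) = (1 / z) * (of_int n * (- z) powi n)"
      using assms by (simp add: power_int_diff)
    ultimately show ?thesis by simp
  qed
  then show "((\<lambda>w. fps_nth (J w) m) has_field_derivative fps_nth (fps_const (1 / z) * J1 z) m) (at z)"
    unfolding J_def J1_def fps_nth_bilateral_series fps_mult_left_const_nth sum_distrib_left by (intro DERIV_sum) auto
qed

text \<open>The derivative in \<open>z\<close> of \<open>size_gf_J\<close>, multiplied by \<open>z\<close>.\<close>

lemma J_derivative_identity:
  assumes z: "z \<noteq> 0"
  shows "(weighted_size_gf z * size_gf (1 / z) - size_gf z * weighted_size_gf (1 / z)) * J z + size_gf z * size_gf (1 / z) * J1 z = - fps_const z * fE1"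
proof -
  let ?c = "fps_const (1 / z)"
  have "fps_has_deriv (\<lambda>w. size_gf w * size_gf (1 / w) * J w)
    ((?c * weighted_size_gf z * size_gf (1 / z) + size_gf z * (fps_const (- 1 / z) * weighted_size_gf (1 / z))) * J z + size_gf z * size_gf (1 / z) * (?c * J1 z)) z"
    by (intro fps_has_deriv_mult fps_has_deriv_size_gf fps_has_deriv_size_gf_inverse fps_has_deriv_J z)
  moreover have "fps_has_deriv (\<lambda>w. fps_const (1 - w) * fE1) (- fE1) z"
    unfolding fps_has_deriv_def by (auto intro!: derivative_eq_intros)
  ultimately have eq: "(?c * weighted_size_gf z * size_gf (1 / z) + size_gf z * (fps_const (- 1 / z) * weighted_size_gf (1 / z))) * J z + size_gf z * size_gf (1 / z) * (?c * J1 z) = - fE1"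
    by (rule fps_has_deriv_unique) (use z size_gf_J in auto)
  have n: "fps_const (- 1 / z) = - ?c" by simp
  have alg: "(c * a * b + u * (- c * d)) * j + u * b * (c * k) = c * ((a * b - u * d) * j + u * b * k)"
    for a b c d u j k :: "complex fps" by (simp add: algebra_simps)
  have "?c * ((weighted_size_gf z * size_gf (1 / z) - size_gf z * weighted_size_gf (1 / z)) * J z + size_gf z * size_gf (1 / z) * J1 z) = - fE1"
    using eq unfolding n alg .
  then have "fps_const z * (?c * ((weighted_size_gf z * size_gf (1 / z) - size_gf z * weighted_size_gf (1 / z)) * J z + size_gf z * size_gf (1 / z) * J1 z)) = fps_const z * (- fE1)"
    by (simp only:)
  moreover have "fps_const z * ?c = 1" using z by simp
  ultimately show ?thesis by (simp only: mult.assoc[symmetric] mult_1_left mult_minus_right mult_minus_left)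
qed

text \<open>Jacobi's identity for E1^3 in bilateral form. At z = 1 the unknown derivative is
  multiplied by \<open>J 1 = 0\<close>, and \<open>size_gf 1\<close> is the reciprocal of
  E1.\<close>

lemma K_1: "K 1 = - 2 * fE1 ^ 3"
proof -
  have "size_gf 1 * size_gf 1 * J1 1 = - fE1"
    using J_derivative_identity[of 1] by (simp add: J_1)
  then have "(size_gf 1 * fE1) * (size_gf 1 * fE1) * J1 1 = - (fE1 ^ 3)"
    by (simp add: power3_eq_cube mult_ac)
  then have "J1 1 = - (fE1 ^ 3)" by (simp add: size_gf_1)
  then show ?thesis by (simp add: K_J1 J_1)
qed

subsection \<open>The crank generating function at fifth roots of unity\<close>

text \<open>Each colour has its own weight, and both the weight and the number partitioned split
  over the components. Induction peels off the first colour as a Cauchy product.\<close>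

lemma colored_partitions_gf:
  "Abs_fps (\<lambda>n. \<Sum>\<pi>\<in>colored_partitions (length ws) n. prod_list (map2 (\<lambda>w p. w p) ws \<pi>)) = prod_list (map partition_gf ws)"
proof (induction ws)
  case Nil
  have "colored_partitions 0 n = (if n = 0 then {[]} else {})" for n
    by (auto simp: colored_partitions_def)
  then show ?case by (auto simp: fps_eq_iff)
next
  case (Cons w ws)
  let ?C = "colored_partitions (length ws)" and ?f = "\<lambda>\<pi>. prod_list (map2 (\<lambda>w p. w p) ws \<pi>)"
  show ?case
  proof (rule fps_ext)
    fix n
    have "fps_nth (prod_list (map partition_gf (w # ws))) n = (\<Sum>i=0..n. (\<Sum>p\<in>partitions_of i. w p) * (\<Sum>\<pi>\<in>?C (n - i). ?f \<pi>))"
      by (simp add: fps_mult_nth Cons.IH[symmetric] partition_gf_def)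
    also have "\<dots> = (\<Sum>i=0..n. \<Sum>x\<in>partitions_of i \<times> ?C (n - i). w (fst x) * ?f (snd x))"
      by (simp add: sum_product sum.cartesian_product case_prod_unfold)
    also have "\<dots> = (\<Sum>y\<in>(SIGMA i:{0..n}. partitions_of i \<times> ?C (n - i)). w (fst (snd y)) * ?f (snd (snd y)))"
      by (subst sum.Sigma) (auto simp: finite_colored_partitions case_prod_unfold)
    also have "\<dots> = (\<Sum>\<pi>\<in>colored_partitions (length (w # ws)) n. prod_list (map2 (\<lambda>w p. w p) (w # ws) \<pi>))"
    \<comment> \<open>The first index of the triple is redundant: it is the number partitioned by
      the head.\<close>
    proof (rule sum.reindex_bij_witness[where j = "\<lambda>y. fst (snd y) # snd (snd y)" and i = "\<lambda>\<pi>. (sum_mset (hd \<pi>), hd \<pi>, tl \<pi>)"])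
      fix \<pi> assume "\<pi> \<in> colored_partitions (length (w # ws)) n"
      then show "fst (snd (sum_mset (hd \<pi>), hd \<pi>, tl \<pi>)) # snd (snd (sum_mset (hd \<pi>), hd \<pi>, tl \<pi>)) = \<pi>"
        "(sum_mset (hd \<pi>), hd \<pi>, tl \<pi>) \<in> (SIGMA i:{0..n}. partitions_of i \<times> ?C (n - i))"
        by (cases \<pi>; auto simp: colored_partitions_def partitions_of_def)+
    qed (auto simp: colored_partitions_def partitions_of_def)
    finally show "fps_nth (Abs_fps (\<lambda>n. \<Sum>\<pi>\<in>colored_partitions (length (w # ws)) n. prod_list (map2 (\<lambda>w p. w p) (w # ws) \<pi>))) n
       = fps_nth (prod_list (map partition_gf (w # ws))) n"
      by simp
  qed
qed

definition crank_gf :: "complex \<Rightarrow> complex fps" where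
  "crank_gf z = Abs_fps (\<lambda>n. \<Sum>\<pi>\<in>colored_partitions 5 n. of_nat (size (\<pi> ! 0)) * z powi crank \<pi>)"

text \<open>The crank sees only two colours, with opposite exponents of z. The other three get the
  weight \<open>1 ^ size p\<close>, so that each contributes \<open>size_gf 1\<close>.\<close>

lemma crank_gf_eq:
  assumes "z \<noteq> 0"
  shows "crank_gf z = weighted_size_gf z * size_gf (1 / z) * size_gf 1 ^ 3"
proof -
  let ?one = "\<lambda>p :: nat multiset. 1 ^ size p :: complex"
  let ?ws = "[\<lambda>p. of_nat (size p) * z ^ size p, \<lambda>p. (1 / z) ^ size p, ?one, ?one, ?one]"
  have len: "length ?ws = 5" by simp
  have "prod_list (map2 (\<lambda>w p. w p) ?ws \<pi>) = of_nat (size (\<pi> ! 0)) * z powi crank \<pi>"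
    if "\<pi> \<in> colored_partitions 5 n" for \<pi> n
  proof -
    have "length \<pi> = 5" using that by (simp add: colored_partitions_def)
    then obtain a b c d e where p: "\<pi> = [a, b, c, d, e]"
      by (auto simp: numeral_eq_Suc length_Suc_conv)
    have "z powi crank \<pi> = z ^ size a * (1 / z) ^ size b"
      unfolding p crank_def using assms by (simp add: power_int_diff power_divide)
    then have "of_nat (size (\<pi> ! 0)) * z powi crank \<pi> = of_nat (size a) * (z ^ size a * (1 / z) ^ size b)"
      unfolding p by (simp only: nth_Cons_0)
    moreover have "prod_list (map2 (\<lambda>w p. w p) ?ws \<pi>) = of_nat (size a) * z ^ size a * (1 / z) ^ size b"
      unfolding p by (simp only: zip_Cons_Cons zip_Nil list.map prod_list.Cons prod_list.Nil case_prod_conv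
          power_one mult_1_right mult.assoc)
    ultimately show ?thesis by (simp only: mult.assoc)
  qed
  then have "crank_gf z = Abs_fps (\<lambda>n. \<Sum>\<pi>\<in>colored_partitions (length ?ws) n. prod_list (map2 (\<lambda>w p. w p) ?ws \<pi>))"
    unfolding crank_gf_def len by (intro arg_cong[where f = Abs_fps] ext sum.cong refl) (simp only:)
  also have "\<dots> = prod_list (map partition_gf ?ws)" by (rule colored_partitions_gf)
  also have "\<dots> = weighted_size_gf z * size_gf (1 / z) * size_gf 1 ^ 3"
    by (simp only: list.map prod_list.Cons prod_list.Nil weighted_size_gf_def size_gf_def power3_eq_cube mult_1_right mult.assoc)
  finally show ?thesis .
qed

text \<open>\<open>W\<close> is eliminated between the derivative identity and
  \<open>size_gf_J\<close>; this costs a second factor \<open>J z\<close>. The combination 2z J +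
  2(1-z) J1 that arises is (1+z) J + (1-z) K.\<close>

lemma crank_gf_diff:
  assumes z: "z \<noteq> 0"
  shows "2 * (crank_gf z - crank_gf (1 / z)) * fE1 ^ 2 * J z ^ 2 = - (fps_const (1 + z) * J z + fps_const (1 - z) * K z)"
proof -
  define D where "D = weighted_size_gf z * size_gf (1 / z) - size_gf z * weighted_size_gf (1 / z)"
  define W where "W = size_gf z * size_gf (1 / z)"
  have "crank_gf z - crank_gf (1 / z) = D * size_gf 1 ^ 3"
    using z by (simp add: crank_gf_eq D_def algebra_simps)
  then have "(crank_gf z - crank_gf (1 / z)) * fE1 ^ 3 = D * (size_gf 1 * fE1) ^ 3"
    by (simp only: power_mult_distrib mult.assoc)
  then have D: "(crank_gf z - crank_gf (1 / z)) * fE1 ^ 3 = D" by (simp only: size_gf_1 power_one mult_1_right)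
  have 1: "D * J z + W * J1 z = - fps_const z * fE1"
    using J_derivative_identity[OF z] unfolding D_def W_def .
  have 2: "W * J z = fps_const (1 - z) * fE1"
    using size_gf_J[OF z] unfolding W_def .
  have alg: "2 * (- c * e) * j - ((1 - c) * e) * (2 * k) = e * - ((1 + c) * j + (1 - c) * (2 * k - j))"
    for c e j k :: "complex fps" by (simp add: algebra_simps)
  have K: "K z = 2 * J1 z - J z" by (rule K_J1)
  have "2 * D * J z ^ 2 = 2 * (D * J z + W * J1 z) * J z - (W * J z) * (2 * J1 z)"
    by (simp add: algebra_simps power2_eq_square)
  also have "\<dots> = fE1 * - ((1 + fps_const z) * J z + (1 - fps_const z) * (2 * J1 z - J z))"
    unfolding 1 2 fps_const_sub[symmetric] fps_const_1_eq_1 by (rule alg)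
  also have "\<dots> = fE1 * - (fps_const (1 + z) * J z + fps_const (1 - z) * K z)"
    unfolding K by (simp only: fps_const_sub[symmetric] fps_const_add[symmetric] fps_const_1_eq_1)
  finally have eq: "fE1 * (2 * (crank_gf z - crank_gf (1 / z)) * fE1 ^ 2 * J z ^ 2) = fE1 * - (fps_const (1 + z) * J z + fps_const (1 - z) * K z)"
    unfolding D[symmetric] by (simp only: power2_eq_square power3_eq_cube mult_ac)
  have "fE1 \<noteq> 0"
  proof
    assume "fE1 = 0"
    then have "fps_nth fE1 0 = 0" by (simp only: fps_zero_nth)
    then show False by simp
  qed
  from mult_left_cancel[THEN iffD1, OF this eq] show ?thesis .
qed

section \<open>The odd function with values 1, 3, -3, -1 at 1, 2, 3, 4 modulo 5, and its Fourier
  expansion\<close>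

definition nb_char :: "int \<Rightarrow> complex" where
  "nb_char t = (if [t = 1] (mod 5) then 1 else 0) - (if [t = 4] (mod 5) then 1 else 0)
     + 3 * (if [t = 2] (mod 5) then 1 else 0) - 3 * (if [t = 3] (mod 5) then 1 else 0)"

lemma prim5_powi:
  assumes "prim5 z"
  shows "z powi t = z ^ nat (t mod 5)"
proof -
  have "z powi t = z powi (5 * (t div 5) + t mod 5)" by simp
  also have "\<dots> = (z ^ 5) powi (t div 5) * z powi (t mod 5)"
    by (subst power_int_add) (use assms in \<open>auto simp: power_int_mult\<close>)
  also have "z powi (t mod 5) = z ^ nat (t mod 5)"
    by (simp add: power_int_def)
  finally show ?thesis by (simp only: prim5_power[OF assms] power_int_1_left mult_1_left)
qed

text \<open>The discrete Fourier expansion of the odd function \<^const>\<open>nb_char\<close> on residues modulo 5.\<close>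

lemma nb_char_eq:
  assumes z: "prim5 z"
  shows "((z^4 - z) + 3 * (z^3 - z^2)) * (z powi t - z powi (- t))
     + ((z^3 - z^2) + 3 * (z - z^4)) * (z powi (2 * t) - z powi (- (2 * t))) = 5 * nb_char t"
proof -
  have z5: "z ^ 5 = 1" by (rule prim5_power[OF z])
  \<comment> \<open>All five cases reduce to the single relation
    \<open>a * a + b * b = - 5\<close>.\<close>
  define a b where "a = z - z^4" and "b = z^2 - z^3"
  have "a * a + b * b = (z^2 + z^5 * z^3 + z^4 + z^5 * z) - 4 * z^5"
    by (simp add: a_def b_def algebra_simps flip: power_add power_Suc power_Suc2) (simp add: power2_eq_square)
  also have "\<dots> = (1 + z + z^2 + z^3 + z^4) - 5" unfolding z5 by simp
  finally have ab: "a * a + b * b = - 5" by (simp only: z[unfolded prim5_def] diff_0)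
  have alg: "(- a - 3 * b) * a + (- b + 3 * a) * b = - (a * a + b * b)"
    "(- a - 3 * b) * b + (- b + 3 * a) * (- a) = - 3 * (a * a + b * b)"
    "(- a - 3 * b) * (- b) + (- b + 3 * a) * a = 3 * (a * a + b * b)"
    "(- a - 3 * b) * (- a) + (- b + 3 * a) * (- b) = a * a + b * b"
    by (simp_all add: algebra_simps)
  have n: "nat 0 = 0" "nat 1 = 1" "nat 2 = 2" "nat 3 = 3" "nat 4 = 4" by simp_all
  have coeff: "(z^4 - z) + 3 * (z^3 - z^2) = - a - 3 * b" "(z^3 - z^2) + 3 * (z - z^4) = - b + 3 * a"
    by (simp_all add: a_def b_def)
  have diff: "z^4 - z = - a" "z^3 - z^2 = - b" "z - z^4 = a" "z^2 - z^3 = b"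
    by (simp_all add: a_def b_def)
  consider "t mod 5 = 0" | "t mod 5 = 1" | "t mod 5 = 2" | "t mod 5 = 3" | "t mod 5 = 4" by linarith
  then show ?thesis
  proof cases
    case 1
    then have m: "(- t) mod 5 = 0" "(2 * t) mod 5 = 0" "(- (2 * t)) mod 5 = 0" by presburger+
    have "nb_char t = 0" by (simp add: nb_char_def cong_def 1)
    then show ?thesis by (simp only: prim5_powi[OF z] m 1 n) simp
  next
    case 2
    then have m: "(- t) mod 5 = 4" "(2 * t) mod 5 = 2" "(- (2 * t)) mod 5 = 3" by presburger+
    have c: "nb_char t = 1" by (simp add: nb_char_def cong_def 2)
    have "(- a - 3 * b) * a + (- b + 3 * a) * b = 5 * (1)" unfolding alg ab by simp
    then show ?thesis unfolding coeff c by (simp only: prim5_powi[OF z] m 2 n power_one_right diff)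
  next
    case 3
    then have m: "(- t) mod 5 = 3" "(2 * t) mod 5 = 4" "(- (2 * t)) mod 5 = 1" by presburger+
    have c: "nb_char t = 3" by (simp add: nb_char_def cong_def 3)
    have "(- a - 3 * b) * b + (- b + 3 * a) * (- a) = 5 * (3)" unfolding alg ab by simp
    then show ?thesis unfolding coeff c by (simp only: prim5_powi[OF z] m 3 n power_one_right diff)
  next
    case 4
    then have m: "(- t) mod 5 = 2" "(2 * t) mod 5 = 1" "(- (2 * t)) mod 5 = 4" by presburger+
    have c: "nb_char t = - 3" by (simp add: nb_char_def cong_def 4)
    have "(- a - 3 * b) * (- b) + (- b + 3 * a) * a = 5 * (- 3)" unfolding alg ab by simp
    then show ?thesis unfolding coeff c by (simp only: prim5_powi[OF z] m 4 n power_one_right diff)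
  next
    case 5
    then have m: "(- t) mod 5 = 1" "(2 * t) mod 5 = 3" "(- (2 * t)) mod 5 = 2" by presburger+
    have c: "nb_char t = - 1" by (simp add: nb_char_def cong_def 5)
    have "(- a - 3 * b) * (- a) + (- b + 3 * a) * (- b) = 5 * (- 1)" unfolding alg ab by simp
    then show ?thesis unfolding coeff c by (simp only: prim5_powi[OF z] m 5 n power_one_right diff)
  qed
qed

text \<open>The generating function before the argument is split modulo 5; its classes 2 and 4 are
  the series G_2 and G_4.\<close>

definition Phi :: "complex fps" where
  "Phi = Abs_fps (\<lambda>n. of_nat (NB 5 1 5 n) - of_nat (NB 5 4 5 n) + 3 * of_nat (NB 5 2 5 n) - 3 * of_nat (NB 5 3 5 n))"

lemma Phi_nth: "fps_nth Phi n = (\<Sum>\<pi>\<in>colored_partitions 5 n. of_nat (size (\<pi> ! 0)) * nb_char (crank \<pi>))"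
proof -
  have NB: "of_nat (NB 5 m 5 n) = (\<Sum>\<pi>\<in>colored_partitions 5 n. of_nat (size (\<pi> ! 0)) * (if [crank \<pi> = int m] (mod 5) then 1 else 0) :: complex)" for m
  proof -
    have "of_nat (NB 5 m 5 n) = (\<Sum>\<pi> | \<pi> \<in> colored_partitions 5 n \<and> [crank \<pi> = int m] (mod 5). of_nat (size (\<pi> ! 0)) :: complex)"
      by (simp only: NB_def of_nat_sum of_nat_numeral)
    also have "\<dots> = (\<Sum>\<pi>\<in>colored_partitions 5 n. if [crank \<pi> = int m] (mod 5) then of_nat (size (\<pi> ! 0)) else 0)"
      by (rule sum.inter_filter[OF finite_colored_partitions])
    also have "\<dots> = (\<Sum>\<pi>\<in>colored_partitions 5 n. of_nat (size (\<pi> ! 0)) * (if [crank \<pi> = int m] (mod 5) then 1 else 0))"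
      by (rule sum.cong) auto
    finally show ?thesis .
  qed
  have s: "s * nb_char t = s * (if [t = int 1] (mod 5) then 1 else 0) - s * (if [t = int 4] (mod 5) then 1 else 0)
     + 3 * (s * (if [t = int 2] (mod 5) then 1 else 0)) - 3 * (s * (if [t = int 3] (mod 5) then 1 else 0))" for s t
    by (simp add: nb_char_def algebra_simps)
  show ?thesis
    by (simp only: Phi_def fps_nth_Abs_fps NB s sum.distrib sum_subtractf sum_distrib_left[symmetric])
qed

lemma Phi_crank_gf:
  assumes z: "prim5 z"
  shows "5 * Phi = fps_const ((z^4 - z) + 3 * (z^3 - z^2)) * (crank_gf z - crank_gf (1 / z))
     + fps_const ((z^3 - z^2) + 3 * (z - z^4)) * (crank_gf (z^2) - crank_gf (1 / z^2))"
proof (rule fps_ext)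
  fix n
  have i: "(1 / w) powi t = w powi (- t)" for w :: complex and t
    by (simp only: power_int_divide_distrib power_int_1_left power_int_minus inverse_eq_divide)
  have sq: "(z^2) powi t = z powi (2 * t)" for t
    by (simp add: power_int_mult)
  have e: "5 * (of_nat s * nb_char t) = ((z^4 - z) + 3 * (z^3 - z^2)) * (of_nat s * z powi t - of_nat s * (1 / z) powi t)
     + ((z^3 - z^2) + 3 * (z - z^4)) * (of_nat s * (z^2) powi t - of_nat s * (1 / z^2) powi t)" for s t
  proof -
    have alg: "c * (s * x - s * y) + d * (s * u - s * v) = s * (c * (x - y) + d * (u - v))" for c d s x y u v :: complex
      by (simp add: algebra_simps)
    show ?thesis unfolding i sq alg using nb_char_eq[OF z, of t] by simp
  qed
  have "fps_nth (5 * Phi) n = 5 * fps_nth Phi n"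
    by (simp only: numeral_fps_const fps_mult_left_const_nth)
  also have "\<dots> = (\<Sum>\<pi>\<in>colored_partitions 5 n. 5 * (of_nat (size (\<pi> ! 0)) * nb_char (crank \<pi>)))"
    unfolding Phi_nth sum_distrib_left ..
  also have "\<dots> = fps_nth (fps_const ((z^4 - z) + 3 * (z^3 - z^2)) * (crank_gf z - crank_gf (1 / z))
     + fps_const ((z^3 - z^2) + 3 * (z - z^4)) * (crank_gf (z^2) - crank_gf (1 / z^2))) n"
    unfolding e by (simp only: fps_add_nth fps_sub_nth fps_mult_left_const_nth crank_gf_def fps_nth_Abs_fps
        sum.distrib sum_distrib_left[symmetric] sum_subtractf)
  finally show "fps_nth (5 * Phi) n = \<dots>" .
qed

subsection \<open>Relations between the dissected products\<close>

definition section5 :: "nat \<Rightarrow> complex fps \<Rightarrow> complex fps" where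
  "section5 r f = Abs_fps (\<lambda>n. fps_nth f (5 * n + r))"

lemma section5_add [simp]: "section5 r (f + g) = section5 r f + section5 r g"
  and section5_diff [simp]: "section5 r (f - g) = section5 r f - section5 r g"
  and section5_uminus [simp]: "section5 r (- f) = - section5 r f"
  and section5_const [simp]: "section5 r (fps_const c * f) = fps_const c * section5 r f"
  by (simp_all add: section5_def fps_eq_iff)

lemma section5_numeral [simp]: "section5 r (numeral k * f) = numeral k * section5 r f"
  by (simp only: numeral_fps_const section5_const)

text \<open>Series in q^5 behave as scalars for the extraction of a residue class.\<close>

lemma section5_compose_mult:
  assumes "r < 5"
  shows "section5 r ((g oo fps_X ^ 5) * f) = g * section5 r f"
proof (rule fps_ext)
  fix n
  have "fps_nth ((g oo fps_X ^ 5) * f) (5 * n + r) = (\<Sum>i=0..5*n+r. if 5 dvd i then fps_nth g (i div 5) * fps_nth f (5 * n + r - i) else 0)"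
    by (simp add: fps_mult_nth fps_nth_compose_X_power if_distribR cong: if_cong) (intro sum.cong, auto)
  also have "\<dots> = (\<Sum>i\<in>{i\<in>{0..5*n+r}. 5 dvd i}. fps_nth g (i div 5) * fps_nth f (5 * n + r - i))"
    by (rule sum.inter_filter[symmetric]) simp
  also have "\<dots> = (\<Sum>j=0..n. fps_nth g j * fps_nth f (5 * (n - j) + r))"
    using assms
    by (intro sum.reindex_bij_witness[where i = "\<lambda>j. 5 * j" and j = "\<lambda>i. i div 5"])
      (auto simp: algebra_simps elim!: dvdE)
  finally show "fps_nth (section5 r ((g oo fps_X ^ 5) * f)) n = fps_nth (g * section5 r f) n"
    by (simp add: section5_def fps_mult_nth)
qed

lemma section5_X_power:
  assumes "r < 5"
  shows "section5 r (fps_X ^ i) = (if i mod 5 = r then fps_X ^ (i div 5) else 0)"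
proof (rule fps_ext)
  fix n
  have "5 * n + r = i \<longleftrightarrow> i mod 5 = r \<and> n = i div 5" using assms by auto
  then show "fps_nth (section5 r (fps_X ^ i)) n = fps_nth (if i mod 5 = r then fps_X ^ (i div 5) else 0) n"
    by (auto simp: section5_def)
qed

definition cY :: "complex fps" where "cY = fps_X * cA"

text \<open>Apart from the power q^i the monomial is a series in q^5, so the exponent of
  \<open>cY\<close> alone decides the residue class.\<close>

lemma section5_monomial:
  assumes "r < 5"
  shows "section5 r (cY ^ i * cB ^ j) = (if i mod 5 = r then fps_X ^ (i div 5) * fA ^ i * fB ^ j else 0)"
proof -
  have "cY ^ i * cB ^ j = (fA ^ i * fB ^ j oo fps_X ^ 5) * fps_X ^ i"
    by (simp add: cY_def cA_def cB_def power_mult_distrib fps_compose_mult_distrib fps_compose_power mult_ac)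
  then show ?thesis
    by (simp add: section5_compose_mult[OF assms] section5_X_power[OF assms])
qed

text \<open>\<open>J z\<close> carries the products at z and z^4, and \<open>J (z^2)\<close> those
  at z^2 and z^3. With one copy of E1 they complete the norm product E5; the other copy of E1
  remains.\<close>

lemma J_mult_J_square:
  assumes z: "prim5 z"
  shows "J z * J (z^2) = fps_const (1 - z) * fps_const (1 - z^2) * (fE1 * fE5)"
proof -
  have z5: "z ^ 5 = 1" by (rule prim5_power[OF z])
  have inv: "1 / z = z ^ 4" "1 / z^2 = z ^ 3"
    using z z5 by (simp_all add: divide_eq_eq flip: power_Suc power_Suc2 power_add)
  let ?q = "\<lambda>j. qpoch (fps_const (z^j) * fps_X) fps_X"
  have "{..<5::nat} = {0,1,2,3,4}" by auto
  then have "(\<Prod>j<5. ?q j) = fE1 * (?q 1 * ?q 2 * ?q 3 * ?q 4)"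
    by (simp add: fE1_def mult_ac)
  then have prod: "fE1 * (?q 1 * ?q 2 * ?q 3 * ?q 4) = fE5"
    using qpoch_prim5[OF z] by (simp add: fE5_def)
  have "J z * J (z^2) = fps_const (1 - z) * fps_const (1 - z^2) * (fE1 * (fE1 * (?q 1 * ?q 2 * ?q 3 * ?q 4)))"
    using z by (simp only: J_eq prim5_nz prim5_nz(1)[OF prim5_square[OF z]] inv power_one_right mult_ac simp_thms)
  then show ?thesis by (simp only: prod)
qed

text \<open>At the primitive fifth roots of unity this takes the two values \<open>(1 \<plusminus> \<surd>5)/2\<close>, exchanged by \<open>z \<mapsto> z\<^sup>2\<close>.\<close>

definition alpha :: "complex \<Rightarrow> complex" where "alpha z = 1 + z + z^4"

lemma alpha_square:
  assumes "prim5 z"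
  shows "alpha z + alpha (z^2) = 1" "alpha z * alpha (z^2) = - 1"
proof -
  have z5: "z ^ 5 = 1" by (rule prim5_power[OF assms])
  have z8: "(z^2)^4 = z^5 * z^3" by (simp flip: power_mult power_add)
  have "alpha z + alpha (z^2) = 1 + (1 + z + z^2 + z^3 + z^4)"
    unfolding alpha_def z8 z5 by simp
  then show "alpha z + alpha (z^2) = 1" by (simp only: assms[unfolded prim5_def] add_0_right)
  have "alpha z * alpha (z^2) = (1 + z + z^4) * (1 + z^2 + z^3)"
    unfolding alpha_def z8 z5 by simp
  also have "\<dots> = 1 + z + z^2 + 2 * z^3 + 2 * z^4 + z^5 * z + z^5 * z^2"
    by algebra
  also have "\<dots> = 2 * (1 + z + z^2 + z^3 + z^4) - 1"
    unfolding z5 by simp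
  finally have "alpha z * alpha (z^2) = 2 * (1 + z + z^2 + z^3 + z^4) - 1" .
  then show "alpha z * alpha (z^2) = - 1" by (simp only: assms[unfolded prim5_def] mult_zero_right diff_0)
qed

lemma fps_nth_0_compose_products [simp]: "fps_nth cA 0 = 1" "fps_nth cB 0 = 1" "fps_nth cE 0 = 1"
  by (simp_all add: cA_def cB_def cE_def)

lemma fps_nonzeroI: "fps_nth f 0 = 1 \<Longrightarrow> f \<noteq> (0 :: complex fps)"
  by auto

text \<open>By (1 - z) \<open>alpha z\<close> = z^4 - z^2 the constant 1 - z becomes common to both
  parts of the dissection.\<close>

lemma J_factor:
  assumes z: "prim5 z"
  shows "J z = fps_const (1 - z) * (cE * (cB - fps_const (alpha z) * cY))"
proof -
  have z5: "z ^ 5 = 1" by (rule prim5_power[OF z])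
  have "(1 - z) * alpha z = 1 + z^4 - z^2 - z^5"
    unfolding alpha_def by algebra
  then have "z^2 - z^4 = - ((1 - z) * alpha z)" unfolding z5 by simp
  then have "fps_const (z^2 - z^4) = - (fps_const (1 - z) * fps_const (alpha z))"
    by (simp only: fps_const_mult fps_const_neg)
  then have "J z = fps_const (1 - z) * (cB * cE) + - (fps_const (1 - z) * fps_const (alpha z)) * (fps_X * (cA * cE))"
    by (simp only: J_dissect[OF z5])
  also have "\<dots> = fps_const (1 - z) * (cE * (cB - fps_const (alpha z) * cY))"
    unfolding cY_def by algebra
  finally show ?thesis .
qed

lemma alpha_consts:
  assumes "prim5 z"
  shows "fps_const (alpha z) + fps_const (alpha (z^2)) = (1 :: complex fps)"
    "fps_const (alpha z) * fps_const (alpha (z^2)) = (- 1 :: complex fps)"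
proof -
  have "fps_const (alpha z) + fps_const (alpha (z^2)) = fps_const 1"
    by (simp only: fps_const_add alpha_square[OF assms])
  then show "fps_const (alpha z) + fps_const (alpha (z^2)) = (1 :: complex fps)"
    by (simp only: fps_const_1_eq_1)
  have "fps_const (alpha z) * fps_const (alpha (z^2)) = - fps_const 1"
    by (simp only: fps_const_mult alpha_square[OF assms] fps_const_neg)
  then show "fps_const (alpha z) * fps_const (alpha (z^2)) = (- 1 :: complex fps)"
    by (simp only: fps_const_1_eq_1)
qed

lemma ex_prim5: "\<exists>z. prim5 z"
proof -
  define z where "z = cis (2 * pi / 5)"
  have "z ^ 5 = cis (real 5 * (2 * pi / 5))" unfolding z_def by (rule Complex.DeMoivre)
  also have "real 5 * (2 * pi / 5) = 2 * pi" by simp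
  finally have z5: "z ^ 5 = 1" by simp
  have "(z - 1) * (1 + z + z^2 + z^3 + z^4) = z ^ 5 - 1" by algebra
  then have "(z - 1) * (1 + z + z^2 + z^3 + z^4) = 0" unfolding z5 by simp
  moreover have "z \<noteq> 1"
  proof
    assume "z = 1"
    then have "sin (2 * pi / 5) = 0" by (simp add: z_def complex_eq_iff)
    moreover have "sin (2 * pi / 5) > 0" by (rule sin_gt_zero) (use pi_gt_zero in linarith)+
    ultimately show False by simp
  qed
  ultimately have "prim5 z" unfolding prim5_def by simp
  then show ?thesis ..
qed

text \<open>The two factorizations of J(z) J(z^2) are compared, and the conjugate values of
  \<open>alpha\<close> combine to integers. Divided out, this is the classical dissection of E1 as
  E5(q^5) (B/A - q - q^2 A/B), with A and B taken at q^5.\<close>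

lemma E1_quadratic: "fE1 * (cA * cB) = cE * (cB^2 - cB * cY - cY^2)"
proof -
  obtain z where z: "prim5 z" using ex_prim5 by blast
  define a a' where "a = fps_const (alpha z)" and "a' = fps_const (alpha (z^2))"
  have aa: "a + a' = 1" "a * a' = - 1" unfolding a_def a'_def by (rule alpha_consts[OF z])+
  let ?d = "fps_const (1 - z) * fps_const (1 - z^2)"
  have "?d * (fE1 * fE5) = ?d * (cE * (cE * ((cB - a * cY) * (cB - a' * cY))))"
    unfolding J_mult_J_square[OF z, symmetric] J_factor[OF z] J_factor[OF prim5_square[OF z]] a_def a'_def
    by (simp only: mult_ac)
  moreover have "?d \<noteq> 0" using z prim5_square[OF z] by simp
  ultimately have "fE1 * fE5 = cE * (cE * ((cB - a * cY) * (cB - a' * cY)))"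
    by (metis mult_left_cancel)
  then have "cE * (fE1 * (cA * cB)) = cE * (cE * ((cB - a * cY) * (cB - a' * cY)))"
    unfolding fE5_eq by (simp only: mult_ac)
  moreover have "cE \<noteq> 0" by (rule fps_nonzeroI) simp
  ultimately have "fE1 * (cA * cB) = cE * ((cB - a * cY) * (cB - a' * cY))"
    by (metis mult_left_cancel)
  also have "(cB - a * cY) * (cB - a' * cY) = cB^2 - (a + a') * (cB * cY) + (a * a') * cY^2" by algebra
  finally show ?thesis unfolding aa by simp
qed

text \<open>Powers are reduced by x^2 = x + 1; the value 11 is the fifth Lucas number.\<close>

lemma golden_fifth_powers:
  fixes a a' :: "'a::idom"
  assumes "a + a' = 1" "a * a' = - 1"
  shows "a ^ 5 + a' ^ 5 = 11" "a ^ 5 * a' ^ 5 = - 1"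
proof -
  have a': "a' = 1 - a" using assms(1) by algebra
  have sq: "a * a = a + 1" using assms(2) unfolding a' by algebra
  have f5: "a ^ 5 = 5 * a + 3" using sq by algebra
  have "a' * a' = a' + 1" using sq unfolding a' by algebra
  then have f5': "a' ^ 5 = 5 * a' + 3" by algebra
  show "a ^ 5 + a' ^ 5 = 11" unfolding f5 f5' using assms(1) by algebra
  show "a ^ 5 * a' ^ 5 = - 1" unfolding power_mult_distrib[symmetric] assms(2) by simp
qed

text \<open>Replace \<open>q\<close> by \<open>z\<^sup>j q\<close> in \<open>E1_quadratic\<close>, which multiplies \<open>cY\<close> by \<open>z\<^sup>j\<close> and fixes the other dissected series,
  and multiply over \<open>j\<close>.\<close>

lemma norm_relation: "cB ^ 10 - 11 * (cB ^ 5 * cY ^ 5) - cY ^ 10 = (cA * cB) ^ 11"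
proof -
  obtain z where z: "prim5 z" using ex_prim5 by blast
  define a a' where "a = fps_const (alpha z)" and "a' = fps_const (alpha (z^2))"
  have aa: "a + a' = 1" "a * a' = - 1" unfolding a_def a'_def by (rule alpha_consts[OF z])+
  let ?h = "\<lambda>j. fps_const (z^j) * fps_X"
  have h0: "fps_nth (?h j) 0 = 0" for j by simp
  have c: "(f oo fps_X ^ 5) oo ?h j = (f oo fps_X ^ 5)" for f j
  proof -
    have "(z ^ j) ^ 5 = 1" using prim5_power[OF z] by (metis power_mult mult.commute power_one)
    then have "(fps_X ^ 5 oo ?h j) = fps_X ^ 5"
      by (simp only: fps_X_power_compose[OF h0] power_mult_distrib fps_const_power) simp
    then show ?thesis using fps_compose_assoc[of "?h j" "fps_X ^ 5" f] by simp
  qed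
  have Y: "(cY oo ?h j) = fps_const (z^j) * cY" for j
    unfolding cY_def fps_compose_mult_distrib[OF h0] c[folded cA_def, of fA] cA_def
    by (simp only: c fps_X_fps_compose_startby0[OF h0] mult.assoc)
  have E: "(fE1 oo ?h j) = qpoch (?h j) (?h j)" for j
    unfolding fE1_def by (subst qpoch_compose) auto
  have quad: "qpoch (?h j) (?h j) * (cA * cB) = cE * ((cB - fps_const (z^j) * (a * cY)) * (cB - fps_const (z^j) * (a' * cY)))" for j
  proof -
    have "qpoch (?h j) (?h j) * (cA * cB) = (fE1 * (cA * cB) oo ?h j)"
      by (simp only: fps_compose_mult_distrib[OF h0] E cA_def cB_def c)
    also have "\<dots> = cE * (cB^2 - cB * (fps_const (z^j) * cY) - (fps_const (z^j) * cY)^2)"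
      unfolding E1_quadratic fps_compose_mult_distrib[OF h0] fps_compose_sub_distrib fps_compose_power[OF h0, symmetric] Y
      by (simp only: cB_def cE_def c)
    also have "cB^2 - cB * (fps_const (z^j) * cY) - (fps_const (z^j) * cY)^2
        = cB^2 - (a + a') * cB * (fps_const (z^j) * cY) + (a * a') * (fps_const (z^j) * cY)^2"
      unfolding aa by simp
    also have "\<dots> = (cB - fps_const (z^j) * (a * cY)) * (cB - fps_const (z^j) * (a' * cY))"
      by algebra
    finally show ?thesis .
  qed
  have "(\<Prod>j<5. qpoch (?h j) (?h j)) * (cA * cB) ^ 5 = (\<Prod>j<5. qpoch (?h j) (?h j) * (cA * cB))"
    by (simp add: prod.distrib)
  also have "\<dots> = cE ^ 5 * ((\<Prod>j<5. cB - fps_const (z^j) * (a * cY)) * (\<Prod>j<5. cB - fps_const (z^j) * (a' * cY)))"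
    unfolding quad prod.distrib by simp
  also have "\<dots> = cE ^ 5 * ((cB^5 - (a * cY)^5) * (cB^5 - (a' * cY)^5))"
    unfolding prim5_prod_diff[OF z] ..
  also have "(cB^5 - (a * cY)^5) * (cB^5 - (a' * cY)^5) = cB^10 - (a^5 + a'^5) * (cB^5 * cY^5) + (a^5 * a'^5) * cY^10"
    by algebra
  finally have "(\<Prod>j<5. qpoch (?h j) (?h j)) * (cA * cB) ^ 5 = cE ^ 5 * (cB^10 - 11 * (cB^5 * cY^5) - cY^10)"
    unfolding golden_fifth_powers[OF aa] by simp
  then have "((\<Prod>j<5. qpoch (?h j) (?h j)) * cE) * (cA * cB) ^ 5 = cE ^ 6 * (cB^10 - 11 * (cB^5 * cY^5) - cY^10)"
    by algebra
  \<comment> \<open>The norm of E1 times \<open>cE\<close> is \<open>fE5 ^ 6\<close>, that is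
    \<open>(cA * cB * cE) ^ 6\<close>; six and five factors \<open>cA * cB\<close> make
    eleven.\<close>
  then have "cE ^ 6 * (cA * cB) ^ 11 = cE ^ 6 * (cB^10 - 11 * (cB^5 * cY^5) - cY^10)"
    unfolding cE_eq[symmetric] qpoch_scaled_prod[OF z, folded cE_eq fE5_def] fE5_eq by algebra
  moreover have "cE ^ 6 \<noteq> 0" using fps_nonzeroI[of cE] by simp
  ultimately show ?thesis by (metis mult_left_cancel)
qed

text \<open>The form of degree 8 is the cofactor of \<open>b\<^sup>2 - b y - y\<^sup>2\<close> in \<open>b\<^bsup>10\<^esup> - 11 b\<^sup>5 y\<^sup>5 - y\<^bsup>10\<^esup>\<close>. Exponents 0 and 1 and coefficients 1
  are written out so that \<open>section5_monomial\<close> applies uniformly to every term.\<close>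

lemma Q8_square:
  fixes b y :: "complex fps"
  shows "(1 * (y^0 * b^8) + 1 * (y^1 * b^7) + 2 * (y^2 * b^6) + 3 * (y^3 * b^5) + 5 * (y^4 * b^4)
      - 3 * (y^5 * b^3) + 2 * (y^6 * b^2) - 1 * (y^7 * b^1) + 1 * (y^8 * b^0)) * (1 * (y^0 * b^8)
      + 1 * (y^1 * b^7) + 2 * (y^2 * b^6) + 3 * (y^3 * b^5) + 5 * (y^4 * b^4) - 3 * (y^5 * b^3)
      + 2 * (y^6 * b^2) - 1 * (y^7 * b^1) + 1 * (y^8 * b^0)) = 1 * (y^0 * b^16) + 2 * (y^1 * b^15)
      + 5 * (y^2 * b^14) + 10 * (y^3 * b^13) + 20 * (y^4 * b^12) + 16 * (y^5 * b^11) + 27 * (y^6 * b^10)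
      + 20 * (y^7 * b^9) + 15 * (y^8 * b^8) - 20 * (y^9 * b^7) + 27 * (y^10 * b^6) - 16 * (y^11 * b^5)
      + 20 * (y^12 * b^4) - 10 * (y^13 * b^3) + 5 * (y^14 * b^2) - 2 * (y^15 * b^1) + 1 * (y^16 * b^0)"
  by algebra

lemma Q8_cube:
  fixes b y :: "complex fps"
  shows "(1 * (y^0 * b^8) + 1 * (y^1 * b^7) + 2 * (y^2 * b^6) + 3 * (y^3 * b^5) + 5 * (y^4 * b^4)
      - 3 * (y^5 * b^3) + 2 * (y^6 * b^2) - 1 * (y^7 * b^1) + 1 * (y^8 * b^0)) * (1 * (y^0 * b^16)
      + 2 * (y^1 * b^15) + 5 * (y^2 * b^14) + 10 * (y^3 * b^13) + 20 * (y^4 * b^12) + 16 * (y^5 * b^11)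
      + 27 * (y^6 * b^10) + 20 * (y^7 * b^9) + 15 * (y^8 * b^8) - 20 * (y^9 * b^7) + 27 * (y^10 * b^6)
      - 16 * (y^11 * b^5) + 20 * (y^12 * b^4) - 10 * (y^13 * b^3) + 5 * (y^14 * b^2) - 2 * (y^15 * b^1)
      + 1 * (y^16 * b^0)) = 1 * (y^0 * b^24) + 3 * (y^1 * b^23) + 9 * (y^2 * b^22) + 22 * (y^3 * b^21)
      + 51 * (y^4 * b^20) + 78 * (y^5 * b^19) + 134 * (y^6 * b^18) + 177 * (y^7 * b^17) + 216 * (y^8 * b^16)
      + 153 * (y^9 * b^15) + 219 * (y^10 * b^14) + 57 * (y^11 * b^13) + 71 * (y^12 * b^12) - 57 * (y^13 * b^11)
      + 219 * (y^14 * b^10) - 153 * (y^15 * b^9) + 216 * (y^16 * b^8) - 177 * (y^17 * b^7) + 134 * (y^18 * b^6)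
      - 78 * (y^19 * b^5) + 51 * (y^20 * b^4) - 22 * (y^21 * b^3) + 9 * (y^22 * b^2) - 3 * (y^23 * b^1)
      + 1 * (y^24 * b^0)"
  by algebra

text \<open>The form of degree 6 is the one that multiplies \<open>cE^2\<close> in the identity for
  \<open>Phi\<close> below, and the form of degree 24 is the cube computed above. The linear form in
  the next lemma comes from the same identity.\<close>

lemma T6_Q24:
  fixes b y :: "complex fps"
  shows "(- 6 * (y^0 * b^6) - 17 * (y^1 * b^5) - 70 * (y^2 * b^4) + 10 * (y^3 * b^3) - 80 * (y^4 * b^2)
      + 28 * (y^5 * b^1) - 9 * (y^6 * b^0)) * (1 * (y^0 * b^24) + 3 * (y^1 * b^23) + 9 * (y^2 * b^22)
      + 22 * (y^3 * b^21) + 51 * (y^4 * b^20) + 78 * (y^5 * b^19) + 134 * (y^6 * b^18) + 177 * (y^7 * b^17)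
      + 216 * (y^8 * b^16) + 153 * (y^9 * b^15) + 219 * (y^10 * b^14) + 57 * (y^11 * b^13) + 71 * (y^12 * b^12)
      - 57 * (y^13 * b^11) + 219 * (y^14 * b^10) - 153 * (y^15 * b^9) + 216 * (y^16 * b^8) - 177 * (y^17 * b^7)
      + 134 * (y^18 * b^6) - 78 * (y^19 * b^5) + 51 * (y^20 * b^4) - 22 * (y^21 * b^3) + 9 * (y^22 * b^2)
      - 3 * (y^23 * b^1) + 1 * (y^24 * b^0)) = - 6 * (y^0 * b^30) - 35 * (y^1 * b^29) - 175 * (y^2 * b^28)
      - 485 * (y^3 * b^27) - 1360 * (y^4 * b^26) - 2997 * (y^5 * b^25) - 6125 * (y^6 * b^24)
      - 9825 * (y^7 * b^23) - 16450 * (y^8 * b^22) - 20650 * (y^9 * b^21) - 26260 * (y^10 * b^20)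
      - 23725 * (y^11 * b^19) - 28725 * (y^12 * b^18) - 10450 * (y^13 * b^17) - 19925 * (y^14 * b^16)
      + 2090 * (y^15 * b^15) - 20650 * (y^16 * b^14) + 16325 * (y^17 * b^13) - 34200 * (y^18 * b^12)
      + 31625 * (y^19 * b^11) - 33665 * (y^20 * b^10) + 27650 * (y^21 * b^9) - 21650 * (y^22 * b^8)
      + 13500 * (y^23 * b^7) - 8275 * (y^24 * b^6) + 4173 * (y^25 * b^5) - 1895 * (y^26 * b^4)
      + 700 * (y^27 * b^3) - 245 * (y^28 * b^2) + 55 * (y^29 * b^1) - 9 * (y^30 * b^0)"
  by algebra

lemma T1_Q24:
  fixes b y :: "complex fps"
  shows "(6 * (y^0 * b^1) + 7 * (y^1 * b^0)) * (1 * (y^0 * b^24) + 3 * (y^1 * b^23) + 9 * (y^2 * b^22)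
      + 22 * (y^3 * b^21) + 51 * (y^4 * b^20) + 78 * (y^5 * b^19) + 134 * (y^6 * b^18) + 177 * (y^7 * b^17)
      + 216 * (y^8 * b^16) + 153 * (y^9 * b^15) + 219 * (y^10 * b^14) + 57 * (y^11 * b^13) + 71 * (y^12 * b^12)
      - 57 * (y^13 * b^11) + 219 * (y^14 * b^10) - 153 * (y^15 * b^9) + 216 * (y^16 * b^8) - 177 * (y^17 * b^7)
      + 134 * (y^18 * b^6) - 78 * (y^19 * b^5) + 51 * (y^20 * b^4) - 22 * (y^21 * b^3) + 9 * (y^22 * b^2)
      - 3 * (y^23 * b^1) + 1 * (y^24 * b^0)) = 6 * (y^0 * b^25) + 25 * (y^1 * b^24) + 75 * (y^2 * b^23)
      + 195 * (y^3 * b^22) + 460 * (y^4 * b^21) + 825 * (y^5 * b^20) + 1350 * (y^6 * b^19) + 2000 * (y^7 * b^18)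
      + 2535 * (y^8 * b^17) + 2430 * (y^9 * b^16) + 2385 * (y^10 * b^15) + 1875 * (y^11 * b^14)
      + 825 * (y^12 * b^13) + 155 * (y^13 * b^12) + 915 * (y^14 * b^11) + 615 * (y^15 * b^10)
      + 225 * (y^16 * b^9) + 450 * (y^17 * b^8) - 435 * (y^18 * b^7) + 470 * (y^19 * b^6) - 240 * (y^20 * b^5)
      + 225 * (y^21 * b^4) - 100 * (y^22 * b^3) + 45 * (y^23 * b^2) - 15 * (y^24 * b^1) + 7 * (y^25 * b^0)"
  by algebra

definition Q8 :: "complex fps" where
  "Q8 = 1 * (cY^0 * cB^8) + 1 * (cY^1 * cB^7) + 2 * (cY^2 * cB^6) + 3 * (cY^3 * cB^5) + 5 * (cY^4 * cB^4)
      - 3 * (cY^5 * cB^3) + 2 * (cY^6 * cB^2) - 1 * (cY^7 * cB^1) + 1 * (cY^8 * cB^0)"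

text \<open>\<open>E1_quadratic\<close> times the cofactor is the norm form, hence a power of
  \<open>cA * cB\<close>. So \<open>Q8\<close> inverts E1 up to a series in q^5.\<close>

lemma E1_Q8: "fE1 * Q8 = cE * (cA * cB) ^ 10"
proof -
  have "(cA * cB) * (fE1 * Q8) = (fE1 * (cA * cB)) * Q8" by algebra
  also have "\<dots> = cE * (cB ^ 10 - 11 * (cB ^ 5 * cY ^ 5) - cY ^ 10)"
    unfolding E1_quadratic Q8_def by algebra
  also have "\<dots> = (cA * cB) * (cE * (cA * cB) ^ 10)"
    unfolding norm_relation by algebra
  finally have eq: "(cA * cB) * (fE1 * Q8) = (cA * cB) * (cE * (cA * cB) ^ 10)" .
  have "cA * cB \<noteq> 0" by (rule fps_nonzeroI) simp
  from mult_left_cancel[THEN iffD1, OF this eq] show ?thesis .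
qed

lemma E1_Q8_cube: "fE1 ^ 3 * (1 * (cY^0 * cB^24) + 3 * (cY^1 * cB^23) + 9 * (cY^2 * cB^22) + 22 * (cY^3 * cB^21)
      + 51 * (cY^4 * cB^20) + 78 * (cY^5 * cB^19) + 134 * (cY^6 * cB^18) + 177 * (cY^7 * cB^17)
      + 216 * (cY^8 * cB^16) + 153 * (cY^9 * cB^15) + 219 * (cY^10 * cB^14) + 57 * (cY^11 * cB^13)
      + 71 * (cY^12 * cB^12) - 57 * (cY^13 * cB^11) + 219 * (cY^14 * cB^10) - 153 * (cY^15 * cB^9)
      + 216 * (cY^16 * cB^8) - 177 * (cY^17 * cB^7) + 134 * (cY^18 * cB^6) - 78 * (cY^19 * cB^5)
      + 51 * (cY^20 * cB^4) - 22 * (cY^21 * cB^3) + 9 * (cY^22 * cB^2) - 3 * (cY^23 * cB^1)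
      + 1 * (cY^24 * cB^0)) = cE ^ 3 * (cA * cB) ^ 30"
proof -
  have "fE1 ^ 3 * (Q8 * (Q8 * Q8)) = (fE1 * Q8) ^ 3" by algebra
  also have "\<dots> = cE ^ 3 * (cA * cB) ^ 30" unfolding E1_Q8 by algebra
  finally show ?thesis unfolding Q8_def Q8_square Q8_cube .
qed

lemma section5_compose_E: "r < 5 \<Longrightarrow> section5 r (cE ^ k * f) = fE5 ^ k * section5 r f"
  using section5_compose_mult[of r "fE5 ^ k" f] by (simp add: cE_def fps_compose_power)

lemma section5_compose_AB: "r < 5 \<Longrightarrow> section5 r ((cA ^ i * cB ^ j) * f) = fA ^ i * fB ^ j * section5 r f"
  using section5_compose_mult[of r "fA ^ i * fB ^ j" f]
  by (simp add: cA_def cB_def fps_compose_power fps_compose_mult_distrib)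

text \<open>E1^3 is read off from \<open>K_dissect\<close> at z = 1 and compared with the cube of
  \<open>E1_quadratic\<close>. The class 3 term cancels the monomial 5 b^3 y^3 of that cube.\<close>

lemma E1_cube_dissect:
  "cA^3 * cB^3 * (cM1 * fps_X^0) - cA^3 * cB^3 * (cM2 * fps_X^1)
     = cE^3 * (cY^0 * cB^6 - 3 * (cY^1 * cB^5) - 3 * (cY^5 * cB^1) - cY^6 * cB^0)"
proof -
  have "- 2 * fE1^3 = - fps_const 2 * cM1 + fps_const 2 * (fps_X * cM2) - fps_const 10 * (fps_X^3 * cE^3)"
    using K_dissect[of 1, OF _ K_1] K_1 by simp
  then have "- 2 * fE1^3 = - 2 * (cM1 - fps_X * cM2 + 5 * (fps_X^3 * cE^3))"
    unfolding numeral_fps_const[symmetric] by algebra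
  then have E3: "fE1^3 = cM1 - fps_X * cM2 + 5 * (fps_X^3 * cE^3)"
    by (rule mult_left_cancel[THEN iffD1, rotated]) simp
  have "(cA * cB)^3 * fE1^3 = (cE * (cB^2 - cB * cY - cY^2))^3"
    unfolding E1_quadratic[symmetric] by algebra
  then show ?thesis unfolding E3 cY_def by algebra
qed

text \<open>Compare the terms with exponents congruent to 0 and to 1 modulo 5 in two expansions of \<open>E1\<^sup>3\<close>: Jacobi's series and
  the cube of the dissection \<open>E1_quadratic\<close>.\<close>

lemma weighted_theta1: "fA^3 * fB^2 * (fB * fE5 + 10 * fS) = fE5^3 * (fB^5 - 3 * fps_X * fA^5)"
  and weighted_theta2: "fA^2 * fB^3 * (3 * (fA * fE5) + 10 * fT) = fE5^3 * (3 * fB^5 + fps_X * fA^5)"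
proof -
  have M: "section5 r (cA^3 * cB^3 * (cM1 * fps_X^i)) = fA^3 * fB^3 * ((fB * fE5 + 10 * fS) * section5 r (fps_X^i))"
    "section5 r (cA^3 * cB^3 * (cM2 * fps_X^i)) = fA^3 * fB^3 * ((3 * (fA * fE5)
      + 10 * fT) * section5 r (fps_X^i))" if "r < 5" for r i
    by (simp_all only: section5_compose_AB[OF that] cM1_def cM2_def section5_compose_mult[OF that])
  have eq: "section5 r (cA^3 * cB^3 * (cM1 * fps_X^0)) - section5 r (cA^3 * cB^3 * (cM2 * fps_X^1))
    = fE5^3 * (section5 r (cY^0 * cB^6) - 3 * section5 r (cY^1 * cB^5)
      - 3 * section5 r (cY^5 * cB^1) - section5 r (cY^6 * cB^0))"
    if "r < 5" for r
    using arg_cong[OF E1_cube_dissect, of "section5 r"]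
    by (simp only: section5_diff section5_numeral section5_compose_E[OF that])
  have r: "(0 :: nat) < 5" "(1 :: nat) < 5" by simp_all
  \<comment> \<open>Class 0 keeps \<open>cM1\<close> and the exponents 0 and 5 of \<open>cY\<close>;
    class 1, further below, keeps \<open>cM2\<close> and the exponents 1 and 6.\<close>
  from eq[OF r(1), unfolded M[OF r(1)], unfolded section5_monomial[OF r(1)] section5_X_power[OF r(1)]]
  have "fA^3 * fB^3 * (fB * fE5 + 10 * fS) = fE5^3 * (fB^6 - 3 * (fps_X * fA^5 * fB))"
    by simp
  then have 1: "fB * (fA^3 * fB^2 * (fB * fE5 + 10 * fS)) = fB * (fE5^3 * (fB^5 - 3 * fps_X * fA^5))"
    by algebra
  have "fB \<noteq> 0" by (rule fps_nonzeroI) simp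
  from mult_left_cancel[THEN iffD1, OF this 1]
  show "fA^3 * fB^2 * (fB * fE5 + 10 * fS) = fE5^3 * (fB^5 - 3 * fps_X * fA^5)" .
  from eq[OF r(2), unfolded M[OF r(2)], unfolded section5_monomial[OF r(2)] section5_X_power[OF r(2)]]
  have "- (fA^3 * fB^3 * (3 * (fA * fE5) + 10 * fT)) = fE5^3 * (- 3 * (fA * fB^5) - fps_X * fA^6)"
    by simp
  then have 2: "fA * (fA^2 * fB^3 * (3 * (fA * fE5) + 10 * fT)) = fA * (fE5^3 * (3 * fB^5 + fps_X * fA^5))"
    by algebra
  have "fA \<noteq> 0" by (rule fps_nonzeroI) simp
  from mult_left_cancel[THEN iffD1, OF this 2]
  show "fA^2 * fB^3 * (3 * (fA * fE5) + 10 * fT) = fE5^3 * (3 * fB^5 + fps_X * fA^5)" .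
qed

text \<open>The evaluation of the weighted theta series at q^5, where q^5 A(q^5)^5 is y^5.\<close>

lemma cM1_eq: "cA^3 * cB^3 * cM1 = cE^3 * (cB^6 - 3 * (cB * cY^5))"
proof -
  have "(fA^3 * fB^2 * (fB * fE5 + 10 * fS) oo fps_X^5) = (fE5^3 * (fB^5 - 3 * fps_X * fA^5) oo fps_X^5)"
    by (simp only: weighted_theta1)
  then have "cA^3 * cB^2 * cM1 = cE^3 * (cB^5 - 3 * fps_X^5 * cA^5)"
    by (simp add: cM1_def cA_def cB_def cE_def fps_compose_mult_distrib fps_compose_sub_distrib fps_compose_power numeral_compose)
  then show ?thesis unfolding cY_def by algebra
qed

lemma cM2_eq: "cA^3 * cB^3 * (fps_X * cM2) = cE^3 * (3 * (cB^5 * cY) + cY^6)"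
proof -
  have "(fA^2 * fB^3 * (3 * (fA * fE5) + 10 * fT) oo fps_X^5) = (fE5^3 * (3 * fB^5 + fps_X * fA^5) oo fps_X^5)"
    by (simp only: weighted_theta2)
  then have "cA^2 * cB^3 * cM2 = cE^3 * (3 * cB^5 + fps_X^5 * cA^5)"
    by (simp add: cM2_def cA_def cB_def cE_def fps_compose_mult_distrib fps_compose_add_distrib fps_compose_power numeral_compose)
  then show ?thesis unfolding cY_def by algebra
qed

definition K_poly :: "complex \<Rightarrow> complex fps" where
  "K_poly z = - (cB^6 - 3 * (cB * cY^5)) + (fps_const (alpha z) - 2) * (3 * (cB^5 * cY) + cY^6)
     - 10 * fps_const (alpha (z^2)) * (cB^3 * cY^3)"

text \<open>The factor 1 + z is common: z^2 + z^4 = (1 + z)(\<open>alpha z\<close> - 2) and z^3 = (1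
  + z) \<open>alpha (z^2)\<close>. What is left involves z only through the two conjugate values of
  \<open>alpha\<close>.\<close>

lemma K_eq:
  assumes z: "prim5 z"
  shows "cA^3 * cB^3 * K z = fps_const (1 + z) * (cE^3 * K_poly z)"
proof -
  have z5: "z ^ 5 = 1" by (rule prim5_power[OF z])
  have z8: "(z^2)^4 = z^5 * z^3" by (simp flip: power_mult power_add)
  have "(1 + z) * (alpha z - 2) = z^2 + z^4 + (z^5 - 1)" unfolding alpha_def by algebra
  then have "z^2 + z^4 = (1 + z) * (alpha z - 2)" unfolding z5 by simp
  then have 1: "fps_const (z^2 + z^4) = fps_const (1 + z) * (fps_const (alpha z) - 2)"
    by (simp only: fps_const_mult fps_const_sub numeral_fps_const)
  have "10 * ((1 + z) * alpha (z^2)) = 10 * (z^3 + (1 + z + z^2 + z^3 + z^4))" unfolding alpha_def z8 z5 by algebra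
  then have "10 * z^3 = 10 * ((1 + z) * alpha (z^2))" by (simp only: z[unfolded prim5_def] add_0_right)
  then have 2: "fps_const (10 * z^3) = 10 * (fps_const (1 + z) * fps_const (alpha (z^2)))"
    by (simp only: fps_const_mult numeral_fps_const)
  have "cA^3 * cB^3 * K z = - fps_const (1 + z) * (cA^3 * cB^3 * cM1)
     + fps_const (1 + z) * (fps_const (alpha z) - 2) * (cA^3 * cB^3 * (fps_X * cM2))
     - 10 * (fps_const (1 + z) * fps_const (alpha (z^2))) * (cB^3 * cY^3 * cE^3)"
    unfolding K_dissect[OF z5 K_1] 1 2 cY_def by algebra
  then show ?thesis unfolding cM1_eq cM2_eq K_poly_def by algebra
qed

subsection \<open>The two residue classes\<close>

text \<open>The dissections of J and K are inserted in \<open>crank_gf_diff\<close>. The denominator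
  (b - \<open>alpha z\<close> y)^2 is cleared by the square of its conjugate, because the product of
  the conjugate factors is the quadratic form of E1.\<close>

lemma crank_gf_diff_prim5:
  assumes z: "prim5 z"
  shows "2 * fps_const ((z^4 - z) + 3 * (z^3 - z^2)) * (crank_gf z - crank_gf (1 / z)) * fE1^4 * (cA * cB)^5
    = - ((4 * fps_const (alpha z) + 1) * cE * (cA^3 * cB^3 * (cB - fps_const (alpha z) * cY) + cE^2 * K_poly z)
        * (cB - fps_const (alpha (z^2)) * cY)^2)"
proof -
  have z5: "z ^ 5 = 1" by (rule prim5_power[OF z])
  define a a' where "a = fps_const (alpha z)" and "a' = fps_const (alpha (z^2))"
  have aa: "a + a' = 1" "a * a' = - 1" unfolding a_def a'_def by (rule alpha_consts[OF z])+
  define c d s where "c = fps_const ((z^4 - z) + 3 * (z^3 - z^2))" and "d = fps_const (1 - z)" and "s = fps_const (1 + z)"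
  define D L L' m where "D = crank_gf z - crank_gf (1 / z)" and "L = cB - a * cY" and "L' = cB - a' * cY" and "m = cA^3 * cB^3"
  have d0: "d \<noteq> 0" using z by (simp add: d_def)
  have e0: "cE \<noteq> 0" by (rule fps_nonzeroI) simp
  have J: "J z = d * (cE * L)" unfolding J_factor[OF z] d_def L_def a_def ..
  have K: "m * K z = s * (cE^3 * K_poly z)" unfolding m_def s_def by (rule K_eq[OF z])
  \<comment> \<open>The Fourier coefficient times (1 + z)/(1 - z) is 4 \<open>alpha z\<close> + 1,
    so the contributions of z and z^2 are conjugate and their sum has rational coefficients.\<close>
  have "((z^4 - z) + 3 * (z^3 - z^2)) * (1 + z) = (4 * alpha z + 1) * (1 - z) + 5 * (z^5 - 1)"
    unfolding alpha_def by algebra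
  then have "((z^4 - z) + 3 * (z^3 - z^2)) * (1 + z) = (4 * alpha z + 1) * (1 - z)"
    unfolding z5 by simp
  then have cs: "c * s = (4 * a + 1) * d"
    unfolding c_def s_def a_def d_def by (simp only: fps_const_mult fps_const_add numeral_fps_const fps_const_1_eq_1[symmetric])
  have "d * cE * (2 * D * fE1^2 * d * cE * L^2 * m) = m * (2 * D * fE1^2 * J z^2)"
    unfolding J by algebra
  also have "2 * D * fE1^2 * J z^2 = - (s * J z + d * K z)"
    unfolding D_def s_def d_def using z by (intro crank_gf_diff) simp
  also have "m * (- (s * J z + d * K z)) = - (s * m * J z + d * (m * K z))" by algebra
  also have "\<dots> = d * cE * (- (s * (m * L + cE^2 * K_poly z)))" unfolding J K by algebra
  finally have eq: "d * cE * (2 * D * fE1^2 * d * cE * L^2 * m) = d * cE * (- (s * (m * L + cE^2 * K_poly z)))" .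
  have "d * cE \<noteq> 0" using d0 e0 by simp
  from mult_left_cancel[THEN iffD1, OF this eq]
  have eq: "2 * D * fE1^2 * d * cE * L^2 * m = - (s * (m * L + cE^2 * K_poly z))" .
  have "d * (2 * c * D * fE1^2 * cE * L^2 * m) = c * (2 * D * fE1^2 * d * cE * L^2 * m)" by algebra
  also have "\<dots> = - ((c * s) * (m * L + cE^2 * K_poly z))" unfolding eq by algebra
  also have "\<dots> = d * (- ((4 * a + 1) * (m * L + cE^2 * K_poly z)))" unfolding cs by algebra
  finally have eq: "d * (2 * c * D * fE1^2 * cE * L^2 * m) = d * (- ((4 * a + 1) * (m * L + cE^2 * K_poly z)))" .
  from mult_left_cancel[THEN iffD1, OF d0 eq]
  have eq: "2 * c * D * fE1^2 * cE * L^2 * m = - ((4 * a + 1) * (m * L + cE^2 * K_poly z))" .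
  have LL: "cE * (L * L') = fE1 * (cA * cB)"
  proof -
    have "L * L' = cB^2 - (a + a') * (cB * cY) + (a * a') * cY^2" unfolding L_def L'_def by algebra
    then show ?thesis unfolding E1_quadratic aa by simp
  qed
  have "2 * c * D * fE1^4 * (cA * cB)^5 = 2 * c * D * fE1^2 * (fE1 * (cA * cB))^2 * m"
    unfolding m_def by algebra
  also have "\<dots> = (2 * c * D * fE1^2 * cE * L^2 * m) * (cE * L'^2)"
    unfolding LL[symmetric] by algebra
  also have "\<dots> = - ((4 * a + 1) * cE * (m * L + cE^2 * K_poly z) * L'^2)"
    unfolding eq by algebra
  finally show ?thesis unfolding c_def D_def a_def a'_def L_def L'_def m_def .
qed

text \<open>The two summands are exchanged with \<open>a\<close> and \<open>a'\<close>, so reduction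
  by a^2 = a + 1 leaves integer coefficients. The quadratic form splits off and will cancel one
  factor E1.\<close>

lemma conjugate_sum:
  fixes a a' b y m g :: "'a::idom"
  assumes "a + a' = 1" "a * a' = - 1"
  shows "(4 * a + 1) * (m * (b - a * y) + g * (- (b^6 - 3 * (b * y^5)) + (a - 2) * (3 * (b^5 * y) + y^6)
      - 10 * a' * (b^3 * y^3))) * (b - a' * y)^2
    + (4 * a' + 1) * (m * (b - a' * y) + g * (- (b^6 - 3 * (b * y^5)) + (a' - 2) * (3 * (b^5 * y) + y^6)
      - 10 * a * (b^3 * y^3))) * (b - a * y)^2
    = (b^2 - b * y - y^2) * (m * (6 * (y^0 * b^1) + 7 * (y^1 * b^0)) + g * (- 6 * (y^0 * b^6) - 17 * (y^1 * b^5)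
      - 70 * (y^2 * b^4) + 10 * (y^3 * b^3) - 80 * (y^4 * b^2) + 28 * (y^5 * b^1) - 9 * (y^6 * b^0)))"
proof -
  have a': "a' = 1 - a" using assms(1) by algebra
  have "a * a = a + 1" using assms(2) unfolding a' by algebra
  then show ?thesis unfolding a' by algebra
qed

text \<open>The Fourier expansion of \<open>Phi\<close> is evaluated as a sum of two conjugate
  terms, and the common factor \<open>fE1 * (cA * cB)\<close> is cancelled.\<close>

lemma Phi_identity:
  "10 * Phi * fE1^3 * (cA * cB)^4 = - (cA^3 * cB^3 * (6 * (cY^0 * cB^1)
      + 7 * (cY^1 * cB^0)) + cE^2 * (- 6 * (cY^0 * cB^6) - 17 * (cY^1 * cB^5) - 70 * (cY^2 * cB^4)
      + 10 * (cY^3 * cB^3) - 80 * (cY^4 * cB^2) + 28 * (cY^5 * cB^1) - 9 * (cY^6 * cB^0)))"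
proof -
  obtain z where z: "prim5 z" using ex_prim5 by blast
  have z2: "prim5 (z^2)" by (rule prim5_square[OF z])
  have z5: "z ^ 5 = 1" by (rule prim5_power[OF z])
  define a a' where "a = fps_const (alpha z)" and "a' = fps_const (alpha (z^2))"
  have aa: "a + a' = 1" "a * a' = - 1" unfolding a_def a'_def by (rule alpha_consts[OF z])+
  have "(z^2)^2 = z^4" "(z^2)^4 = z^5 * z^3" "(z^2)^3 = z^5 * z" "(z^4)^4 = z^5 * z^5 * z^5 * z"
    by (simp_all flip: power_mult power_add power_Suc2)
  then have sq: "(z^2)^2 = z^4" "(z^2)^4 = z^3" "(z^2)^3 = z" "(z^4)^4 = z"
    unfolding z5 by simp_all
  have "alpha ((z^2)^2) = alpha z" unfolding sq(1) alpha_def sq(4) by simp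
  then have a'': "fps_const (alpha ((z^2)^2)) = a" by (simp only: a_def)
  let ?c1 = "fps_const ((z^4 - z) + 3 * (z^3 - z^2))" and ?c2 = "fps_const ((z^3 - z^2) + 3 * (z - z^4))"
  let ?D1 = "crank_gf z - crank_gf (1 / z)" and ?D2 = "crank_gf (z^2) - crank_gf (1 / z^2)"
  have K1: "K_poly z = - (cB^6 - 3 * (cB * cY^5)) + (a - 2) * (3 * (cB^5 * cY) + cY^6) - 10 * a' * (cB^3 * cY^3)"
    unfolding K_poly_def a_def a'_def ..
  have K2: "K_poly (z^2) = - (cB^6 - 3 * (cB * cY^5)) + (a' - 2) * (3 * (cB^5 * cY) + cY^6) - 10 * a * (cB^3 * cY^3)"
    unfolding K_poly_def a'' a'_def ..
  note R1 = crank_gf_diff_prim5[OF z, folded a_def a'_def, unfolded K1]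
  \<comment> \<open>Replacing z by z^2 exchanges the values of \<open>alpha\<close> and turns the
    first Fourier coefficient into the second.\<close>
  note R2 = crank_gf_diff_prim5[OF z2, unfolded a'' K2, folded a'_def, unfolded sq]
  have "(fE1 * (cA * cB)) * (10 * Phi * fE1^3 * (cA * cB)^4) = 2 * (5 * Phi) * fE1^4 * (cA * cB)^5"
    by algebra
  also have "\<dots> = 2 * ?c1 * ?D1 * fE1^4 * (cA * cB)^5 + 2 * ?c2 * ?D2 * fE1^4 * (cA * cB)^5"
    unfolding Phi_crank_gf[OF z] by algebra
  also have "\<dots> = - (cE * (cB^2 - cB * cY - cY^2)) * (cA^3 * cB^3 * (6 * (cY^0 * cB^1)
      + 7 * (cY^1 * cB^0)) + cE^2 * (- 6 * (cY^0 * cB^6) - 17 * (cY^1 * cB^5) - 70 * (cY^2 * cB^4)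
      + 10 * (cY^3 * cB^3) - 80 * (cY^4 * cB^2) + 28 * (cY^5 * cB^1) - 9 * (cY^6 * cB^0)))"
    unfolding R1 R2 using conjugate_sum[OF aa, of "cA^3 * cB^3" cB cY "cE^2"] by algebra
  finally have eq: "(fE1 * (cA * cB)) * (10 * Phi * fE1^3 * (cA * cB)^4)
    = (fE1 * (cA * cB)) * (- (cA^3 * cB^3 * (6 * (cY^0 * cB^1)
      + 7 * (cY^1 * cB^0)) + cE^2 * (- 6 * (cY^0 * cB^6) - 17 * (cY^1 * cB^5) - 70 * (cY^2 * cB^4)
      + 10 * (cY^3 * cB^3) - 80 * (cY^4 * cB^2) + 28 * (cY^5 * cB^1) - 9 * (cY^6 * cB^0))))"
    unfolding E1_quadratic[symmetric] by (simp only: mult_minus_left mult_minus_right)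
  have "fE1 * (cA * cB) \<noteq> 0" by (rule fps_nonzeroI) simp
  from mult_left_cancel[THEN iffD1, OF this eq] show ?thesis .
qed

text \<open>Multiplication by the cube of \<open>Q8\<close> removes E1^3. The factor of
  \<open>Phi\<close> on the left is now a series in q^5, and the right side is spelled out in
  monomials so that residue classes can be read off.\<close>

lemma Phi_expansion:
  "10 * (cE^3 * ((cA^34 * cB^34) * Phi)) = - (cA^3 * cB^3 * (6 * (cY^0 * cB^25) + 25 * (cY^1 * cB^24)
      + 75 * (cY^2 * cB^23) + 195 * (cY^3 * cB^22) + 460 * (cY^4 * cB^21) + 825 * (cY^5 * cB^20)
      + 1350 * (cY^6 * cB^19) + 2000 * (cY^7 * cB^18) + 2535 * (cY^8 * cB^17) + 2430 * (cY^9 * cB^16)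
      + 2385 * (cY^10 * cB^15) + 1875 * (cY^11 * cB^14) + 825 * (cY^12 * cB^13) + 155 * (cY^13 * cB^12)
      + 915 * (cY^14 * cB^11) + 615 * (cY^15 * cB^10) + 225 * (cY^16 * cB^9) + 450 * (cY^17 * cB^8)
      - 435 * (cY^18 * cB^7) + 470 * (cY^19 * cB^6) - 240 * (cY^20 * cB^5) + 225 * (cY^21 * cB^4)
      - 100 * (cY^22 * cB^3) + 45 * (cY^23 * cB^2) - 15 * (cY^24 * cB^1)
      + 7 * (cY^25 * cB^0)) + cE^2 * (- 6 * (cY^0 * cB^30) - 35 * (cY^1 * cB^29) - 175 * (cY^2 * cB^28)
      - 485 * (cY^3 * cB^27) - 1360 * (cY^4 * cB^26) - 2997 * (cY^5 * cB^25) - 6125 * (cY^6 * cB^24)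
      - 9825 * (cY^7 * cB^23) - 16450 * (cY^8 * cB^22) - 20650 * (cY^9 * cB^21) - 26260 * (cY^10 * cB^20)
      - 23725 * (cY^11 * cB^19) - 28725 * (cY^12 * cB^18) - 10450 * (cY^13 * cB^17) - 19925 * (cY^14 * cB^16)
      + 2090 * (cY^15 * cB^15) - 20650 * (cY^16 * cB^14) + 16325 * (cY^17 * cB^13) - 34200 * (cY^18 * cB^12)
      + 31625 * (cY^19 * cB^11) - 33665 * (cY^20 * cB^10) + 27650 * (cY^21 * cB^9) - 21650 * (cY^22 * cB^8)
      + 13500 * (cY^23 * cB^7) - 8275 * (cY^24 * cB^6) + 4173 * (cY^25 * cB^5) - 1895 * (cY^26 * cB^4)
      + 700 * (cY^27 * cB^3) - 245 * (cY^28 * cB^2) + 55 * (cY^29 * cB^1) - 9 * (cY^30 * cB^0)))"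
proof -
  let ?Q = "1 * (cY^0 * cB^24) + 3 * (cY^1 * cB^23) + 9 * (cY^2 * cB^22) + 22 * (cY^3 * cB^21)
      + 51 * (cY^4 * cB^20) + 78 * (cY^5 * cB^19) + 134 * (cY^6 * cB^18) + 177 * (cY^7 * cB^17)
      + 216 * (cY^8 * cB^16) + 153 * (cY^9 * cB^15) + 219 * (cY^10 * cB^14) + 57 * (cY^11 * cB^13)
      + 71 * (cY^12 * cB^12) - 57 * (cY^13 * cB^11) + 219 * (cY^14 * cB^10) - 153 * (cY^15 * cB^9)
      + 216 * (cY^16 * cB^8) - 177 * (cY^17 * cB^7) + 134 * (cY^18 * cB^6) - 78 * (cY^19 * cB^5)
      + 51 * (cY^20 * cB^4) - 22 * (cY^21 * cB^3) + 9 * (cY^22 * cB^2) - 3 * (cY^23 * cB^1)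
      + 1 * (cY^24 * cB^0)"
  have "10 * (cE^3 * ((cA^34 * cB^34) * Phi)) = 10 * Phi * (cA * cB)^4 * (cE^3 * (cA * cB)^30)" by algebra
  also have "\<dots> = (10 * Phi * fE1^3 * (cA * cB)^4) * ?Q" unfolding E1_Q8_cube[symmetric] by algebra
  also have "\<dots> = - (cA^3 * cB^3 * ((6 * (cY^0 * cB^1)
      + 7 * (cY^1 * cB^0)) * ?Q) + cE^2 * ((- 6 * (cY^0 * cB^6) - 17 * (cY^1 * cB^5) - 70 * (cY^2 * cB^4)
      + 10 * (cY^3 * cB^3) - 80 * (cY^4 * cB^2) + 28 * (cY^5 * cB^1) - 9 * (cY^6 * cB^0)) * ?Q))"
    unfolding Phi_identity by algebra
  finally show ?thesis unfolding T6_Q24 T1_Q24 .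
qed

section \<open>Extraction of the classes 2 and 4, and the closed forms\<close>

lemma section5_neg_numeral [simp]: "section5 r (- numeral k * f) = - numeral k * section5 r f"
  by (simp only: mult_minus_left section5_uminus section5_numeral)

text \<open>Only the exponents 2, 7, 12, ... of \<open>cY\<close> survive; the outer powers of
  \<open>cE\<close>, \<open>cA\<close> and \<open>cB\<close> pass through as series in q^5.\<close>

lemma Phi_section5_2:
  "10 * (fE5^3 * ((fA^34 * fB^34) * section5 2 Phi)) = - (fA^3 * fB^3 * (75 * (fps_X^0 * fA^2 * fB^23) + 2000 * (fps_X^1 * fA^7 * fB^18) + 825 * (fps_X^2 * fA^12 * fB^13) + 450 * (fps_X^3 * fA^17 * fB^8) - 100 * (fps_X^4 * fA^22 * fB^3)) + fE5^2 * (- 175 * (fps_X^0 * fA^2 * fB^28) - 9825 * (fps_X^1 * fA^7 * fB^23) - 28725 * (fps_X^2 * fA^12 * fB^18) + 16325 * (fps_X^3 * fA^17 * fB^13) - 21650 * (fps_X^4 * fA^22 * fB^8) + 700 * (fps_X^5 * fA^27 * fB^3)))"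
proof -
  have r: "(2 :: nat) < 5" by simp
  have "section5 2 (10 * (cE^3 * ((cA^34 * cB^34) * Phi))) = section5 2 (- (cA^3 * cB^3 * (6 * (cY^0 * cB^25)
      + 25 * (cY^1 * cB^24) + 75 * (cY^2 * cB^23) + 195 * (cY^3 * cB^22) + 460 * (cY^4 * cB^21)
      + 825 * (cY^5 * cB^20) + 1350 * (cY^6 * cB^19) + 2000 * (cY^7 * cB^18) + 2535 * (cY^8 * cB^17)
      + 2430 * (cY^9 * cB^16) + 2385 * (cY^10 * cB^15) + 1875 * (cY^11 * cB^14) + 825 * (cY^12 * cB^13)
      + 155 * (cY^13 * cB^12) + 915 * (cY^14 * cB^11) + 615 * (cY^15 * cB^10) + 225 * (cY^16 * cB^9)
      + 450 * (cY^17 * cB^8) - 435 * (cY^18 * cB^7) + 470 * (cY^19 * cB^6) - 240 * (cY^20 * cB^5)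
      + 225 * (cY^21 * cB^4) - 100 * (cY^22 * cB^3) + 45 * (cY^23 * cB^2) - 15 * (cY^24 * cB^1)
      + 7 * (cY^25 * cB^0)) + cE^2 * (- 6 * (cY^0 * cB^30) - 35 * (cY^1 * cB^29) - 175 * (cY^2 * cB^28)
      - 485 * (cY^3 * cB^27) - 1360 * (cY^4 * cB^26) - 2997 * (cY^5 * cB^25) - 6125 * (cY^6 * cB^24)
      - 9825 * (cY^7 * cB^23) - 16450 * (cY^8 * cB^22) - 20650 * (cY^9 * cB^21) - 26260 * (cY^10 * cB^20)
      - 23725 * (cY^11 * cB^19) - 28725 * (cY^12 * cB^18) - 10450 * (cY^13 * cB^17) - 19925 * (cY^14 * cB^16)
      + 2090 * (cY^15 * cB^15) - 20650 * (cY^16 * cB^14) + 16325 * (cY^17 * cB^13) - 34200 * (cY^18 * cB^12)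
      + 31625 * (cY^19 * cB^11) - 33665 * (cY^20 * cB^10) + 27650 * (cY^21 * cB^9) - 21650 * (cY^22 * cB^8)
      + 13500 * (cY^23 * cB^7) - 8275 * (cY^24 * cB^6) + 4173 * (cY^25 * cB^5) - 1895 * (cY^26 * cB^4)
      + 700 * (cY^27 * cB^3) - 245 * (cY^28 * cB^2) + 55 * (cY^29 * cB^1) - 9 * (cY^30 * cB^0))))"
    by (rule arg_cong[OF Phi_expansion])
  then show ?thesis
    unfolding section5_numeral section5_uminus section5_add section5_diff section5_neg_numeral mult_1_left section5_compose_E[OF r] section5_compose_AB[OF r] section5_monomial[OF r]
    by simp
qed

lemma Phi_section5_4:
  "10 * (fE5^3 * ((fA^34 * fB^34) * section5 4 Phi)) = - (fA^3 * fB^3 * (460 * (fps_X^0 * fA^4 * fB^21) + 2430 * (fps_X^1 * fA^9 * fB^16) + 915 * (fps_X^2 * fA^14 * fB^11) + 470 * (fps_X^3 * fA^19 * fB^6) - 15 * (fps_X^4 * fA^24 * fB^1)) + fE5^2 * (- 1360 * (fps_X^0 * fA^4 * fB^26) - 20650 * (fps_X^1 * fA^9 * fB^21) - 19925 * (fps_X^2 * fA^14 * fB^16) + 31625 * (fps_X^3 * fA^19 * fB^11) - 8275 * (fps_X^4 * fA^24 * fB^6) + 55 * (fps_X^5 * fA^29 * fB^1)))"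
proof -
  have r: "(4 :: nat) < 5" by simp
  have "section5 4 (10 * (cE^3 * ((cA^34 * cB^34) * Phi))) = section5 4 (- (cA^3 * cB^3 * (6 * (cY^0 * cB^25)
      + 25 * (cY^1 * cB^24) + 75 * (cY^2 * cB^23) + 195 * (cY^3 * cB^22) + 460 * (cY^4 * cB^21)
      + 825 * (cY^5 * cB^20) + 1350 * (cY^6 * cB^19) + 2000 * (cY^7 * cB^18) + 2535 * (cY^8 * cB^17)
      + 2430 * (cY^9 * cB^16) + 2385 * (cY^10 * cB^15) + 1875 * (cY^11 * cB^14) + 825 * (cY^12 * cB^13)
      + 155 * (cY^13 * cB^12) + 915 * (cY^14 * cB^11) + 615 * (cY^15 * cB^10) + 225 * (cY^16 * cB^9)
      + 450 * (cY^17 * cB^8) - 435 * (cY^18 * cB^7) + 470 * (cY^19 * cB^6) - 240 * (cY^20 * cB^5)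
      + 225 * (cY^21 * cB^4) - 100 * (cY^22 * cB^3) + 45 * (cY^23 * cB^2) - 15 * (cY^24 * cB^1)
      + 7 * (cY^25 * cB^0)) + cE^2 * (- 6 * (cY^0 * cB^30) - 35 * (cY^1 * cB^29) - 175 * (cY^2 * cB^28)
      - 485 * (cY^3 * cB^27) - 1360 * (cY^4 * cB^26) - 2997 * (cY^5 * cB^25) - 6125 * (cY^6 * cB^24)
      - 9825 * (cY^7 * cB^23) - 16450 * (cY^8 * cB^22) - 20650 * (cY^9 * cB^21) - 26260 * (cY^10 * cB^20)
      - 23725 * (cY^11 * cB^19) - 28725 * (cY^12 * cB^18) - 10450 * (cY^13 * cB^17) - 19925 * (cY^14 * cB^16)
      + 2090 * (cY^15 * cB^15) - 20650 * (cY^16 * cB^14) + 16325 * (cY^17 * cB^13) - 34200 * (cY^18 * cB^12)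
      + 31625 * (cY^19 * cB^11) - 33665 * (cY^20 * cB^10) + 27650 * (cY^21 * cB^9) - 21650 * (cY^22 * cB^8)
      + 13500 * (cY^23 * cB^7) - 8275 * (cY^24 * cB^6) + 4173 * (cY^25 * cB^5) - 1895 * (cY^26 * cB^4)
      + 700 * (cY^27 * cB^3) - 245 * (cY^28 * cB^2) + 55 * (cY^29 * cB^1) - 9 * (cY^30 * cB^0))))"
    by (rule arg_cong[OF Phi_expansion])
  then show ?thesis
    unfolding section5_numeral section5_uminus section5_add section5_diff section5_neg_numeral mult_1_left section5_compose_E[OF r] section5_compose_AB[OF r] section5_monomial[OF r]
    by simp
qed

text \<open>Brings every quotient to one common denominator \<open>D\<close> by the complementary
  factor \<open>s\<close>; a nonzero constant term of \<open>D\<close> makes all of them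
  units.\<close>

lemma fps_divide_eq_mult_inverse:
  fixes d s D N :: "'a::field fps"
  assumes "fps_nth D 0 \<noteq> 0" "d * s = D"
  shows "N / d = N * s * inverse D"
proof -
  have d0: "fps_nth d 0 \<noteq> 0" and s0: "fps_nth s 0 \<noteq> 0" using assms by auto
  have "inverse D = inverse d * inverse s" unfolding assms(2)[symmetric] by (rule fps_inverse_mult)
  then have "N * s * inverse D = N * inverse d * (inverse s * s)" by (simp only: mult_ac)
  then show ?thesis by (simp only: fps_divide_unit[OF d0] inverse_mult_eq_1[OF s0] mult_1_right)
qed

text \<open>Isolates one half as a single symbol, so that polynomial reasoning needs only the
  relation that its double is 1.\<close>

lemma fps_const_half: "fps_const (numeral n / 2) = fps_const (1/2) * (numeral n :: 'a::field_char_0 fps)"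
  by (simp add: numeral_fps_const)

text \<open>Stated for arbitrary series, since what is left is a polynomial identity once E1 is
  replaced by A B E5 and denominators are cleared.\<close>

lemma G2_closed_form:
  fixes A B E1 E5 q g :: "complex fps"
  assumes nth: "fps_nth A 0 = 1" "fps_nth B 0 = 1" "fps_nth E5 0 = 1" and E1: "E1 = A * B * E5"
    and g: "10 * (E5^3 * ((A^34 * B^34) * g)) = - (A^3 * B^3 * (75 * (q^0 * A^2 * B^23)
      + 2000 * (q^1 * A^7 * B^18) + 825 * (q^2 * A^12 * B^13) + 450 * (q^3 * A^17 * B^8)
      - 100 * (q^4 * A^22 * B^3)) + E5^2 * (- 175 * (q^0 * A^2 * B^28) - 9825 * (q^1 * A^7 * B^23)
      - 28725 * (q^2 * A^12 * B^18) + 16325 * (q^3 * A^17 * B^13) - 21650 * (q^4 * A^22 * B^8)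
      + 700 * (q^5 * A^27 * B^3)))"
  shows "g = - 70 * q^5 * (A^11 * E5^17) / (B^13 * E1^18)
         + 2165 * q^4 * (A^6 * E5^17) / (B^8 * E1^18)
         - fps_const (3265/2) * q^3 * (A * E5^17) / (B^3 * E1^18)
         + fps_const (5745/2) * q^2 * (B^2 * E5^17) / (A^4 * E1^18)
         + fps_const (1965/2) * q * (B^7 * E5^17) / (A^9 * E1^18)
         + fps_const (35/2) * (B^12 * E5^17) / (A^14 * E1^18)
         + 10 * q^4 * (A^9 * E5^15) / (B^10 * E1^18)
         - 45 * q^3 * (A^4 * E5^15) / (B^5 * E1^18)
         - fps_const (165/2) * q^2 * E5^15 / (A * E1^18)
         - 200 * q * (B^5 * E5^15) / (A^6 * E1^18)
         - fps_const (15/2) * (B^10 * E5^15) / (A^11 * E1^18)"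
proof -
  \<comment> \<open>E1^18 contributes 18 to each exponent; a further A^14 and B^15 cover every
    denominator of both closed forms.\<close>
  define D where "D = A^32 * B^33 * E5^18"
  define W where "W = inverse D"
  define hf where "hf = fps_const (1/2 :: complex)"
  have D0: "fps_nth D 0 \<noteq> 0" by (simp add: D_def nth)
  have DW: "D * W = 1" unfolding W_def by (rule inverse_mult_eq_1'[OF D0])
  have hf2: "2 * hf = 1" by (simp add: hf_def numeral_fps_const)
  note frac = fps_divide_eq_mult_inverse[OF D0, unfolded D_def[symmetric]]
  note halves = fps_const_half[where 'a = complex, folded hf_def]
  define c where "c = 10 * (E5^3 * (A^34 * B^34))"
  have c0: "c \<noteq> 0"
  proof
    assume "c = 0"
    then have "fps_nth c 0 = 0" by simp
    then show False by (simp add: c_def nth)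
  qed
  define Num where "Num = - 70 * (q^5 * A^25 * B^2 * E5^17)
         + 2165 * (q^4 * A^20 * B^7 * E5^17)
         - (hf * 3265) * (q^3 * A^15 * B^12 * E5^17)
         + (hf * 5745) * (q^2 * A^10 * B^17 * E5^17)
         + (hf * 1965) * (q^1 * A^5 * B^22 * E5^17)
         + (hf * 35) * (q^0 * A^0 * B^27 * E5^17)
         + 10 * (q^4 * A^23 * B^5 * E5^15)
         - 45 * (q^3 * A^18 * B^10 * E5^15)
         - (hf * 165) * (q^2 * A^13 * B^15 * E5^15)
         - 200 * (q^1 * A^8 * B^20 * E5^15)
         - (hf * 15) * (q^0 * A^3 * B^25 * E5^15)"
  have t0: "- 70 * q^5 * (A^11 * E5^17) / (B^13 * (A * B * E5)^18) = - 70 * q^5 * (A^11 * E5^17) * (A^14 * B^2) * W"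
    unfolding W_def by (rule frac) (unfold D_def, algebra)
  have t1: "2165 * q^4 * (A^6 * E5^17) / (B^8 * (A * B * E5)^18) = 2165 * q^4 * (A^6 * E5^17) * (A^14 * B^7) * W"
    unfolding W_def by (rule frac) (unfold D_def, algebra)
  have t2: "fps_const (3265/2) * q^3 * (A * E5^17) / (B^3 * (A * B * E5)^18) = fps_const (3265/2) * q^3 * (A * E5^17) * (A^14 * B^12) * W"
    unfolding W_def by (rule frac) (unfold D_def, algebra)
  have t3: "fps_const (5745/2) * q^2 * (B^2 * E5^17) / (A^4 * (A * B * E5)^18) = fps_const (5745/2) * q^2 * (B^2 * E5^17) * (A^10 * B^15) * W"
    unfolding W_def by (rule frac) (unfold D_def, algebra)
  have t4: "fps_const (1965/2) * q * (B^7 * E5^17) / (A^9 * (A * B * E5)^18) = fps_const (1965/2) * q * (B^7 * E5^17) * (A^5 * B^15) * W"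
    unfolding W_def by (rule frac) (unfold D_def, algebra)
  have t5: "fps_const (35/2) * (B^12 * E5^17) / (A^14 * (A * B * E5)^18) = fps_const (35/2) * (B^12 * E5^17) * (A^0 * B^15) * W"
    unfolding W_def by (rule frac) (unfold D_def, algebra)
  have t6: "10 * q^4 * (A^9 * E5^15) / (B^10 * (A * B * E5)^18) = 10 * q^4 * (A^9 * E5^15) * (A^14 * B^5) * W"
    unfolding W_def by (rule frac) (unfold D_def, algebra)
  have t7: "45 * q^3 * (A^4 * E5^15) / (B^5 * (A * B * E5)^18) = 45 * q^3 * (A^4 * E5^15) * (A^14 * B^10) * W"
    unfolding W_def by (rule frac) (unfold D_def, algebra)
  have t8: "fps_const (165/2) * q^2 * E5^15 / (A * (A * B * E5)^18) = fps_const (165/2) * q^2 * E5^15 * (A^13 * B^15) * W"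
    unfolding W_def by (rule frac) (unfold D_def, algebra)
  have t9: "200 * q * (B^5 * E5^15) / (A^6 * (A * B * E5)^18) = 200 * q * (B^5 * E5^15) * (A^8 * B^15) * W"
    unfolding W_def by (rule frac) (unfold D_def, algebra)
  have t10: "fps_const (15/2) * (B^10 * E5^15) / (A^11 * (A * B * E5)^18) = fps_const (15/2) * (B^10 * E5^15) * (A^3 * B^15) * W"
    unfolding W_def by (rule frac) (unfold D_def, algebra)

  have "c * (g * D) = (- (A^3 * B^3 * (75 * (q^0 * A^2 * B^23) + 2000 * (q^1 * A^7 * B^18)
      + 825 * (q^2 * A^12 * B^13) + 450 * (q^3 * A^17 * B^8)
      - 100 * (q^4 * A^22 * B^3)) + E5^2 * (- 175 * (q^0 * A^2 * B^28) - 9825 * (q^1 * A^7 * B^23)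
      - 28725 * (q^2 * A^12 * B^18) + 16325 * (q^3 * A^17 * B^13) - 21650 * (q^4 * A^22 * B^8)
      + 700 * (q^5 * A^27 * B^3)))) * D"
    unfolding g[symmetric] c_def by algebra
  also have "\<dots> = c * Num"
    unfolding c_def D_def Num_def using hf2 by algebra
  finally have "g * D = Num" using mult_left_cancel[THEN iffD1, OF c0] by blast
  then have "g * (D * W) = Num * W" by (simp only: mult.assoc[symmetric])
  then have gN: "g = Num * W" unfolding DW by simp
  show ?thesis
    unfolding E1 t0 t1 t2 t3 t4 t5 t6 t7 t8 t9 t10 unfolding gN Num_def halves by algebra
qed

text \<open>The hypothesis on \<open>S\<close> expresses it through A, B and E5, so the displayed
  split between the multiple of \<open>S\<close> and the rest is one of several. It is verified by
  substituting this expression for \<open>S\<close>.\<close>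

lemma G4_closed_form:
  fixes A B E1 E5 S q g :: "complex fps"
  assumes nth: "fps_nth A 0 = 1" "fps_nth B 0 = 1" "fps_nth E5 0 = 1" and E1: "E1 = A * B * E5"
    and S: "A^3 * B^2 * (B * E5 + 10 * S) = E5^3 * (B^5 - 3 * q * A^5)"
    and g: "10 * (E5^3 * ((A^34 * B^34) * g)) = - (A^3 * B^3 * (460 * (q^0 * A^4 * B^21)
      + 2430 * (q^1 * A^9 * B^16) + 915 * (q^2 * A^14 * B^11) + 470 * (q^3 * A^19 * B^6)
      - 15 * (q^4 * A^24 * B^1)) + E5^2 * (- 1360 * (q^0 * A^4 * B^26) - 20650 * (q^1 * A^9 * B^21)
      - 19925 * (q^2 * A^14 * B^16) + 31625 * (q^3 * A^19 * B^11) - 8275 * (q^4 * A^24 * B^6)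
      + 55 * (q^5 * A^29 * B^1)))"
  shows "g = 5 * S *
           (2 * q^4 * (A^11 * E5^14) / (B^13 * E1^18)
         - q^3 * (A^6 * E5^14) / (B^8 * E1^18)
         + 2108 * q^2 * (A * E5^14) / (B^3 * E1^18)
         - 4 * q * (B^2 * E5^14) / (A^4 * E1^18)
         - 3 * (B^7 * E5^14) / (A^9 * E1^18)
         - 5 * q^3 * (A^9 * E5^12) / (B^10 * E1^18)
         + 30 * q^2 * (A^4 * E5^12) / (B^5 * E1^18))

         - fps_const (5/2) * q^5 * (A^13 * E5^17) / (B^15 * E1^18)
         + 825 * q^4 * (A^8 * E5^17) / (B^10 * E1^18)
         + fps_const (1865/2) * q^2 * E5^17 / (A^2 * E1^18)
         + fps_const (4125/2) * q * (B^5 * E5^17) / (A^7 * E1^18)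
         + fps_const (275/2) * (B^10 * E5^17) / (A^12 * E1^18)
         - 5 * q^4 * (A^11 * E5^15) / (B^12 * E1^18)
         + fps_const (1895/2) * q^2 * (A * E5^15) / (B^2 * E1^18)
         - 245 * q * (B^3 * E5^15) / (A^4 * E1^18)
         - fps_const (95/2) * (B^8 * E5^15) / (A^9 * E1^18)
         - fps_const (5/2) * q^3 * (A^9 * E5^13) / (B^9 * E1^18)
         + 15 * q^2 * (A^4 * E5^13) / (B^4 * E1^18)"
proof -
  define D where "D = A^32 * B^33 * E5^18"
  define W where "W = inverse D"
  define hf where "hf = fps_const (1/2 :: complex)"
  have D0: "fps_nth D 0 \<noteq> 0" by (simp add: D_def nth)
  have DW: "D * W = 1" unfolding W_def by (rule inverse_mult_eq_1'[OF D0])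
  have hf2: "2 * hf = 1" by (simp add: hf_def numeral_fps_const)
  note frac = fps_divide_eq_mult_inverse[OF D0, unfolded D_def[symmetric]]
  note halves = fps_const_half[where 'a = complex, folded hf_def]
  \<comment> \<open>The extra factor \<open>A^3 * B^2\<close> is the one that accompanies
    \<open>S\<close> in its relation, so \<open>S\<close> can be replaced without division.\<close>
  define c where "c = A^3 * B^2 * (10 * (E5^3 * (A^34 * B^34)))"
  have c0: "c \<noteq> 0"
  proof
    assume "c = 0"
    then have "fps_nth c 0 = 0" by simp
    then show False by (simp add: c_def nth)
  qed
  have S': "A^3 * B^2 * (10 * S) = E5^3 * (B^5 - 3 * q * A^5) - A^3 * B^3 * E5" using S by algebra
  define NumS where "NumS = 2 * (q^4 * A^25 * B^2 * E5^14)
         - 1 * (q^3 * A^20 * B^7 * E5^14)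
         + 2108 * (q^2 * A^15 * B^12 * E5^14)
         - 4 * (q^1 * A^10 * B^17 * E5^14)
         - 3 * (q^0 * A^5 * B^22 * E5^14)
         - 5 * (q^3 * A^23 * B^5 * E5^12)
         + 30 * (q^2 * A^18 * B^10 * E5^12)"
  define Num where "Num = - (hf * 5) * (q^5 * A^27 * B^0 * E5^17)
         + 825 * (q^4 * A^22 * B^5 * E5^17)
         + (hf * 1865) * (q^2 * A^12 * B^15 * E5^17)
         + (hf * 4125) * (q^1 * A^7 * B^20 * E5^17)
         + (hf * 275) * (q^0 * A^2 * B^25 * E5^17)
         - 5 * (q^4 * A^25 * B^3 * E5^15)
         + (hf * 1895) * (q^2 * A^15 * B^13 * E5^15)
         - 245 * (q^1 * A^10 * B^18 * E5^15)
         - (hf * 95) * (q^0 * A^5 * B^23 * E5^15)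
         - (hf * 5) * (q^3 * A^23 * B^6 * E5^13)
         + 15 * (q^2 * A^18 * B^11 * E5^13)"
  have u0: "2 * q^4 * (A^11 * E5^14) / (B^13 * (A * B * E5)^18) = 2 * q^4 * (A^11 * E5^14) * (A^14 * B^2) * W"
    unfolding W_def by (rule frac) (unfold D_def, algebra)
  have u1: "q^3 * (A^6 * E5^14) / (B^8 * (A * B * E5)^18) = q^3 * (A^6 * E5^14) * (A^14 * B^7) * W"
    unfolding W_def by (rule frac) (unfold D_def, algebra)
  have u2: "2108 * q^2 * (A * E5^14) / (B^3 * (A * B * E5)^18) = 2108 * q^2 * (A * E5^14) * (A^14 * B^12) * W"
    unfolding W_def by (rule frac) (unfold D_def, algebra)
  have u3: "4 * q * (B^2 * E5^14) / (A^4 * (A * B * E5)^18) = 4 * q * (B^2 * E5^14) * (A^10 * B^15) * W"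
    unfolding W_def by (rule frac) (unfold D_def, algebra)
  have u4: "3 * (B^7 * E5^14) / (A^9 * (A * B * E5)^18) = 3 * (B^7 * E5^14) * (A^5 * B^15) * W"
    unfolding W_def by (rule frac) (unfold D_def, algebra)
  have u5: "5 * q^3 * (A^9 * E5^12) / (B^10 * (A * B * E5)^18) = 5 * q^3 * (A^9 * E5^12) * (A^14 * B^5) * W"
    unfolding W_def by (rule frac) (unfold D_def, algebra)
  have u6: "30 * q^2 * (A^4 * E5^12) / (B^5 * (A * B * E5)^18) = 30 * q^2 * (A^4 * E5^12) * (A^14 * B^10) * W"
    unfolding W_def by (rule frac) (unfold D_def, algebra)

  have t0: "fps_const (5/2) * q^5 * (A^13 * E5^17) / (B^15 * (A * B * E5)^18) = fps_const (5/2) * q^5 * (A^13 * E5^17) * (A^14 * B^0) * W"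
    unfolding W_def by (rule frac) (unfold D_def, algebra)
  have t1: "825 * q^4 * (A^8 * E5^17) / (B^10 * (A * B * E5)^18) = 825 * q^4 * (A^8 * E5^17) * (A^14 * B^5) * W"
    unfolding W_def by (rule frac) (unfold D_def, algebra)
  have t2: "fps_const (1865/2) * q^2 * E5^17 / (A^2 * (A * B * E5)^18) = fps_const (1865/2) * q^2 * E5^17 * (A^12 * B^15) * W"
    unfolding W_def by (rule frac) (unfold D_def, algebra)
  have t3: "fps_const (4125/2) * q * (B^5 * E5^17) / (A^7 * (A * B * E5)^18) = fps_const (4125/2) * q * (B^5 * E5^17) * (A^7 * B^15) * W"
    unfolding W_def by (rule frac) (unfold D_def, algebra)
  have t4: "fps_const (275/2) * (B^10 * E5^17) / (A^12 * (A * B * E5)^18) = fps_const (275/2) * (B^10 * E5^17) * (A^2 * B^15) * W"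
    unfolding W_def by (rule frac) (unfold D_def, algebra)
  have t5: "5 * q^4 * (A^11 * E5^15) / (B^12 * (A * B * E5)^18) = 5 * q^4 * (A^11 * E5^15) * (A^14 * B^3) * W"
    unfolding W_def by (rule frac) (unfold D_def, algebra)
  have t6: "fps_const (1895/2) * q^2 * (A * E5^15) / (B^2 * (A * B * E5)^18) = fps_const (1895/2) * q^2 * (A * E5^15) * (A^14 * B^13) * W"
    unfolding W_def by (rule frac) (unfold D_def, algebra)
  have t7: "245 * q * (B^3 * E5^15) / (A^4 * (A * B * E5)^18) = 245 * q * (B^3 * E5^15) * (A^10 * B^15) * W"
    unfolding W_def by (rule frac) (unfold D_def, algebra)
  have t8: "fps_const (95/2) * (B^8 * E5^15) / (A^9 * (A * B * E5)^18) = fps_const (95/2) * (B^8 * E5^15) * (A^5 * B^15) * W"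
    unfolding W_def by (rule frac) (unfold D_def, algebra)
  have t9: "fps_const (5/2) * q^3 * (A^9 * E5^13) / (B^9 * (A * B * E5)^18) = fps_const (5/2) * q^3 * (A^9 * E5^13) * (A^14 * B^6) * W"
    unfolding W_def by (rule frac) (unfold D_def, algebra)
  have t10: "15 * q^2 * (A^4 * E5^13) / (B^4 * (A * B * E5)^18) = 15 * q^2 * (A^4 * E5^13) * (A^14 * B^11) * W"
    unfolding W_def by (rule frac) (unfold D_def, algebra)

  have "c * (g * D) = A^3 * B^2 * (- (A^3 * B^3 * (460 * (q^0 * A^4 * B^21) + 2430 * (q^1 * A^9 * B^16)
      + 915 * (q^2 * A^14 * B^11) + 470 * (q^3 * A^19 * B^6)
      - 15 * (q^4 * A^24 * B^1)) + E5^2 * (- 1360 * (q^0 * A^4 * B^26) - 20650 * (q^1 * A^9 * B^21)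
      - 19925 * (q^2 * A^14 * B^16) + 31625 * (q^3 * A^19 * B^11) - 8275 * (q^4 * A^24 * B^6)
      + 55 * (q^5 * A^29 * B^1)))) * D"
    unfolding g[symmetric] c_def by algebra
  also have "\<dots> = (E5^3 * (B^5 - 3 * q * A^5) - A^3 * B^3 * E5) * (5 * (E5^3 * (A^34 * B^34)) * NumS) + c * Num"
    unfolding c_def D_def Num_def NumS_def using hf2 by algebra
  also have "\<dots> = c * (5 * S * NumS + Num)"
    unfolding S'[symmetric] c_def by algebra
  finally have "g * D = 5 * S * NumS + Num" using mult_left_cancel[THEN iffD1, OF c0] by blast
  then have "g * (D * W) = (5 * S * NumS + Num) * W" by (simp only: mult.assoc[symmetric])
  then have gN: "g = (5 * S * NumS + Num) * W" unfolding DW by simp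
  show ?thesis
    unfolding E1 u0 u1 u2 u3 u4 u5 u6 t0 t1 t2 t3 t4 t5 t6 t7 t8 t9 t10
    unfolding gN Num_def NumS_def halves by algebra
qed

theorem theorem1p4:
  fixes q A B E1 E5 S :: "complex fps" and G :: "nat \<Rightarrow> complex fps"
  defines "q \<equiv> fps_X"
  defines "A \<equiv> qpochs [q, q^4] (q^5)"
    and "B \<equiv> qpochs [q^2, q^3] (q^5)"
    and "E1 \<equiv> qpoch q q"
    and "E5 \<equiv> qpoch (q^5) (q^5)"
    and "S \<equiv> (\<Sum>\<^sub>\<infinity>n::int. fps_const ((-1) powi n * of_int n) * q ^ nat (n * (5 * n + 1) div 2))"
    and "G \<equiv> (\<lambda>r. Abs_fps (\<lambda>n.
           of_nat (NB 5 1 5 (5 * n + r)) - of_nat (NB 5 4 5 (5 * n + r))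
           + 3 * of_nat (NB 5 2 5 (5 * n + r)) - 3 * of_nat (NB 5 3 5 (5 * n + r))))"
  shows "G 2 =
         - 70 * q^5 * (A^11 * E5^17) / (B^13 * E1^18)
         + 2165 * q^4 * (A^6 * E5^17) / (B^8 * E1^18)
         - fps_const (3265/2) * q^3 * (A * E5^17) / (B^3 * E1^18)
         + fps_const (5745/2) * q^2 * (B^2 * E5^17) / (A^4 * E1^18)
         + fps_const (1965/2) * q * (B^7 * E5^17) / (A^9 * E1^18)
         + fps_const (35/2) * (B^12 * E5^17) / (A^14 * E1^18)
         + 10 * q^4 * (A^9 * E5^15) / (B^10 * E1^18)
         - 45 * q^3 * (A^4 * E5^15) / (B^5 * E1^18)
         - fps_const (165/2) * q^2 * E5^15 / (A * E1^18)
         - 200 * q * (B^5 * E5^15) / (A^6 * E1^18)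
         - fps_const (15/2) * (B^10 * E5^15) / (A^11 * E1^18)
    \<and> G 4 =
         5 * S *
           (2 * q^4 * (A^11 * E5^14) / (B^13 * E1^18)
            - q^3 * (A^6 * E5^14) / (B^8 * E1^18)
            + 2108 * q^2 * (A * E5^14) / (B^3 * E1^18)
            - 4 * q * (B^2 * E5^14) / (A^4 * E1^18)
            - 3 * (B^7 * E5^14) / (A^9 * E1^18)
            - 5 * q^3 * (A^9 * E5^12) / (B^10 * E1^18)
            + 30 * q^2 * (A^4 * E5^12) / (B^5 * E1^18))
         - fps_const (5/2) * q^5 * (A^13 * E5^17) / (B^15 * E1^18)
         + 825 * q^4 * (A^8 * E5^17) / (B^10 * E1^18)
         + fps_const (1865/2) * q^2 * E5^17 / (A^2 * E1^18)
         + fps_const (4125/2) * q * (B^5 * E5^17) / (A^7 * E1^18)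
         + fps_const (275/2) * (B^10 * E5^17) / (A^12 * E1^18)
         - 5 * q^4 * (A^11 * E5^15) / (B^12 * E1^18)
         + fps_const (1895/2) * q^2 * (A * E5^15) / (B^2 * E1^18)
         - 245 * q * (B^3 * E5^15) / (A^4 * E1^18)
         - fps_const (95/2) * (B^8 * E5^15) / (A^9 * E1^18)
         - fps_const (5/2) * q^3 * (A^9 * E5^13) / (B^9 * E1^18)
         + 15 * q^2 * (A^4 * E5^13) / (B^4 * E1^18)"
proof -
  have A: "A = fA" and B: "B = fB" and E1: "E1 = fE1" and E5: "E5 = fE5"
    unfolding A_def B_def E1_def E5_def q_def fA_def fB_def fE1_def fE5_def by (rule refl)+
  have S: "S = fS"
    unfolding S_def q_def by (rule fS_eq)
  have G: "G r = section5 r Phi" for r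
    unfolding G_def section5_def Phi_def by simp
  note g2 = G2_closed_form[OF fps_nth_0_products(1,2,4) fE1_eq Phi_section5_2]
  note g4 = G4_closed_form[OF fps_nth_0_products(1,2,4) fE1_eq weighted_theta1 Phi_section5_4]
  show ?thesis
    unfolding A B E1 E5 S G q_def by (intro conjI g2 g4)
qed

end
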